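(* Let $P(D)=\sum_{|\alpha|\le m}c_\alpha D^\alpha$ be a partial differential operator on $\mathbb{R}^n$ with coefficients in $\widetilde{\mathbb{C}}$ such that $\widetilde{P}(\xi_0)$ is invertible in $\widetilde{\mathbb{R}}$ for some $\xi_0\in\mathbb{R}^n$. Then the equation $P(D)u=v$ (i) has a solution $u\in\mathcal{G}(\mathbb{R}^n)$ if $v\in\mathcal{G}_c(\mathbb{R}^n)$; (ii) has a solution $u\in\mathcal{G}^\infty(\mathbb{R}^n)$ if $v\in\mathcal{G}^\infty_c(\mathbb{R}^n)$; (iii) has a solution $u\in\mathcal{L}(\mathcal{G}_c(\mathbb{R}^n),\widetilde{\mathbb{C}})$ if $v\in\mathcal{L}(\mathcal{G}(\mathbb{R}^n),\widetilde{\mathbb{C}})$; (iv) has a solution $u\in\mathcal{L}_{\rm b}(\mathcal{G}_c(\mathbb{R}^n),\widetilde{\mathbb{C}})$ if $v\in\mathcal{L}_{\rm b}(\mathcal{G}(\mathbb{R}^n),\widetilde{\mathbb{C}})$.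
   Context: All nets are indexed by $\varepsilon\in(0,1]$; $O(\cdot)$ is as $\varepsilon\to0$. $\widetilde{\mathbb{C}}$ (resp. $\widetilde{\mathbb{R}}$) is the ring of complex (resp. real) nets that are moderate ($\exists N\in\mathbb{N}$: $|r_\varepsilon|=O(\varepsilon^{-N})$) modulo negligible nets ($\forall q\in\mathbb{N}$: $|r_\varepsilon|=O(\varepsilon^{q})$). $\mathcal{G}(\Omega)$ ($\Omega\subseteq\mathbb{R}^n$ open) is the Colombeau algebra: nets $(u_\varepsilon)_\varepsilon$ in $C^\infty(\Omega)$ with $\forall K\Subset\Omega\,\forall\alpha\,\exists N$: $\sup_K|\partial^\alpha u_\varepsilon|=O(\varepsilon^{-N})$, modulo nets with $\forall K\,\forall\alpha\,\forall q$: $\sup_K|\partial^\alpha u_\varepsilon|=O(\varepsilon^q)$. $\mathcal{G}^\infty(\Omega)\subseteq\mathcal{G}(\Omega)$ is the subalgebra of elements having a representative with $\forall K\,\exists N\,\forall\alpha$: $\sup_K|\partial^\alpha u_\varepsilon|=O(\varepsilon^{-N})$. $\mathcal{G}_c(\Omega)$ consists of the elements of $\mathcal{G}(\Omega)$ with compact support (representatives are chosen with supports in one compact set independent of $\varepsilon$); $\mathcal{G}^\infty_c=\mathcal{G}^\infty\cap\mathcal{G}_c$. Topology: $\mathcal{G}(\Omega)$ carries the ultra-pseudo-seminorms $e^{-\mathrm{v}_{K,j}(u)}$, $K\Subset\Omega$, $j\in\mathbb{N}$, with $\mathrm{v}_{K,j}(u)=\sup\{b\in\mathbb{R}:\sup_{x\in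 K,|\alpha|\le j}|\partial^\alpha u_\varepsilon(x)|=O(\varepsilon^b)\}$. $\mathcal{G}_K(\Omega)=\{u\in\mathcal{G}_c(\Omega):\mathrm{supp}\,u\subseteq K\}$ carries the analogous ultra-pseudo-seminorms computed on a compact neighbourhood $K'$ of $K$; $\mathcal{G}_c(\Omega)$ is the strict inductive limit of the $\mathcal{G}_K(\Omega)$; $\widetilde{\mathbb{C}}$ carries $|r|_{\rm e}=e^{-\mathrm{v}(r)}$, $\mathrm{v}(r)=\sup\{b:|r_\varepsilon|=O(\varepsilon^b)\}$. $\mathcal{L}(\cdot,\widetilde{\mathbb{C}})$ denotes continuous $\widetilde{\mathbb{C}}$-linear functionals. $T\in\mathcal{L}(\mathcal{G}_c(\Omega),\widetilde{\mathbb{C}})$ is basic ($T\in\mathcal{L}_{\rm b}(\mathcal{G}_c(\Omega),\widetilde{\mathbb{C}})$) if there is a net $(T_\varepsilon)_\varepsilon$ in $\mathcal{D}'(\Omega)$ such that $\forall K\Subset\Omega\ \exists j,N\in\mathbb{N},c>0,\eta\in(0,1]$: $|T_\varepsilon(f)|\le c\,\varepsilon^{-N}\sup_{x\in K,|\alpha|\le j}|\partial^\alpha f(x)|$ for all $f\in C^\infty_K(\Omega)$, $\varepsilon\in(0,\eta]$, and $T(u)=[(T_\varepsilon(u_\varepsilon))_\varepsilon]$ for all $u\in\mathcal{G}_c(\Omega)$. $T\in\mathcal{L}(\mathcal{G}(\Omega),\widetilde{\mathbb{C}})$ is basic ($T\in\mathcal{L}_{\rm b}(\mathcal{G}(\Omega),\widetilde{\mathbb{C}})$)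 if there are a net $(T_\varepsilon)_\varepsilon$ in $\mathcal{E}'(\Omega)$ and $K\Subset\Omega$, $j,N\in\mathbb{N}$, $c>0$, $\eta\in(0,1]$ such that the same estimate holds for all $f\in C^\infty(\Omega)$, $\varepsilon\in(0,\eta]$, and $T(u)=[(T_\varepsilon(u_\varepsilon))_\varepsilon]$ for all $u\in\mathcal{G}(\Omega)$. $\mathcal{L}(\mathcal{G}(\Omega),\widetilde{\mathbb{C}})$ is identified, by restriction to $\mathcal{G}_c(\Omega)$, with the set of functionals in $\mathcal{L}(\mathcal{G}_c(\Omega),\widetilde{\mathbb{C}})$ with compact support. $D^\alpha=(-i)^{|\alpha|}\partial^\alpha$; on functionals $P(D)T(u)=T({}^tP(D)u)$ with ${}^tP(D)=\sum(-1)^{|\alpha|}c_\alpha D^\alpha$. For representatives $(c_{\alpha,\varepsilon})_\varepsilon$ of $c_\alpha$ put $P_\varepsilon(\xi)=\sum_{|\alpha|\le m}c_{\alpha,\varepsilon}\xi^\alpha$, $\widetilde{P_\varepsilon}(\xi)=\big(\sum_{|\alpha|\le m}|\partial^\alpha P_\varepsilon(\xi)|^2\big)^{1/2}$, and $\widetilde{P}(\xi)=[(\widetilde{P_\varepsilon}(\xi))_\varepsilon]\in\widetilde{\mathbb{R}}$. *)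

theory Defs
  imports "HOL-Analysis.Analysis" "HOL-Library.Landau_Symbols"
begin

section \<open>Generalized numbers\<close>

text \<open>
  Nets are functions of a real parameter \<open>e\<close>, of which only the values for \<open>e \<in> {0<..1}\<close>
  matter; asymptotic conditions as \<open>e \<rightarrow> 0\<close> are stated along \<^term>\<open>at_right (0::real)\<close>.
\<close>

definition moderate :: "(real \<Rightarrow> 'a::real_normed_field) \<Rightarrow> bool" where
  "moderate r \<longleftrightarrow> (\<exists>N::nat. (\<lambda>e. norm (r e)) \<in> O[at_right 0](\<lambda>e. e powr - real N))"

definition negligible_net :: "(real \<Rightarrow> 'a::real_normed_field) \<Rightarrow> bool" where
  "negligible_net r \<longleftrightarrow> (\<forall>q::nat. (\<lambda>e. norm (r e)) \<in> O[at_right 0](\<lambda>e. e powr real q))"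

definition gen_eq :: "(real \<Rightarrow> 'a::real_normed_field) \<Rightarrow> (real \<Rightarrow> 'a) \<Rightarrow> bool" where
  "gen_eq r s \<longleftrightarrow> moderate r \<and> moderate s \<and> negligible_net (\<lambda>e. r e - s e)"

lemma powr_bigo_at_right_0:
  assumes "a \<le> b"
  shows "(\<lambda>e::real. e powr b) \<in> O[at_right 0](\<lambda>e. e powr a)"
proof (rule le_imp_bigo_real[of 1])
  have "eventually (\<lambda>e::real. e \<in> {0<..<1}) (at_right 0)"
    by (rule eventually_at_right_real) simp
  then show "eventually (\<lambda>e::real. e powr b \<le> 1 * e powr a) (at_right 0)"
    by eventually_elim (use assms in \<open>auto intro: powr_mono'\<close>)
qed auto

lemma bigo_powr_weaken:
  assumes "f \<in> O[at_right 0](\<lambda>e::real. e powr b)" "a \<le> b"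
  shows "f \<in> O[at_right 0](\<lambda>e::real. e powr a)"
  using assms landau_o.big_trans powr_bigo_at_right_0 by blast

lemma bigo_bound:
  fixes f g :: "real \<Rightarrow> real"
  assumes "eventually (\<lambda>e. \<bar>f e\<bar> \<le> g e) (at_right 0)" "g \<in> O[at_right 0](h)"
  shows "f \<in> O[at_right 0](h)"
proof -
  have "f \<in> O[at_right 0](g)"
    by (rule bigoI[of _ 1]) (use assms(1) in \<open>auto elim!: eventually_mono\<close>)
  then show ?thesis using assms(2) landau_o.big_trans by blast
qed

lemma eventually_unit_interval: "eventually (\<lambda>e::real. e \<in> {0<..1}) (at_right 0)"
  using eventually_at_right_real[of 0 "1::real"] by (auto elim: eventually_mono)

lemma bigo_powr_mult:
  fixes f g :: "real \<Rightarrow> real"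
  assumes "f \<in> O[at_right 0](\<lambda>e. e powr a)" "g \<in> O[at_right 0](\<lambda>e. e powr b)"
  shows "(\<lambda>e. f e * g e) \<in> O[at_right 0](\<lambda>e. e powr (a + b))"
  using landau_o.big.mult[OF assms] by (simp add: powr_add)

lemma moderate_bound:
  fixes r :: "real \<Rightarrow> 'a::real_normed_field"
  assumes "eventually (\<lambda>e. norm (r e) \<le> g e) (at_right 0)" "moderate (g :: real \<Rightarrow> real)"
  shows "moderate r"
proof -
  from assms(2) obtain N where N: "(\<lambda>e. norm (g e)) \<in> O[at_right 0](\<lambda>e. e powr - real N)"
    unfolding moderate_def by blast
  have "(\<lambda>e. norm (r e)) \<in> O[at_right 0](\<lambda>e. e powr - real N)"
    by (rule bigo_bound[OF _ N]) (use assms(1) in \<open>auto elim!: eventually_mono\<close>)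
  then show ?thesis unfolding moderate_def by blast
qed

lemma negligible_net_bound:
  fixes r :: "real \<Rightarrow> 'a::real_normed_field"
  assumes "eventually (\<lambda>e. norm (r e) \<le> g e) (at_right 0)" "negligible_net (g :: real \<Rightarrow> real)"
  shows "negligible_net r"
  unfolding negligible_net_def
proof
  fix q :: nat
  have N: "(\<lambda>e. norm (g e)) \<in> O[at_right 0](\<lambda>e. e powr real q)"
    using assms(2) unfolding negligible_net_def by blast
  show "(\<lambda>e. norm (r e)) \<in> O[at_right 0](\<lambda>e. e powr real q)"
    by (rule bigo_bound[OF _ N]) (use assms(1) in \<open>auto elim!: eventually_mono\<close>)
qed

lemma moderate_norm [simp]: "moderate (\<lambda>e. norm (r e)) \<longleftrightarrow> moderate r"
  by (simp add: moderate_def)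

lemma negligible_net_norm [simp]: "negligible_net (\<lambda>e. norm (r e)) \<longleftrightarrow> negligible_net r"
  by (simp add: negligible_net_def)

lemma moderate_const [simp]: "moderate (\<lambda>_. c)"
  unfolding moderate_def
proof (rule exI[of _ 0])
  have "(\<lambda>e. norm c) \<in> O[at_right 0](\<lambda>e::real. 1)" by simp
  also have "(\<lambda>e::real. 1) \<in> O[at_right 0](\<lambda>e::real. e powr - real 0)"
    by (rule le_imp_bigo_real[of 1]) (auto simp: eventually_at_right_less eventually_mono[OF eventually_at_right_less])
  finally show "(\<lambda>e. norm c) \<in> O[at_right 0](\<lambda>e::real. e powr - real 0)" .
qed

lemma negligible_net_zero [simp]: "negligible_net (\<lambda>_. 0)"
  by (simp add: negligible_net_def)

lemma negligible_imp_moderate: "negligible_net r \<Longrightarrow> moderate r"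
  unfolding negligible_net_def moderate_def by (rule exI[of _ 0]) (metis of_nat_0 minus_zero)

lemma moderate_add:
  assumes "moderate r" "moderate s"
  shows "moderate (\<lambda>e. r e + s e)"
proof -
  from assms obtain N M where
    N: "(\<lambda>e. norm (r e)) \<in> O[at_right 0](\<lambda>e. e powr - real N)" and
    M: "(\<lambda>e. norm (s e)) \<in> O[at_right 0](\<lambda>e. e powr - real M)"
    unfolding moderate_def by blast
  have "(\<lambda>e. norm (r e) + norm (s e)) \<in> O[at_right 0](\<lambda>e. e powr - real (max N M))"
    by (intro sum_in_bigo bigo_powr_weaken[OF N] bigo_powr_weaken[OF M]) auto
  then have "(\<lambda>e. norm (r e + s e)) \<in> O[at_right 0](\<lambda>e. e powr - real (max N M))"
    by (rule bigo_bound[rotated]) (simp add: norm_triangle_ineq)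
  then show ?thesis unfolding moderate_def by blast
qed

lemma negligible_net_add:
  assumes "negligible_net r" "negligible_net s"
  shows "negligible_net (\<lambda>e. r e + s e)"
  unfolding negligible_net_def
proof
  fix q :: nat
  have "(\<lambda>e. norm (r e) + norm (s e)) \<in> O[at_right 0](\<lambda>e. e powr real q)"
    using assms by (intro sum_in_bigo) (auto simp: negligible_net_def)
  then show "(\<lambda>e. norm (r e + s e)) \<in> O[at_right 0](\<lambda>e. e powr real q)"
    by (rule bigo_bound[rotated]) (simp add: norm_triangle_ineq)
qed

lemma moderate_mult:
  assumes "moderate r" "moderate s"
  shows "moderate (\<lambda>e. r e * s e)"
proof -
  from assms obtain N M where
    N: "(\<lambda>e. norm (r e)) \<in> O[at_right 0](\<lambda>e. e powr - real N)" and
    M: "(\<lambda>e. norm (s e)) \<in> O[at_right 0](\<lambda>e. e powr - real M)"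
    unfolding moderate_def by blast
  have "(\<lambda>e. norm (r e * s e)) \<in> O[at_right 0](\<lambda>e. e powr - real (N + M))"
    using bigo_powr_mult[OF N M] by (simp add: norm_mult)
  then show ?thesis unfolding moderate_def by blast
qed

lemma negligible_net_mult:
  assumes "moderate r" "negligible_net s"
  shows "negligible_net (\<lambda>e. r e * s e)"
  unfolding negligible_net_def
proof
  fix q :: nat
  from assms(1) obtain N where
    N: "(\<lambda>e. norm (r e)) \<in> O[at_right 0](\<lambda>e. e powr - real N)"
    unfolding moderate_def by blast
  have M: "(\<lambda>e. norm (s e)) \<in> O[at_right 0](\<lambda>e. e powr real (N + q))"
    using assms(2) unfolding negligible_net_def by blast
  show "(\<lambda>e. norm (r e * s e)) \<in> O[at_right 0](\<lambda>e. e powr real q)"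
    using bigo_powr_mult[OF N M] by (simp add: norm_mult)
qed

lemma moderate_uminus [simp]: "moderate (\<lambda>e. - r e) \<longleftrightarrow> moderate r"
  by (simp add: moderate_def)

lemma negligible_net_uminus [simp]: "negligible_net (\<lambda>e. - r e) \<longleftrightarrow> negligible_net r"
  by (simp add: negligible_net_def)

lemma moderate_diff: "moderate r \<Longrightarrow> moderate s \<Longrightarrow> moderate (\<lambda>e. r e - s e)"
  using moderate_add[of r "\<lambda>e. - s e"] by simp

lemma moderate_sum:
  "(\<And>i. i \<in> I \<Longrightarrow> moderate (r i)) \<Longrightarrow> moderate (\<lambda>e. \<Sum>i\<in>I. r i e)"
  by (induction I rule: infinite_finite_induct) (auto intro: moderate_add)

lemma negligible_net_sum:
  "(\<And>i. i \<in> I \<Longrightarrow> negligible_net (r i)) \<Longrightarrow> negligible_net (\<lambda>e. \<Sum>i\<in>I. r i e)"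
  by (induction I rule: infinite_finite_induct) (auto intro: negligible_net_add)

lemma negligible_net_diff_commute:
  "negligible_net (\<lambda>e. r e - s e) \<longleftrightarrow> negligible_net (\<lambda>e. s e - r e)"
  by (simp add: negligible_net_def norm_minus_commute)

quotient_type (overloaded) 'a gen = "real \<Rightarrow> 'a::real_normed_field" / partial: gen_eq
proof (rule part_equivpI)
  show "\<exists>r. gen_eq r r" by (rule exI[of _ "\<lambda>_. 0"]) (simp add: gen_eq_def)
  show "symp gen_eq"
    by (auto intro!: sympI simp: gen_eq_def dest: negligible_net_diff_commute[THEN iffD1])
  show "transp gen_eq"
  proof (rule transpI)
    fix r s t assume "gen_eq r s" "gen_eq s t"
    then show "gen_eq r t"
      using negligible_net_add[of "\<lambda>e. r e - s e" "\<lambda>e. s e - t e"] by (auto simp: gen_eq_def)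
  qed
qed

instantiation gen :: (real_normed_field) comm_ring_1
begin

lift_definition zero_gen :: "'a gen" is "\<lambda>_. 0" by (simp add: gen_eq_def)

lift_definition one_gen :: "'a gen" is "\<lambda>_. 1" by (simp add: gen_eq_def)

lift_definition plus_gen :: "'a gen \<Rightarrow> 'a gen \<Rightarrow> 'a gen" is "\<lambda>r s e. r e + s e"
proof -
  fix r r' s s' :: "real \<Rightarrow> 'a" assume "gen_eq r r'" "gen_eq s s'"
  then show "gen_eq (\<lambda>e. r e + s e) (\<lambda>e. r' e + s' e)"
    using negligible_net_add[of "\<lambda>e. r e - r' e" "\<lambda>e. s e - s' e"]
    by (auto simp: gen_eq_def moderate_add algebra_simps)
qed

lift_definition uminus_gen :: "'a gen \<Rightarrow> 'a gen" is "\<lambda>r e. - r e"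
proof -
  fix r r' :: "real \<Rightarrow> 'a" assume "gen_eq r r'"
  then show "gen_eq (\<lambda>e. - r e) (\<lambda>e. - r' e)"
    using negligible_net_uminus[of "\<lambda>e. r e - r' e"] by (auto simp: gen_eq_def algebra_simps)
qed

definition minus_gen :: "'a gen \<Rightarrow> 'a gen \<Rightarrow> 'a gen" where "minus_gen r s = r + - s"

lift_definition times_gen :: "'a gen \<Rightarrow> 'a gen \<Rightarrow> 'a gen" is "\<lambda>r s e. r e * s e"
proof -
  fix r r' s s' :: "real \<Rightarrow> 'a" assume "gen_eq r r'" "gen_eq s s'"
  then have "negligible_net (\<lambda>e. s e * (r e - r' e) + r' e * (s e - s' e))"
    by (intro negligible_net_add negligible_net_mult) (auto simp: gen_eq_def)
  with \<open>gen_eq r r'\<close> \<open>gen_eq s s'\<close> show "gen_eq (\<lambda>e. r e * s e) (\<lambda>e. r' e * s' e)"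
    by (auto simp: gen_eq_def moderate_mult algebra_simps)
qed

instance
proof
  show "a + b + c = a + (b + c)" for a b c :: "'a gen"
    by transfer (auto simp: gen_eq_def add.assoc moderate_add)
  show "a + b = b + a" for a b :: "'a gen"
    by transfer (auto simp: gen_eq_def add.commute moderate_add)
  show "0 + a = a" for a :: "'a gen"
    by transfer (auto simp: gen_eq_def)
  show "- a + a = 0" for a :: "'a gen"
    by transfer (auto simp: gen_eq_def)
  show "a - b = a + - b" for a b :: "'a gen"
    by (simp add: minus_gen_def)
  show "a * b * c = a * (b * c)" for a b c :: "'a gen"
    by transfer (auto simp: gen_eq_def mult.assoc moderate_mult)
  show "a * b = b * a" for a b :: "'a gen"
    by transfer (auto simp: gen_eq_def mult.commute moderate_mult)
  show "1 * a = a" for a :: "'a gen"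
    by transfer (auto simp: gen_eq_def)
  show "(a + b) * c = a * c + b * c" for a b c :: "'a gen"
    by transfer (auto simp: gen_eq_def distrib_right moderate_add moderate_mult)
  show "(0::'a gen) \<noteq> 1"
  proof
    assume "(0::'a gen) = 1"
    then have "negligible_net (\<lambda>_. 1 :: 'a)"
      by transfer (simp add: gen_eq_def negligible_net_def)
    then have "(\<lambda>_. 1::real) \<in> O[at_right 0](\<lambda>e::real. e powr real 1)"
      unfolding negligible_net_def by (metis norm_one)
    then obtain c where c: "eventually (\<lambda>e::real. 1 \<le> c * \<bar>e\<bar>) (at_right 0)" and "c > 0"
      by (elim landau_o.bigE) auto
    have "eventually (\<lambda>e::real. 1 \<le> c * e) (at_right 0)"
      using c eventually_unit_interval by eventually_elim auto
    moreover have "eventually (\<lambda>e::real. e < 1 / c) (at_right 0)"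
      using \<open>c > 0\<close> by (intro eventually_at_rightI[of 0 "1/c"]) auto
    ultimately have "eventually (\<lambda>e::real. False) (at_right 0)"
      by eventually_elim (use \<open>c > 0\<close> in \<open>auto simp: field_simps\<close>)
    then show False by simp
  qed
qed

end

lemma minus_gen_transfer [transfer_rule]:
  "rel_fun (pcr_gen (=)) (rel_fun (pcr_gen (=)) (pcr_gen (=))) (\<lambda>r s e. r e - s e) (-)"
  unfolding minus_gen_def diff_conv_add_uminus by transfer_prover


section \<open>Partial derivatives of smooth functions\<close>

type_synonym 'n cfun = "real ^ 'n \<Rightarrow> complex"

definition partial_deriv :: "'n::finite \<Rightarrow> 'n cfun \<Rightarrow> 'n cfun" where
  "partial_deriv i f x = frechet_derivative f (at x) (axis i 1)"

text \<open>Differentiability of all iterated partial derivatives makes all of them continuous.\<close>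

definition smooth :: "'n::finite cfun \<Rightarrow> bool" where
  "smooth f \<longleftrightarrow> (\<forall>is x. foldr partial_deriv is f differentiable at x)"

definition mi_order :: "('n::finite \<Rightarrow> nat) \<Rightarrow> nat" where
  "mi_order \<alpha> = (\<Sum>i\<in>UNIV. \<alpha> i)"

text \<open>
  The iterated derivative \<open>\<partial>\<^sup>\<alpha>\<close>.  The list chooses an order of differentiation, which is immaterial
  for smooth functions (lemma \<open>mpd_eq\<close>).
\<close>

definition mpd :: "('n::finite \<Rightarrow> nat) \<Rightarrow> 'n cfun \<Rightarrow> 'n cfun" where
  "mpd \<alpha> f = foldr partial_deriv (SOME is. \<forall>i. count_list is i = \<alpha> i) f"

lemma partial_deriv_eqI: "(f has_derivative f') (at x) \<Longrightarrow> partial_deriv i f x = f' (axis i 1)"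
  unfolding partial_deriv_def by (metis frechet_derivative_at)

lemma partial_deriv_add:
  assumes "\<And>x. f differentiable at x" "\<And>x. g differentiable at x"
  shows "partial_deriv i (\<lambda>x. f x + g x) = (\<lambda>x. partial_deriv i f x + partial_deriv i g x)"
  using has_derivative_add[OF assms[unfolded frechet_derivative_works]]
  by (auto simp: fun_eq_iff dest!: partial_deriv_eqI simp: partial_deriv_def[of i f] partial_deriv_def[of i g])

lemma partial_deriv_cmult:
  assumes "\<And>x. f differentiable at x"
  shows "partial_deriv i (\<lambda>x. c * f x) = (\<lambda>x. c * partial_deriv i f x)"
proof
  fix x
  show "partial_deriv i (\<lambda>x. c * f x) x = c * partial_deriv i f x"
    using partial_deriv_eqI[OF has_derivative_mult_right[OF assms[unfolded frechet_derivative_works]]]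
    by (simp add: partial_deriv_def[of i f])
qed

lemma smoothD: "smooth f \<Longrightarrow> foldr partial_deriv is f differentiable at x"
  by (simp add: smooth_def)

lemma smooth_foldr: "smooth f \<Longrightarrow> smooth (foldr partial_deriv is f)"
  unfolding smooth_def by (metis foldr_append comp_apply)

lemma smooth_mpd: "smooth f \<Longrightarrow> smooth (mpd \<alpha> f)"
  unfolding mpd_def by (rule smooth_foldr)

lemma smooth_partial_deriv: "smooth f \<Longrightarrow> smooth (partial_deriv i f)"
  using smooth_foldr[of f "[i]"] by simp

lemma foldr_partial_deriv_add:
  assumes "smooth f" "smooth g"
  shows "foldr partial_deriv is (\<lambda>x. f x + g x) =
    (\<lambda>x. foldr partial_deriv is f x + foldr partial_deriv is g x)"
  by (induction "is") (simp_all add: partial_deriv_add smoothD[OF assms(1)] smoothD[OF assms(2)])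

lemma foldr_partial_deriv_cmult:
  assumes "smooth f"
  shows "foldr partial_deriv is (\<lambda>x. c * f x) = (\<lambda>x. c * foldr partial_deriv is f x)"
  by (induction "is") (simp_all add: partial_deriv_cmult smoothD[OF assms])

lemma smooth_add: "smooth f \<Longrightarrow> smooth g \<Longrightarrow> smooth (\<lambda>x. f x + g x)"
  by (subst smooth_def) (auto simp: foldr_partial_deriv_add intro: differentiable_add smoothD)

lemma smooth_cmult: "smooth f \<Longrightarrow> smooth (\<lambda>x. c * f x)"
  by (subst smooth_def) (auto simp: foldr_partial_deriv_cmult intro!: differentiable_mult smoothD)

lemma mpd_add: "smooth f \<Longrightarrow> smooth g \<Longrightarrow> mpd \<alpha> (\<lambda>x. f x + g x) = (\<lambda>x. mpd \<alpha> f x + mpd \<alpha> g x)"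
  unfolding mpd_def by (rule foldr_partial_deriv_add)

lemma mpd_cmult: "smooth f \<Longrightarrow> mpd \<alpha> (\<lambda>x. c * f x) = (\<lambda>x. c * mpd \<alpha> f x)"
  unfolding mpd_def by (rule foldr_partial_deriv_cmult)

lemma smooth_uminus: "smooth f \<Longrightarrow> smooth (\<lambda>x. - f x)"
  using smooth_cmult[of f "-1"] by simp

lemma mpd_uminus: "smooth f \<Longrightarrow> mpd \<alpha> (\<lambda>x. - f x) = (\<lambda>x. - mpd \<alpha> f x)"
  using mpd_cmult[of f \<alpha> "-1"] by simp

lemma smooth_diff: "smooth f \<Longrightarrow> smooth g \<Longrightarrow> smooth (\<lambda>x. f x - g x)"
  using smooth_add[of f "\<lambda>x. - g x"] by (simp add: smooth_uminus)

lemma mpd_diff: "smooth f \<Longrightarrow> smooth g \<Longrightarrow> mpd \<alpha> (\<lambda>x. f x - g x) = (\<lambda>x. mpd \<alpha> f x - mpd \<alpha> g x)"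
  using mpd_add[of f "\<lambda>x. - g x"] by (simp add: smooth_uminus mpd_uminus)

lemma partial_deriv_zero: "partial_deriv i (\<lambda>_. c) = (\<lambda>_. 0)"
  by (simp add: partial_deriv_def fun_eq_iff)

lemma foldr_partial_deriv_zero: "foldr partial_deriv is (\<lambda>_. 0) = (\<lambda>_. 0)"
  by (induction "is") (simp_all add: partial_deriv_zero)

lemma smooth_zero [simp]: "smooth (\<lambda>_. 0)"
  by (simp add: smooth_def foldr_partial_deriv_zero)

lemma mpd_zero [simp]: "mpd \<alpha> (\<lambda>_. 0) = (\<lambda>_. 0)"
  by (simp add: mpd_def foldr_partial_deriv_zero)

lemma smooth_sum: "(\<And>i. i \<in> I \<Longrightarrow> smooth (f i)) \<Longrightarrow> smooth (\<lambda>x. \<Sum>i\<in>I. f i x)"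
  by (induction I rule: infinite_finite_induct) (auto intro: smooth_add)

lemma mpd_sum:
  "(\<And>i. i \<in> I \<Longrightarrow> smooth (f i)) \<Longrightarrow> mpd \<alpha> (\<lambda>x. \<Sum>i\<in>I. f i x) = (\<lambda>x. \<Sum>i\<in>I. mpd \<alpha> (f i) x)"
  by (induction I rule: infinite_finite_induct) (auto simp: mpd_add smooth_sum)

lemma mixed_difference_quotient:
  fixes g p :: "'a::real_normed_vector \<Rightarrow> real"
  assumes g: "\<And>y. ((\<lambda>t. g (y + t *\<^sub>R a)) has_real_derivative p y) (at 0)"
    and p: "(p has_derivative p') (at x)"
  shows "((\<lambda>h. (g (x + h *\<^sub>R a + h *\<^sub>R b) - g (x + h *\<^sub>R a) - g (x + h *\<^sub>R b) + g x) / h\<^sup>2)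
    \<longlongrightarrow> p' b) (at_right 0)"
proof (rule tendstoI)
  fix e :: real assume "e > 0"
  define M where "M = 2 * norm a + norm b + 1"
  have "M > 0" unfolding M_def by (simp add: add_nonneg_pos)
  define e' where "e' = e / (2 * M)"
  have "e' > 0" using \<open>e > 0\<close> \<open>M > 0\<close> by (simp add: e'_def)
  from p obtain d where "d > 0" and
    d: "\<And>y. norm (y - x) < d \<Longrightarrow> norm (p y - p x - p' (y - x)) \<le> e' * norm (y - x)"
    unfolding has_derivative_at_alt using \<open>e' > 0\<close> by blast
  have lin: "linear p'" using p has_derivative_linear by blast
  have g': "((\<lambda>t. g (y + t *\<^sub>R a)) has_real_derivative p (y + s *\<^sub>R a)) (at s)" for y s
  proof -
    have "((\<lambda>t. g ((y + s *\<^sub>R a) + t *\<^sub>R a)) has_real_derivative p (y + s *\<^sub>R a)) (at (s + - s))"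
      using g[of "y + s *\<^sub>R a"] by simp
    then show ?thesis
      by (subst (asm) DERIV_shift) (simp add: algebra_simps)
  qed
  have "eventually (\<lambda>h::real. h \<in> {0<..<d / M}) (at_right 0)"
    by (rule eventually_at_right_real) (use \<open>d > 0\<close> \<open>M > 0\<close> in simp)
  then show "eventually (\<lambda>h. dist ((g (x + h *\<^sub>R a + h *\<^sub>R b) - g (x + h *\<^sub>R a) - g (x + h *\<^sub>R b) + g x) / h\<^sup>2) (p' b) < e)
      (at_right 0)"
  proof eventually_elim
    fix h :: real assume "h \<in> {0<..<d / M}"
    then have h: "h > 0" "h * M < d" using \<open>M > 0\<close> by (auto simp: field_simps)
    define \<phi> where "\<phi> t = g ((x + h *\<^sub>R b) + t *\<^sub>R a) - g (x + t *\<^sub>R a)" for t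
    have "\<exists>z>0. z < h \<and> \<phi> h - \<phi> 0 = (h - 0) * (p ((x + h *\<^sub>R b) + z *\<^sub>R a) - p (x + z *\<^sub>R a))"
      by (rule MVT2[OF h(1)]) (unfold \<phi>_def, intro DERIV_diff g')
    then obtain z where z: "0 < z" "z < h" and
      eq: "\<phi> h - \<phi> 0 = h * (p ((x + h *\<^sub>R b) + z *\<^sub>R a) - p (x + z *\<^sub>R a))" by auto
    have za: "norm (z *\<^sub>R a) \<le> h * norm a" using z by (simp add: mult_right_mono)
    have "norm (h *\<^sub>R b + z *\<^sub>R a) \<le> norm (h *\<^sub>R b) + norm (z *\<^sub>R a)" by (rule norm_triangle_ineq)
    then have n1: "norm (h *\<^sub>R b + z *\<^sub>R a) \<le> h * (norm a + norm b)"
      using za h by (simp add: algebra_simps)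
    have hM: "h * norm a \<le> h * M" "h * (norm a + norm b) \<le> h * M"
      using h(1) by (auto simp: M_def)
    have near: "\<bar>p (x + w) - p x - p' w\<bar> \<le> e' * k"
      if "norm w \<le> k" "k \<le> h * M" for w k
    proof -
      have "\<bar>p (x + w) - p x - p' w\<bar> \<le> e' * norm w"
        using d[of "x + w"] that h(2) by simp
      also have "\<dots> \<le> e' * k" using that(1) \<open>e' > 0\<close> by simp
      finally show ?thesis .
    qed
    have *: "\<bar>p (x + h *\<^sub>R b + z *\<^sub>R a) - p x - p' (h *\<^sub>R b + z *\<^sub>R a)\<bar> \<le> e' * (h * (norm a + norm b))"
      using near[OF n1 hM(2)] by (simp add: add.assoc)
    have **: "\<bar>p (x + z *\<^sub>R a) - p x - p' (z *\<^sub>R a)\<bar> \<le> e' * (h * norm a)"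
      using near[OF za hM(1)] .
    have "p' (h *\<^sub>R b + z *\<^sub>R a) - p' (z *\<^sub>R a) = h * p' b"
      using lin by (simp add: linear_add linear_scale)
    with * ** have "\<bar>(p (x + h *\<^sub>R b + z *\<^sub>R a) - p (x + z *\<^sub>R a)) - h * p' b\<bar>
        \<le> e' * (h * (norm a + norm b)) + e' * (h * norm a)" by linarith
    also have "\<dots> = h * (e' * (2 * norm a + norm b))" by (simp add: algebra_simps)
    also have "\<dots> < h * e"
    proof (rule mult_strict_left_mono[OF _ h(1)])
      have "e' * (2 * norm a + norm b) \<le> e' * M" using \<open>e' > 0\<close> by (auto simp: M_def)
      also have "\<dots> < e" using \<open>e > 0\<close> \<open>M > 0\<close> by (simp add: e'_def)
      finally show "e' * (2 * norm a + norm b) < e" .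
    qed
    finally have fin: "\<bar>(p (x + h *\<^sub>R b + z *\<^sub>R a) - p (x + z *\<^sub>R a)) - h * p' b\<bar> < h * e" .
    have "g (x + h *\<^sub>R a + h *\<^sub>R b) - g (x + h *\<^sub>R a) - g (x + h *\<^sub>R b) + g x = \<phi> h - \<phi> 0"
      by (simp add: \<phi>_def algebra_simps)
    then have "(g (x + h *\<^sub>R a + h *\<^sub>R b) - g (x + h *\<^sub>R a) - g (x + h *\<^sub>R b) + g x) / h\<^sup>2 - p' b =
        ((p (x + h *\<^sub>R b + z *\<^sub>R a) - p (x + z *\<^sub>R a)) - h * p' b) / h"
      unfolding \<open>_ = \<phi> h - \<phi> 0\<close> eq using h(1) by (simp add: power2_eq_square divide_simps)
    then show "dist ((g (x + h *\<^sub>R a + h *\<^sub>R b) - g (x + h *\<^sub>R a) - g (x + h *\<^sub>R b) + g x) / h\<^sup>2) (p' b) < e"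
      using fin h(1) by (simp add: dist_real_def abs_divide pos_divide_less_eq mult.commute)
  qed
qed

lemma partial_deriv_commute_aux:
  fixes L :: "complex \<Rightarrow> real"
  assumes L: "bounded_linear L" and f: "smooth f"
  shows "L (partial_deriv i (partial_deriv j f) x) = L (partial_deriv j (partial_deriv i f) x)"
proof -
  let ?e = "\<lambda>i. axis i (1::real)"
  have df: "(f has_derivative frechet_derivative f (at y)) (at y)" for y
    using smoothD[OF f, of "[]" y] by (simp add: frechet_derivative_works)
  have 1: "((\<lambda>t. L (f (y + t *\<^sub>R ?e i))) has_real_derivative L (partial_deriv i f y)) (at 0)" for i y
  proof -
    have "((\<lambda>t. y + t *\<^sub>R ?e i) has_derivative (\<lambda>t. t *\<^sub>R ?e i)) (at 0)"
      by (auto intro!: derivative_eq_intros)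
    then have "((\<lambda>t. f (y + t *\<^sub>R ?e i)) has_derivative (\<lambda>t. frechet_derivative f (at y) (t *\<^sub>R ?e i))) (at 0)"
      by (rule has_derivative_compose) (use df[of y] in simp)
    then have "((\<lambda>t. L (f (y + t *\<^sub>R ?e i))) has_derivative (\<lambda>t. L (frechet_derivative f (at y) (t *\<^sub>R ?e i)))) (at 0)"
      by (rule bounded_linear.has_derivative[OF L])
    moreover have "L (frechet_derivative f (at y) (t *\<^sub>R ?e i)) = L (partial_deriv i f y) * t" for t
      using linear_scale[OF has_derivative_linear[OF df[of y]], of t "?e i"]
        linear_scale[OF bounded_linear.linear[OF L]] by (simp add: partial_deriv_def)
    ultimately show ?thesis by (simp add: has_field_derivative_def)
  qed
  have 2: "((\<lambda>y. L (partial_deriv i f y)) has_derivative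
      (\<lambda>v. L (frechet_derivative (partial_deriv i f) (at x) v))) (at x)" for i
    using smoothD[OF f, of "[i]" x]
    by (intro bounded_linear.has_derivative[OF L]) (simp add: frechet_derivative_works)
  let ?q = "\<lambda>i j h. (L (f (x + h *\<^sub>R ?e i + h *\<^sub>R ?e j)) - L (f (x + h *\<^sub>R ?e i))
      - L (f (x + h *\<^sub>R ?e j)) + L (f x)) / h\<^sup>2"
  have 3: "(?q i j \<longlongrightarrow> L (partial_deriv j (partial_deriv i f) x)) (at_right 0)" for i j
    using mixed_difference_quotient[where g = "\<lambda>x. L (f x)", OF 1[of _ i] 2[of i], of "?e j"]
    by (simp add: partial_deriv_def[of j])
  have "?q i j = ?q j i" by (rule ext) (simp add: add_ac)
  then have "(?q i j \<longlongrightarrow> L (partial_deriv i (partial_deriv j f) x)) (at_right 0)"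
    using 3[of j i] by (simp only:)
  then show ?thesis by (rule tendsto_unique[OF trivial_limit_at_right_real _ 3[of i j]])
qed

lemma partial_deriv_commute:
  assumes "smooth f"
  shows "partial_deriv i (partial_deriv j f) = partial_deriv j (partial_deriv i f)"
  using partial_deriv_commute_aux[OF bounded_linear_Re assms]
    partial_deriv_commute_aux[OF bounded_linear_Im assms]
  by (auto simp: fun_eq_iff complex_eq_iff)

lemma foldr_partial_deriv_move:
  assumes "smooth f"
  shows "foldr partial_deriv (xs @ i # ys) f = foldr partial_deriv (i # xs @ ys) f"
proof (induction xs)
  case (Cons a xs)
  have "smooth (foldr partial_deriv (xs @ ys) f)" by (rule smooth_foldr[OF assms])
  then show ?case using Cons partial_deriv_commute[of _ a i] by simp
qed simp

lemma count_list_all_zero: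
  assumes "\<And>i. count_list xs i = 0"
  shows "xs = []"
proof (cases xs)
  case (Cons b bs)
  then have "count_list xs b \<noteq> 0" by simp
  with assms[of b] show ?thesis by simp
qed

lemma foldr_partial_deriv_perm:
  assumes "smooth f" "\<And>i. count_list xs i = count_list ys i"
  shows "foldr partial_deriv xs f = foldr partial_deriv ys f"
  using assms(2)
proof (induction xs arbitrary: ys)
  case Nil
  then have "ys = []" by (intro count_list_all_zero) simp
  then show ?case by simp
next
  case (Cons a xs)
  have "count_list ys a \<noteq> 0" using Cons.prems[of a] by simp
  then have "a \<in> set ys" by (metis count_list_0_iff)
  then obtain us vs where ys: "ys = us @ a # vs" by (meson split_list)
  have "count_list xs i = count_list (us @ vs) i" for i
    using Cons.prems[of i] by (auto simp: ys split: if_splits)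
  then show ?case using Cons.IH[of "us @ vs"] foldr_partial_deriv_move[OF assms(1), of us a vs] ys
    by simp
qed

lemma ex_multiindex_list: "\<exists>is. \<forall>i::'n::finite. count_list is i = \<alpha> i"
proof -
  obtain xs :: "'n list" where xs: "set xs = UNIV" "distinct xs"
    using finite_distinct_list[of "UNIV :: 'n set"] by auto
  have rep: "count_list (replicate k a) i = (if a = i then k else 0)" for k and a i :: 'n
    by (induction k) auto
  have "count_list (concat (map (\<lambda>i. replicate (\<alpha> i) i) ys)) i = (if i \<in> set ys then \<alpha> i else 0)"
    if "distinct ys" for ys i
    using that by (induction ys) (auto simp: rep)
  then show ?thesis using xs by (intro exI[of _ "concat (map (\<lambda>i. replicate (\<alpha> i) i) xs)"]) auto
qed

lemma mpd_eq:
  assumes "smooth f" "\<And>i. count_list is i = \<alpha> i"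
  shows "mpd \<alpha> f = foldr partial_deriv is f"
  unfolding mpd_def
proof (rule foldr_partial_deriv_perm[OF assms(1)])
  fix i
  show "count_list (SOME is. \<forall>i. count_list is i = \<alpha> i) i = count_list is i"
    using someI_ex[OF ex_multiindex_list[of \<alpha>]] assms(2) by simp
qed

lemma mpd_mpd:
  assumes "smooth f"
  shows "mpd \<alpha> (mpd \<beta> f) = mpd (\<lambda>i. \<alpha> i + \<beta> i) f"
proof -
  obtain as bs where as: "\<forall>i. count_list as i = \<alpha> i" and bs: "\<forall>i. count_list bs i = \<beta> i"
    using ex_multiindex_list by metis
  have "mpd \<alpha> (mpd \<beta> f) = foldr partial_deriv as (foldr partial_deriv bs f)"
    using mpd_eq[OF assms, of bs \<beta>] mpd_eq[OF smooth_foldr[OF assms], of as \<alpha> bs] as bs by simp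
  also have "\<dots> = mpd (\<lambda>i. \<alpha> i + \<beta> i) f"
    using mpd_eq[OF assms, of "as @ bs" "\<lambda>i. \<alpha> i + \<beta> i"] as bs by simp
  finally show ?thesis .
qed

lemma mpd_zero_index: "mpd (\<lambda>_. 0) f = f"
proof -
  have "is = []" if "\<forall>i::'a. count_list is i = 0" for "is"
    using that by (intro count_list_all_zero) simp
  then have "(SOME is. \<forall>i::'a. count_list is i = (\<lambda>_. 0) i) = []"
    by (intro some_equality) auto
  then show ?thesis by (simp add: mpd_def)
qed

lemma finite_mi_order: "finite {\<alpha> :: 'n::finite \<Rightarrow> nat. mi_order \<alpha> \<le> m}"
proof (rule finite_subset)
  have "\<alpha> i \<le> mi_order \<alpha>" for \<alpha> :: "'n \<Rightarrow> nat" and i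
    unfolding mi_order_def by (rule member_le_sum) auto
  then show "{\<alpha> :: 'n \<Rightarrow> nat. mi_order \<alpha> \<le> m} \<subseteq> {\<alpha>. \<forall>i. (i \<in> UNIV \<longrightarrow> \<alpha> i \<in> {..m}) \<and> (i \<notin> UNIV \<longrightarrow> \<alpha> i = 0)}"
    using order_trans by fastforce
qed (rule finite_set_of_finite_funs; simp)


text \<open>Suprema of moduli over \<open>K\<close>; inserting \<open>0\<close> only serves to make the supremum over the empty set \<open>0\<close>.\<close>

definition sup_norm :: "(real ^ 'n::finite) set \<Rightarrow> 'n cfun \<Rightarrow> real" where
  "sup_norm K f = Sup (insert 0 ((\<lambda>x. cmod (f x)) ` K))"

definition seminorm :: "(real ^ 'n::finite) set \<Rightarrow> nat \<Rightarrow> 'n cfun \<Rightarrow> real" where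
  "seminorm K j f = Sup (insert 0 {cmod (mpd \<alpha> f x) | \<alpha> x. mi_order \<alpha> \<le> j \<and> x \<in> K})"

lemma smooth_continuous_on: "smooth f \<Longrightarrow> continuous_on K f"
  using smoothD[of f "[]"]
  by (auto intro!: continuous_at_imp_continuous_on differentiable_imp_continuous_within)

lemma sup_norm_least: "(\<And>x. x \<in> K \<Longrightarrow> cmod (f x) \<le> B) \<Longrightarrow> 0 \<le> B \<Longrightarrow> sup_norm K f \<le> B"
  unfolding sup_norm_def by (intro cSup_least) auto

lemma bdd_above_sup_norm:
  assumes "compact K" "continuous_on K f"
  shows "bdd_above (insert 0 ((\<lambda>x. cmod (f x)) ` K))"
proof -
  have "compact ((\<lambda>x. cmod (f x)) ` K)"
    using assms by (intro compact_continuous_image continuous_intros)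
  then show ?thesis by (simp add: bounded_imp_bdd_above compact_imp_bounded)
qed

lemma sup_norm_upper:
  assumes "compact K" "continuous_on K f" "x \<in> K"
  shows "cmod (f x) \<le> sup_norm K f"
  unfolding sup_norm_def by (intro cSup_upper bdd_above_sup_norm assms) (use assms in auto)

lemma sup_norm_nonneg:
  assumes "compact K" "continuous_on K f"
  shows "0 \<le> sup_norm K f"
  unfolding sup_norm_def by (intro cSup_upper bdd_above_sup_norm assms) auto

lemma sup_norm_add_le:
  assumes "compact K" "continuous_on K f" "continuous_on K g"
  shows "sup_norm K (\<lambda>x. f x + g x) \<le> sup_norm K f + sup_norm K g"
proof (rule sup_norm_least)
  fix x assume "x \<in> K"
  then show "cmod (f x + g x) \<le> sup_norm K f + sup_norm K g"
    using sup_norm_upper[of K f x] sup_norm_upper[of K g x] assms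
    by (meson add_mono norm_triangle_le)
qed (use assms sup_norm_nonneg in force)

lemma sup_norm_cmult_le:
  assumes "compact K" "continuous_on K f"
  shows "sup_norm K (\<lambda>x. c * f x) \<le> cmod c * sup_norm K f"
  using sup_norm_upper[OF assms] sup_norm_nonneg[OF assms]
  by (intro sup_norm_least) (auto simp: norm_mult intro!: mult_left_mono)

lemma sup_norm_uminus [simp]: "sup_norm K (\<lambda>x. - f x) = sup_norm K f"
  by (simp add: sup_norm_def)

lemma sup_norm_zero [simp]: "sup_norm K (\<lambda>x. 0) = 0"
proof -
  have "insert 0 ((\<lambda>x. cmod 0) ` K) = {0}" by auto
  then show ?thesis unfolding sup_norm_def by (metis cSup_singleton)
qed

lemma bdd_above_seminorm:
  assumes "compact K" "smooth f"
  shows "bdd_above (insert 0 {cmod (mpd \<alpha> f x) | \<alpha> x. mi_order \<alpha> \<le> j \<and> x \<in> K})"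
proof (rule bdd_aboveI[of _ "\<Sum>\<alpha> | mi_order \<alpha> \<le> j. sup_norm K (mpd \<alpha> f)"])
  have nn: "0 \<le> sup_norm K (mpd \<alpha> f)" for \<alpha>
    by (intro sup_norm_nonneg smooth_continuous_on smooth_mpd assms)
  fix r assume "r \<in> insert 0 {cmod (mpd \<alpha> f x) | \<alpha> x. mi_order \<alpha> \<le> j \<and> x \<in> K}"
  then consider "r = 0" | \<alpha> x where "r = cmod (mpd \<alpha> f x)" "mi_order \<alpha> \<le> j" "x \<in> K" by blast
  then show "r \<le> (\<Sum>\<alpha> | mi_order \<alpha> \<le> j. sup_norm K (mpd \<alpha> f))"
  proof cases
    case 1
    then show ?thesis using nn by (simp add: sum_nonneg)
  next
    case 2
    then have "r \<le> sup_norm K (mpd \<alpha> f)"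
      by (auto intro!: sup_norm_upper smooth_continuous_on smooth_mpd assms)
    also have "\<dots> \<le> (\<Sum>\<alpha> | mi_order \<alpha> \<le> j. sup_norm K (mpd \<alpha> f))"
      by (rule member_le_sum) (use 2 nn finite_mi_order in auto)
    finally show ?thesis .
  qed
qed

lemma seminorm_upper:
  "compact K \<Longrightarrow> smooth f \<Longrightarrow> mi_order \<alpha> \<le> j \<Longrightarrow> x \<in> K \<Longrightarrow> cmod (mpd \<alpha> f x) \<le> seminorm K j f"
  unfolding seminorm_def by (intro cSup_upper bdd_above_seminorm) auto

lemma seminorm_nonneg: "compact K \<Longrightarrow> smooth f \<Longrightarrow> 0 \<le> seminorm K j f"
  unfolding seminorm_def by (intro cSup_upper bdd_above_seminorm) auto

lemma seminorm_least:
  "(\<And>\<alpha> x. mi_order \<alpha> \<le> j \<Longrightarrow> x \<in> K \<Longrightarrow> cmod (mpd \<alpha> f x) \<le> B) \<Longrightarrow> 0 \<le> B \<Longrightarrow> seminorm K j f \<le> B"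
  unfolding seminorm_def by (intro cSup_least) auto

lemma seminorm_le_sum:
  fixes f :: "'n::finite cfun"
  assumes "compact K" "smooth f"
  shows "seminorm K j f \<le> (\<Sum>\<alpha> | mi_order \<alpha> \<le> j. sup_norm K (mpd \<alpha> f))"
proof (rule seminorm_least)
  have nn: "0 \<le> sup_norm K (mpd \<alpha> f)" for \<alpha>
    by (intro sup_norm_nonneg smooth_continuous_on smooth_mpd assms)
  then show "0 \<le> (\<Sum>\<alpha> | mi_order \<alpha> \<le> j. sup_norm K (mpd \<alpha> f))" by (simp add: sum_nonneg)
  fix \<alpha> :: "'n \<Rightarrow> nat" and x assume *: "mi_order \<alpha> \<le> j" "x \<in> K"
  then have "cmod (mpd \<alpha> f x) \<le> sup_norm K (mpd \<alpha> f)"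
    by (intro sup_norm_upper smooth_continuous_on smooth_mpd assms)
  also have "\<dots> \<le> (\<Sum>\<alpha> | mi_order \<alpha> \<le> j. sup_norm K (mpd \<alpha> f))"
    by (rule member_le_sum) (use * nn finite_mi_order in auto)
  finally show "cmod (mpd \<alpha> f x) \<le> (\<Sum>\<alpha> | mi_order \<alpha> \<le> j. sup_norm K (mpd \<alpha> f))" .
qed

lemma seminorm_add_le:
  fixes f g :: "'n::finite cfun"
  assumes "compact K" "smooth f" "smooth g"
  shows "seminorm K j (\<lambda>x. f x + g x) \<le> seminorm K j f + seminorm K j g"
proof (rule seminorm_least)
  fix \<alpha> :: "'n \<Rightarrow> nat" and x assume "mi_order \<alpha> \<le> j" "x \<in> K"
  then show "cmod (mpd \<alpha> (\<lambda>x. f x + g x) x) \<le> seminorm K j f + seminorm K j g"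
    using seminorm_upper[of K f \<alpha> j x] seminorm_upper[of K g \<alpha> j x] assms
    by (simp add: mpd_add) (meson add_mono norm_triangle_le)
qed (use assms seminorm_nonneg in force)

lemma seminorm_uminus: "smooth f \<Longrightarrow> seminorm K j (\<lambda>x. - f x) = seminorm K j f"
  by (simp add: seminorm_def mpd_uminus)


section \<open>The Colombeau algebra of the whole space\<close>

type_synonym 'n fnet = "real \<Rightarrow> 'n cfun"

definition moderate_fnet :: "'n::finite fnet \<Rightarrow> bool" where
  "moderate_fnet u \<longleftrightarrow> (\<forall>e\<in>{0<..1}. smooth (u e)) \<and>
     (\<forall>K. compact K \<longrightarrow> (\<forall>\<alpha>. moderate (\<lambda>e. sup_norm K (mpd \<alpha> (u e)))))"

definition negligible_fnet :: "'n::finite fnet \<Rightarrow> bool" where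
  "negligible_fnet u \<longleftrightarrow>
     (\<forall>K. compact K \<longrightarrow> (\<forall>\<alpha>. negligible_net (\<lambda>e. sup_norm K (mpd \<alpha> (u e)))))"

definition colombeau_eq :: "'n::finite fnet \<Rightarrow> 'n fnet \<Rightarrow> bool" where
  "colombeau_eq u w \<longleftrightarrow> moderate_fnet u \<and> moderate_fnet w \<and> negligible_fnet (\<lambda>e x. u e x - w e x)"

definition smooth_fnet :: "'n::finite fnet \<Rightarrow> bool" where
  "smooth_fnet u \<longleftrightarrow> (\<forall>e\<in>{0<..1}. smooth (u e))"

lemma moderate_fnet_smooth: "moderate_fnet u \<Longrightarrow> smooth_fnet u"
  by (simp add: moderate_fnet_def smooth_fnet_def)

lemma abs_sup_norm [simp]:
  "compact K \<Longrightarrow> smooth f \<Longrightarrow> \<bar>sup_norm K (mpd \<alpha> f)\<bar> = sup_norm K (mpd \<alpha> f)"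
  by (simp add: sup_norm_nonneg smooth_continuous_on smooth_mpd)

lemma sup_norm_mpd_add_le:
  assumes "compact K" "smooth f" "smooth g"
  shows "sup_norm K (mpd \<alpha> (\<lambda>x. f x + g x)) \<le> sup_norm K (mpd \<alpha> f) + sup_norm K (mpd \<alpha> g)"
  unfolding mpd_add[OF assms(2,3)]
  by (intro sup_norm_add_le smooth_continuous_on smooth_mpd assms)

lemma sup_norm_mpd_cmult_le:
  assumes "compact K" "smooth f"
  shows "sup_norm K (mpd \<alpha> (\<lambda>x. c * f x)) \<le> cmod c * sup_norm K (mpd \<alpha> f)"
  unfolding mpd_cmult[OF assms(2)]
  by (intro sup_norm_cmult_le smooth_continuous_on smooth_mpd assms)

lemma net_sup_norm_add_bound:
  assumes "compact K" "smooth_fnet u" "smooth_fnet w"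
  shows "eventually (\<lambda>e. norm (sup_norm K (mpd \<alpha> (\<lambda>x. u e x + w e x)))
    \<le> sup_norm K (mpd \<alpha> (u e)) + sup_norm K (mpd \<alpha> (w e))) (at_right 0)"
  using eventually_unit_interval
proof eventually_elim
  case (elim e)
  then have "smooth (u e)" "smooth (w e)" using assms by (auto simp: smooth_fnet_def)
  then show ?case using assms(1) sup_norm_mpd_add_le by (simp add: smooth_add)
qed

lemma net_sup_norm_cmult_bound:
  assumes "compact K" "smooth_fnet u"
  shows "eventually (\<lambda>e. norm (sup_norm K (mpd \<alpha> (\<lambda>x. r e * u e x)))
    \<le> cmod (r e) * sup_norm K (mpd \<alpha> (u e))) (at_right 0)"
  using eventually_unit_interval
proof eventually_elim
  case (elim e)
  then have "smooth (u e)" using assms by (auto simp: smooth_fnet_def)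
  then show ?case using assms(1) sup_norm_mpd_cmult_le by (simp add: smooth_cmult)
qed

lemma smooth_fnet_add: "smooth_fnet u \<Longrightarrow> smooth_fnet w \<Longrightarrow> smooth_fnet (\<lambda>e x. u e x + w e x)"
  by (auto simp: smooth_fnet_def smooth_add)

lemma smooth_fnet_diff: "smooth_fnet u \<Longrightarrow> smooth_fnet w \<Longrightarrow> smooth_fnet (\<lambda>e x. u e x - w e x)"
  by (auto simp: smooth_fnet_def smooth_diff)

lemma smooth_fnet_scale: "smooth_fnet u \<Longrightarrow> smooth_fnet (\<lambda>e x. r e * u e x)"
  by (auto simp: smooth_fnet_def smooth_cmult)

lemma moderate_fnet_add:
  assumes "moderate_fnet u" "moderate_fnet w"
  shows "moderate_fnet (\<lambda>e x. u e x + w e x)"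
proof -
  note sm = moderate_fnet_smooth[OF assms(1)] moderate_fnet_smooth[OF assms(2)]
  have "moderate (\<lambda>e. sup_norm K (mpd \<alpha> (\<lambda>x. u e x + w e x)))" if "compact K" for K \<alpha>
    using assms that
    by (intro moderate_bound[OF net_sup_norm_add_bound[OF that sm]] moderate_add)
      (auto simp: moderate_fnet_def)
  then show ?thesis using smooth_fnet_add[OF sm] by (auto simp: moderate_fnet_def smooth_fnet_def)
qed

lemma negligible_fnet_add:
  assumes "negligible_fnet u" "negligible_fnet w" "smooth_fnet u" "smooth_fnet w"
  shows "negligible_fnet (\<lambda>e x. u e x + w e x)"
proof -
  have "negligible_net (\<lambda>e. sup_norm K (mpd \<alpha> (\<lambda>x. u e x + w e x)))" if "compact K" for K \<alpha>
    using assms that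
    by (intro negligible_net_bound[OF net_sup_norm_add_bound[OF that assms(3,4)]] negligible_net_add)
      (auto simp: negligible_fnet_def)
  then show ?thesis by (auto simp: negligible_fnet_def)
qed

lemma moderate_fnet_scale:
  assumes "moderate r" "moderate_fnet u"
  shows "moderate_fnet (\<lambda>e x. r e * u e x)"
proof -
  have "moderate (\<lambda>e. sup_norm K (mpd \<alpha> (\<lambda>x. r e * u e x)))" if "compact K" for K \<alpha>
    using assms that
    by (intro moderate_bound[OF net_sup_norm_cmult_bound[OF that moderate_fnet_smooth[OF assms(2)]]]
        moderate_mult) (auto simp: moderate_fnet_def)
  then show ?thesis using assms(2) by (auto simp: moderate_fnet_def smooth_cmult)
qed

lemma negligible_fnet_scale:
  assumes "moderate r" "negligible_fnet u" "smooth_fnet u"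
  shows "negligible_fnet (\<lambda>e x. r e * u e x)"
proof -
  have "negligible_net (\<lambda>e. sup_norm K (mpd \<alpha> (\<lambda>x. r e * u e x)))" if "compact K" for K \<alpha>
    using assms that
    by (intro negligible_net_bound[OF net_sup_norm_cmult_bound[OF that assms(3)]]
        negligible_net_mult) (auto simp: negligible_fnet_def)
  then show ?thesis by (auto simp: negligible_fnet_def)
qed

lemma negligible_fnet_scale':
  assumes "negligible_net r" "moderate_fnet u"
  shows "negligible_fnet (\<lambda>e x. r e * u e x)"
proof -
  have "negligible_net (\<lambda>e. sup_norm K (mpd \<alpha> (\<lambda>x. r e * u e x)))" if "compact K" for K \<alpha>
  proof (rule negligible_net_bound[OF net_sup_norm_cmult_bound[OF that moderate_fnet_smooth[OF assms(2)]]])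
    show "negligible_net (\<lambda>e. cmod (r e) * sup_norm K (mpd \<alpha> (u e)))"
      using assms that negligible_net_mult[of "\<lambda>e. sup_norm K (mpd \<alpha> (u e))" "\<lambda>e. cmod (r e)"]
      by (simp add: moderate_fnet_def mult.commute)
  qed
  then show ?thesis by (auto simp: negligible_fnet_def)
qed

lemma moderate_fnet_zero [simp]: "moderate_fnet (\<lambda>_ _. 0)"
  by (simp add: moderate_fnet_def)

lemma negligible_fnet_zero [simp]: "negligible_fnet (\<lambda>_ _. 0)"
  by (simp add: negligible_fnet_def)

lemma moderate_fnet_mpd: "moderate_fnet u \<Longrightarrow> moderate_fnet (\<lambda>e. mpd \<beta> (u e))"
  unfolding moderate_fnet_def
proof (intro conjI allI impI ballI; elim conjE)
  fix K :: "(real ^ 'a) set" and \<alpha>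
  assume *: "compact K" "\<forall>e\<in>{0<..1}. smooth (u e)"
    "\<forall>K. compact K \<longrightarrow> (\<forall>\<alpha>. moderate (\<lambda>e. sup_norm K (mpd \<alpha> (u e))))"
  then have "moderate (\<lambda>e. sup_norm K (mpd (\<lambda>i. \<alpha> i + \<beta> i) (u e)))" by blast
  then show "moderate (\<lambda>e. sup_norm K (mpd \<alpha> (mpd \<beta> (u e))))"
    by (rule moderate_bound[rotated])
      (use eventually_unit_interval in eventually_elim, use * in \<open>simp add: mpd_mpd\<close>)
qed (auto intro: smooth_mpd)

lemma negligible_fnet_mpd:
  assumes "negligible_fnet u" "smooth_fnet u"
  shows "negligible_fnet (\<lambda>e. mpd \<beta> (u e))"
  unfolding negligible_fnet_def
proof (intro allI impI)
  fix K :: "(real ^ 'a) set" and \<alpha>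
  assume K: "compact K"
  then have "negligible_net (\<lambda>e. sup_norm K (mpd (\<lambda>i. \<alpha> i + \<beta> i) (u e)))"
    using assms(1) by (simp add: negligible_fnet_def)
  then show "negligible_net (\<lambda>e. sup_norm K (mpd \<alpha> (mpd \<beta> (u e))))"
    by (rule negligible_net_bound[rotated])
      (use eventually_unit_interval in eventually_elim,
        use assms(2) K in \<open>simp add: mpd_mpd smooth_fnet_def\<close>)
qed

lemma negligible_fnet_cong:
  assumes "negligible_fnet u" "\<And>e. e \<in> {0<..1} \<Longrightarrow> u e = w e"
  shows "negligible_fnet w"
proof -
  have "negligible_net (\<lambda>e. sup_norm K (mpd \<alpha> (w e)))" if "compact K" for K \<alpha>
  proof (rule negligible_net_bound)
    show "negligible_net (\<lambda>e. norm (sup_norm K (mpd \<alpha> (u e))))"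
      using assms(1) that unfolding negligible_net_norm by (simp add: negligible_fnet_def)
    show "eventually (\<lambda>e. norm (sup_norm K (mpd \<alpha> (w e))) \<le> norm (sup_norm K (mpd \<alpha> (u e)))) (at_right 0)"
      using eventually_unit_interval by eventually_elim (simp add: assms(2))
  qed
  then show ?thesis by (simp add: negligible_fnet_def)
qed

quotient_type (overloaded) 'n colombeau = "real \<Rightarrow> real ^ 'n::finite \<Rightarrow> complex" / partial: colombeau_eq
proof (rule part_equivpI)
  show "\<exists>u. colombeau_eq u u" by (rule exI[of _ "\<lambda>_ _. 0"]) (simp add: colombeau_eq_def)
  show "symp colombeau_eq"
  proof (rule sympI)
    fix u w assume *: "colombeau_eq u w"
    then have "negligible_fnet (\<lambda>e x. (-1) * (u e x - w e x))"
      by (intro negligible_fnet_scale smooth_fnet_diff) (auto simp: colombeau_eq_def moderate_fnet_smooth)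
    then show "colombeau_eq w u" using * by (auto simp: colombeau_eq_def)
  qed
  show "transp colombeau_eq"
  proof (rule transpI)
    fix u v w assume *: "colombeau_eq u v" "colombeau_eq v w"
    then have "negligible_fnet (\<lambda>e x. (u e x - v e x) + (v e x - w e x))"
      by (intro negligible_fnet_add smooth_fnet_diff) (auto simp: colombeau_eq_def moderate_fnet_smooth)
    then show "colombeau_eq u w" using * by (auto simp: colombeau_eq_def)
  qed
qed

instantiation colombeau :: (finite) ab_group_add
begin

lift_definition zero_colombeau :: "'a colombeau" is "\<lambda>_ _. 0" by (simp add: colombeau_eq_def)

lift_definition plus_colombeau :: "'a colombeau \<Rightarrow> 'a colombeau \<Rightarrow> 'a colombeau"
  is "\<lambda>u w e x. u e x + w e x"
proof -
  fix u u' w w' :: "'a fnet" assume *: "colombeau_eq u u'" "colombeau_eq w w'"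
  then have "negligible_fnet (\<lambda>e x. (u e x - u' e x) + (w e x - w' e x))"
    by (intro negligible_fnet_add smooth_fnet_diff) (auto simp: colombeau_eq_def moderate_fnet_smooth)
  then show "colombeau_eq (\<lambda>e x. u e x + w e x) (\<lambda>e x. u' e x + w' e x)"
    using * by (auto simp: colombeau_eq_def moderate_fnet_add algebra_simps)
qed

lift_definition uminus_colombeau :: "'a colombeau \<Rightarrow> 'a colombeau" is "\<lambda>u e x. - u e x"
proof -
  fix u u' :: "'a fnet" assume *: "colombeau_eq u u'"
  have "moderate_fnet (\<lambda>e x. - u e x)" "moderate_fnet (\<lambda>e x. - u' e x)"
    using * moderate_fnet_scale[of "\<lambda>_. -1" u] moderate_fnet_scale[of "\<lambda>_. -1" u']
    by (auto simp: colombeau_eq_def)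
  moreover have "negligible_fnet (\<lambda>e x. (-1) * (u e x - u' e x))"
    using * by (intro negligible_fnet_scale smooth_fnet_diff) (auto simp: colombeau_eq_def moderate_fnet_smooth)
  ultimately show "colombeau_eq (\<lambda>e x. - u e x) (\<lambda>e x. - u' e x)"
    by (auto simp: colombeau_eq_def)
qed

definition minus_colombeau :: "'a colombeau \<Rightarrow> 'a colombeau \<Rightarrow> 'a colombeau" where
  "minus_colombeau u w = u + - w"

instance
proof
  show "a + b + c = a + (b + c)" for a b c :: "'a colombeau"
    by transfer (auto simp: colombeau_eq_def add.assoc moderate_fnet_add)
  show "a + b = b + a" for a b :: "'a colombeau"
    by transfer (auto simp: colombeau_eq_def add.commute moderate_fnet_add)
  show "0 + a = a" for a :: "'a colombeau"
    by transfer (auto simp: colombeau_eq_def)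
  show "- a + a = 0" for a :: "'a colombeau"
    by transfer (auto simp: colombeau_eq_def)
  show "a - b = a + - b" for a b :: "'a colombeau"
    by (simp add: minus_colombeau_def)
qed

end

lift_definition gscale :: "complex gen \<Rightarrow> 'n::finite colombeau \<Rightarrow> 'n colombeau"
  is "\<lambda>r u e x. r e * u e x"
proof -
  fix r r' :: "real \<Rightarrow> complex" and u u' :: "'n fnet"
  assume *: "gen_eq r r'" "colombeau_eq u u'"
  then have "negligible_fnet (\<lambda>e x. (r e - r' e) * u e x + r' e * (u e x - u' e x))"
    by (intro negligible_fnet_add negligible_fnet_scale negligible_fnet_scale' smooth_fnet_diff)
      (auto simp: colombeau_eq_def gen_eq_def moderate_fnet_smooth moderate_fnet_scale moderate_diff
        intro!: smooth_fnet_scale smooth_fnet_diff)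
  then show "colombeau_eq (\<lambda>e x. r e * u e x) (\<lambda>e x. r' e * u' e x)"
    using * by (auto simp: colombeau_eq_def gen_eq_def moderate_fnet_scale algebra_simps)
qed

lift_definition gD :: "('n::finite \<Rightarrow> nat) \<Rightarrow> 'n colombeau \<Rightarrow> 'n colombeau"
  is "\<lambda>\<alpha> u e x. (- \<i>) ^ mi_order \<alpha> * mpd \<alpha> (u e) x"
proof -
  fix \<alpha> :: "'n \<Rightarrow> nat" and u w :: "'n fnet" assume *: "colombeau_eq u w"
  then have sm: "smooth_fnet u" "smooth_fnet w" by (auto simp: colombeau_eq_def moderate_fnet_smooth)
  have "negligible_fnet (\<lambda>e. mpd \<alpha> (\<lambda>x. u e x - w e x))"
    using * sm by (intro negligible_fnet_mpd smooth_fnet_diff) (auto simp: colombeau_eq_def)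
  then have "negligible_fnet (\<lambda>e x. mpd \<alpha> (u e) x - mpd \<alpha> (w e) x)"
    by (rule negligible_fnet_cong) (use sm in \<open>simp add: mpd_diff smooth_fnet_def\<close>)
  then have "negligible_fnet (\<lambda>e x. (- \<i>) ^ mi_order \<alpha> * (mpd \<alpha> (u e) x - mpd \<alpha> (w e) x))"
    by (rule negligible_fnet_scale[rotated])
      (use sm in \<open>auto simp: smooth_fnet_def intro!: smooth_diff smooth_mpd\<close>)
  then show "colombeau_eq (\<lambda>e x. (- \<i>) ^ mi_order \<alpha> * mpd \<alpha> (u e) x)
      (\<lambda>e x. (- \<i>) ^ mi_order \<alpha> * mpd \<alpha> (w e) x)"
    using * by (simp add: colombeau_eq_def moderate_fnet_scale moderate_fnet_mpd right_diff_distrib)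
qed


section \<open>Valuations and ultra-pseudo-seminorms\<close>

definition valuation :: "(real \<Rightarrow> real) \<Rightarrow> ereal" where
  "valuation f = Sup {ereal b | b. f \<in> O[at_right 0](\<lambda>e. e powr b)}"

text \<open>\<open>v \<mapsto> e\<^sup>-\<^sup>v\<close> with \<open>e\<^sup>-\<^sup>\<infinity> = 0\<close>; the value at \<open>- \<infinity>\<close> is irrelevant, as moderate nets have valuation \<open>> - \<infinity>\<close>.\<close>

definition exp_neg :: "ereal \<Rightarrow> real" where
  "exp_neg v = (if v = \<infinity> then 0 else exp (- real_of_ereal v))"

lemma bigo_powr_negligible_cong:
  fixes f g h :: "real \<Rightarrow> real"
  assumes "eventually (\<lambda>e. \<bar>f e - g e\<bar> \<le> h e) (at_right 0)" "negligible_net h"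
    and f: "f \<in> O[at_right 0](\<lambda>e. e powr b)"
  shows "g \<in> O[at_right 0](\<lambda>e. e powr b)"
proof -
  obtain q :: nat where "b \<le> real q" using real_arch_simple by blast
  have "(\<lambda>e. norm (h e)) \<in> O[at_right 0](\<lambda>e. e powr real q)"
    using assms(2) by (simp add: negligible_net_def)
  then have "(\<lambda>e. norm (h e)) \<in> O[at_right 0](\<lambda>e. e powr b)"
    using \<open>b \<le> real q\<close> by (rule bigo_powr_weaken)
  then have "(\<lambda>e. norm (f e) + norm (h e)) \<in> O[at_right 0](\<lambda>e. e powr b)"
    using f by (intro sum_in_bigo) auto
  then show ?thesis
    by (rule bigo_bound[rotated]) (use assms(1) in eventually_elim, simp)
qed

lemma valuation_cong:
  assumes "eventually (\<lambda>e. \<bar>f e - g e\<bar> \<le> h e) (at_right 0)" "negligible_net h"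
  shows "valuation f = valuation g"
proof -
  have "eventually (\<lambda>e. \<bar>g e - f e\<bar> \<le> h e) (at_right 0)"
    using assms(1) by eventually_elim linarith
  then have "f \<in> O[at_right 0](\<lambda>e. e powr b) \<longleftrightarrow> g \<in> O[at_right 0](\<lambda>e. e powr b)" for b
    using bigo_powr_negligible_cong assms by blast
  then show ?thesis by (simp add: valuation_def)
qed

lift_definition gen_val :: "'a::real_normed_field gen \<Rightarrow> ereal" is "\<lambda>r. valuation (\<lambda>e. norm (r e))"
proof -
  fix r s :: "real \<Rightarrow> 'a" assume "gen_eq r s"
  then show "valuation (\<lambda>e. norm (r e)) = valuation (\<lambda>e. norm (s e))"
    by (intro valuation_cong[where h = "\<lambda>e. norm (r e - s e)"])
      (auto simp: gen_eq_def norm_triangle_ineq3)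
qed

definition gen_abs :: "'a::real_normed_field gen \<Rightarrow> real" where
  "gen_abs r = exp_neg (gen_val r)"

text \<open>For compact \<open>K\<close> the valuation \<open>v\<^sub>K\<^sub>,\<^sub>j\<close> may be computed on any representative (lemma \<open>colombeau_val_abs\<close>).\<close>

definition colombeau_val :: "(real ^ 'n::finite) set \<Rightarrow> nat \<Rightarrow> 'n colombeau \<Rightarrow> ereal" where
  "colombeau_val K j u = valuation (\<lambda>e. seminorm K j (rep_colombeau u e))"

lemma valuation_seminorm_cong:
  assumes "compact K" "colombeau_eq u w"
  shows "valuation (\<lambda>e. seminorm K j (u e)) = valuation (\<lambda>e. seminorm K j (w e))"
proof (rule valuation_cong)
  let ?h = "\<lambda>e. \<Sum>\<alpha> | mi_order \<alpha> \<le> j. sup_norm K (mpd \<alpha> (\<lambda>x. u e x - w e x))"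
  show "negligible_net ?h"
    using assms by (intro negligible_net_sum) (auto simp: colombeau_eq_def negligible_fnet_def)
  show "eventually (\<lambda>e. \<bar>seminorm K j (u e) - seminorm K j (w e)\<bar> \<le> ?h e) (at_right 0)"
    using eventually_unit_interval
  proof eventually_elim
    case (elim e)
    then have sm: "smooth (u e)" "smooth (w e)"
      using assms(2) by (auto simp: colombeau_eq_def moderate_fnet_def)
    define d where "d = seminorm K j (\<lambda>x. u e x - w e x)"
    have "seminorm K j (u e) \<le> seminorm K j (w e) + d"
      using seminorm_add_le[OF assms(1) sm(2) smooth_diff[OF sm]] by (simp add: d_def)
    moreover have "seminorm K j (w e) \<le> seminorm K j (u e) + d"
      using seminorm_add_le[OF assms(1) sm(1) smooth_uminus[OF smooth_diff[OF sm]]]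
        seminorm_uminus[OF smooth_diff[OF sm]] by (simp add: d_def)
    moreover have "d \<le> ?h e"
      unfolding d_def by (intro seminorm_le_sum smooth_diff assms sm)
    ultimately show ?case by linarith
  qed
qed

lemma colombeau_val_abs:
  assumes "compact K" "moderate_fnet u"
  shows "colombeau_val K j (abs_colombeau u) = valuation (\<lambda>e. seminorm K j (u e))"
  unfolding colombeau_val_def
proof (rule valuation_seminorm_cong[OF assms(1)])
  have "colombeau_eq u u" using assms(2) by (simp add: colombeau_eq_def)
  then show "colombeau_eq (rep_colombeau (abs_colombeau u)) u"
    by (rule Quotient3_rep_abs[OF Quotient3_colombeau])
qed


section \<open>Compact supports and regularity\<close>

lift_definition vanishes_on :: "(real ^ 'n::finite) set \<Rightarrow> 'n colombeau \<Rightarrow> bool"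
  is "\<lambda>W u. \<forall>K \<alpha>. compact K \<and> K \<subseteq> W \<longrightarrow> negligible_net (\<lambda>e. sup_norm K (mpd \<alpha> (u e)))"
proof -
  fix W :: "(real ^ 'n) set" and u w :: "'n fnet"
  assume uw: "colombeau_eq u w"
  have *: "negligible_net (\<lambda>e. sup_norm K (mpd \<alpha> (w e)))"
    if "colombeau_eq u w" "compact K" "negligible_net (\<lambda>e. sup_norm K (mpd \<alpha> (u e)))" for u w :: "'n fnet" and K \<alpha>
  proof (rule negligible_net_bound)
    show "negligible_net (\<lambda>e. sup_norm K (mpd \<alpha> (u e)) + sup_norm K (mpd \<alpha> (\<lambda>x. u e x - w e x)))"
      using that by (intro negligible_net_add) (auto simp: colombeau_eq_def negligible_fnet_def)
    show "eventually (\<lambda>e. norm (sup_norm K (mpd \<alpha> (w e)))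
      \<le> sup_norm K (mpd \<alpha> (u e)) + sup_norm K (mpd \<alpha> (\<lambda>x. u e x - w e x))) (at_right 0)"
      using eventually_unit_interval
    proof eventually_elim
      case (elim e)
      then have sm: "smooth (u e)" "smooth (w e)"
        using that(1) by (auto simp: colombeau_eq_def moderate_fnet_def)
      show ?case
        using sup_norm_mpd_add_le[OF that(2) sm(1) smooth_uminus[OF smooth_diff[OF sm]], of \<alpha>]
          mpd_uminus[OF smooth_diff[OF sm], of \<alpha>] that(2) sm by simp
    qed
  qed
  have "colombeau_eq w u"
    using uw by (rule sympD[OF Quotient3_symp[OF Quotient3_colombeau]])
  with uw show "(\<forall>K \<alpha>. compact K \<and> K \<subseteq> W \<longrightarrow> negligible_net (\<lambda>e. sup_norm K (mpd \<alpha> (u e)))) =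
      (\<forall>K \<alpha>. compact K \<and> K \<subseteq> W \<longrightarrow> negligible_net (\<lambda>e. sup_norm K (mpd \<alpha> (w e))))"
    using *[of u w] *[of w u] by blast
qed

definition gsupp :: "'n::finite colombeau \<Rightarrow> (real ^ 'n) set" where
  "gsupp u = - \<Union>{W. open W \<and> vanishes_on W u}"

definition Gc :: "'n::finite colombeau set" where
  "Gc = {u. compact (gsupp u)}"

definition GK :: "(real ^ 'n::finite) set \<Rightarrow> 'n colombeau set" where
  "GK K = {u \<in> Gc. gsupp u \<subseteq> K}"

definition regular_fnet :: "'n::finite fnet \<Rightarrow> bool" where
  "regular_fnet u \<longleftrightarrow> (\<forall>K. compact K \<longrightarrow>
     (\<exists>N::nat. \<forall>\<alpha>. (\<lambda>e. sup_norm K (mpd \<alpha> (u e))) \<in> O[at_right 0](\<lambda>e. e powr - real N)))"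

definition Ginf :: "'n::finite colombeau set" where
  "Ginf = {abs_colombeau u | u. moderate_fnet u \<and> regular_fnet u}"


section \<open>Topologies and duals\<close>

text \<open>
  The topology of a family \<open>P\<close> of ultra-pseudo-seminorms on an additive subgroup \<open>S\<close>, generated by
  the balls around all points of \<open>S\<close>.
\<close>

definition ultra_topology :: "'a::ab_group_add set \<Rightarrow> ('a \<Rightarrow> real) set \<Rightarrow> 'a topology" where
  "ultra_topology S P =
     topology_generated_by {{w \<in> S. p (w - u) < r} | p u r. p \<in> P \<and> u \<in> S \<and> 0 < r}"

definition gen_topology :: "complex gen topology" where
  "gen_topology = ultra_topology UNIV {gen_abs}"

definition G_topology :: "'n::finite colombeau topology" where
  "G_topology = ultra_topology UNIV {\<lambda>u. exp_neg (colombeau_val K j u) | K j. compact K}"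

text \<open>
  On \<open>GK K\<close> the seminorms do not depend on the choice of the compact neighbourhood \<open>K'\<close> of \<open>K\<close>;
  we use all of them.
\<close>

definition GK_topology :: "(real ^ 'n::finite) set \<Rightarrow> 'n colombeau topology" where
  "GK_topology K = ultra_topology (GK K)
     {\<lambda>u. exp_neg (colombeau_val K' j u) | K' j. compact K' \<and> K \<subseteq> interior K'}"

text \<open>
  The locally convex inductive limit topology on \<open>Gc\<close>: a base of neighbourhoods of \<open>0\<close> consists of the
  absolutely convex sets (in the sense of modules over the generalized numbers: balanced and
  closed under addition) whose trace on each \<open>GK K\<close> is a neighbourhood of \<open>0\<close>.  These are additive
  subgroups, so their translates are open.
\<close>

definition Gc_nbhd0 :: "'n::finite colombeau set \<Rightarrow> bool" where
  "Gc_nbhd0 V \<longleftrightarrow> V \<subseteq> Gc \<and>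
     (\<forall>u\<in>V. \<forall>w\<in>V. u + w \<in> V) \<and>
     (\<forall>r. gen_abs r \<le> 1 \<longrightarrow> (\<forall>u\<in>V. gscale r u \<in> V)) \<and>
     (\<forall>K. compact K \<longrightarrow> (\<exists>U. openin (GK_topology K) U \<and> 0 \<in> U \<and> U \<subseteq> V))"

definition Gc_topology :: "'n::finite colombeau topology" where
  "Gc_topology = topology_generated_by {(+) u ` V | u V. u \<in> Gc \<and> Gc_nbhd0 V}"

definition gen_linear_on :: "'n::finite colombeau set \<Rightarrow> ('n colombeau \<Rightarrow> complex gen) \<Rightarrow> bool" where
  "gen_linear_on S T \<longleftrightarrow> (\<forall>u\<in>S. \<forall>w\<in>S. T (u + w) = T u + T w) \<and>
     (\<forall>r. \<forall>u\<in>S. T (gscale r u) = r * T u)"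

text \<open>The dual spaces \<open>L(G, C)\<close> and \<open>L(Gc, C)\<close>; for the latter only the values on \<open>Gc\<close> are relevant.\<close>

definition dual_G :: "('n::finite colombeau \<Rightarrow> complex gen) set" where
  "dual_G = {T. gen_linear_on UNIV T \<and> continuous_map G_topology gen_topology T}"

definition dual_Gc :: "('n::finite colombeau \<Rightarrow> complex gen) set" where
  "dual_Gc = {T. gen_linear_on Gc T \<and> continuous_map Gc_topology gen_topology T}"


section \<open>Distributions and basic functionals\<close>

definition tsupp :: "'n::finite cfun \<Rightarrow> (real ^ 'n) set" where
  "tsupp f = closure {x. f x \<noteq> 0}"

definition C_infinity :: "'n::finite cfun set" where
  "C_infinity = {f. smooth f}"

definition C_infinity_on :: "(real ^ 'n::finite) set \<Rightarrow> 'n cfun set" where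
  "C_infinity_on K = {f. smooth f \<and> tsupp f \<subseteq> K}"

definition test_functions :: "'n::finite cfun set" where
  "test_functions = {f. smooth f \<and> compact (tsupp f)}"

definition clinear_on :: "'n::finite cfun set \<Rightarrow> ('n cfun \<Rightarrow> complex) \<Rightarrow> bool" where
  "clinear_on S T \<longleftrightarrow> (\<forall>f\<in>S. \<forall>g\<in>S. T (\<lambda>x. f x + g x) = T f + T g) \<and>
     (\<forall>a. \<forall>f\<in>S. T (\<lambda>x. a * f x) = a * T f)"

text \<open>
  Membership in \<open>D'\<close> and \<open>E'\<close>: continuity on the test functions, respectively on all smooth
  functions, is expressed by the usual seminorm estimates.
\<close>

definition distribution :: "('n::finite cfun \<Rightarrow> complex) \<Rightarrow> bool" where
  "distribution T \<longleftrightarrow> clinear_on test_functions T \<and>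
     (\<forall>K. compact K \<longrightarrow> (\<exists>j C. \<forall>f\<in>C_infinity_on K. cmod (T f) \<le> C * seminorm K j f))"

definition compact_distribution :: "('n::finite cfun \<Rightarrow> complex) \<Rightarrow> bool" where
  "compact_distribution T \<longleftrightarrow> clinear_on C_infinity T \<and>
     (\<exists>K j C. compact K \<and> (\<forall>f\<in>C_infinity. cmod (T f) \<le> C * seminorm K j f))"

definition dual_bounds ::
    "'n::finite cfun set \<Rightarrow> (real ^ 'n) set \<Rightarrow> (real \<Rightarrow> 'n cfun \<Rightarrow> complex) \<Rightarrow> bool" where
  "dual_bounds S K T \<longleftrightarrow> (\<exists>(j::nat) (N::nat) (c::real) (\<eta>::real). 0 < c \<and> \<eta> \<in> {0<..1} \<and>
     (\<forall>f\<in>S. \<forall>e\<in>{0<..\<eta>}. cmod (T e f) \<le> c * e powr - real N * seminorm K j f))"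

definition basic_dual_Gc :: "('n::finite colombeau \<Rightarrow> complex gen) set" where
  "basic_dual_Gc = {T \<in> dual_Gc. \<exists>Tn.
     (\<forall>e\<in>{0<..1}. distribution (Tn e)) \<and>
     (\<forall>K. compact K \<longrightarrow> dual_bounds (C_infinity_on K) K Tn) \<and>
     (\<forall>u K. moderate_fnet u \<and> compact K \<and> (\<forall>e\<in>{0<..1}. tsupp (u e) \<subseteq> K) \<longrightarrow>
        T (abs_colombeau u) = abs_gen (\<lambda>e. Tn e (u e)))}"

definition basic_dual_G :: "('n::finite colombeau \<Rightarrow> complex gen) set" where
  "basic_dual_G = {T \<in> dual_G. \<exists>Tn.
     (\<forall>e\<in>{0<..1}. compact_distribution (Tn e)) \<and>
     (\<exists>K. compact K \<and> dual_bounds C_infinity K Tn) \<and>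
     (\<forall>u. moderate_fnet u \<longrightarrow> T (abs_colombeau u) = abs_gen (\<lambda>e. Tn e (u e)))}"


section \<open>Differential operators with generalized constant coefficients\<close>

definition diff_op ::
    "nat \<Rightarrow> (('n::finite \<Rightarrow> nat) \<Rightarrow> complex gen) \<Rightarrow> 'n colombeau \<Rightarrow> 'n colombeau" where
  "diff_op m c u = (\<Sum>\<alpha> | mi_order \<alpha> \<le> m. gscale (c \<alpha>) (gD \<alpha> u))"

definition transpose_coeffs ::
    "(('n::finite \<Rightarrow> nat) \<Rightarrow> complex gen) \<Rightarrow> ('n \<Rightarrow> nat) \<Rightarrow> complex gen" where
  "transpose_coeffs c \<alpha> = (- 1) ^ mi_order \<alpha> * c \<alpha>"

definition diff_op_dual ::
    "nat \<Rightarrow> (('n::finite \<Rightarrow> nat) \<Rightarrow> complex gen) \<Rightarrow>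
     ('n colombeau \<Rightarrow> complex gen) \<Rightarrow> 'n colombeau \<Rightarrow> complex gen" where
  "diff_op_dual m c T u = T (diff_op m (transpose_coeffs c) u)"

definition symbol_poly :: "nat \<Rightarrow> (('n::finite \<Rightarrow> nat) \<Rightarrow> complex) \<Rightarrow> 'n cfun" where
  "symbol_poly m a \<xi> = (\<Sum>\<alpha> | mi_order \<alpha> \<le> m. a \<alpha> * of_real (\<Prod>i\<in>UNIV. (\<xi> $ i) ^ \<alpha> i))"

definition weight :: "nat \<Rightarrow> (('n::finite \<Rightarrow> nat) \<Rightarrow> complex) \<Rightarrow> real ^ 'n \<Rightarrow> real" where
  "weight m a \<xi> = sqrt (\<Sum>\<alpha> | mi_order \<alpha> \<le> m. (cmod (mpd \<alpha> (symbol_poly m a) \<xi>))\<^sup>2)"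

inductive poly_fun :: "'n::finite cfun \<Rightarrow> bool" where
  const: "poly_fun (\<lambda>_. a)"
| coord: "poly_fun (\<lambda>x. of_real (x $ i))"
| add: "poly_fun f \<Longrightarrow> poly_fun g \<Longrightarrow> poly_fun (\<lambda>x. f x + g x)"
| mult: "poly_fun f \<Longrightarrow> poly_fun g \<Longrightarrow> poly_fun (\<lambda>x. f x * g x)"

lemma poly_fun_derivative:
  fixes f :: "'n::finite cfun"
  shows "poly_fun f \<Longrightarrow> (\<forall>x. f differentiable at x) \<and> poly_fun (partial_deriv i f)"
proof (induction rule: poly_fun.induct)
  case (const a)
  then show ?case by (simp add: partial_deriv_zero poly_fun.const)
next
  case (coord k)
  have d: "((\<lambda>x. complex_of_real (x $ k)) has_derivative (\<lambda>h. of_real (h $ k))) (at x)" for x :: "real ^ 'n"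
    by (intro bounded_linear_imp_has_derivative bounded_linear_compose[OF bounded_linear_of_real]
        bounded_linear_vec_nth)
  then have "partial_deriv i (\<lambda>x. complex_of_real (x $ k)) = (\<lambda>_. of_real (axis i 1 $ k))"
    by (intro ext partial_deriv_eqI)
  then show ?case using d by (auto simp: poly_fun.const differentiable_def)
next
  case (add f g)
  then show ?case by (auto simp: partial_deriv_add intro: poly_fun.add)
next
  case (mult f g)
  have "((\<lambda>x. f x * g x) has_derivative
      (\<lambda>h. f x * frechet_derivative g (at x) h + frechet_derivative f (at x) h * g x)) (at x)" for x
    using mult.IH by (intro has_derivative_mult) (auto simp: frechet_derivative_works)
  from partial_deriv_eqI[OF this]
  have "partial_deriv i (\<lambda>x. f x * g x) x = f x * partial_deriv i g x + partial_deriv i f x * g x" for x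
    by (simp add: partial_deriv_def[of i f] partial_deriv_def[of i g])
  then have "partial_deriv i (\<lambda>x. f x * g x) = (\<lambda>x. f x * partial_deriv i g x + partial_deriv i f x * g x)"
    by blast
  then show ?case using mult by (auto intro!: poly_fun.add poly_fun.mult)
qed

lemma poly_fun_smooth:
  assumes "poly_fun f"
  shows "smooth f"
proof -
  have "poly_fun (foldr partial_deriv is f)" for "is"
    by (induction "is") (simp_all add: assms poly_fun_derivative)
  then show ?thesis using poly_fun_derivative by (auto simp: smooth_def)
qed

lemma smooth_monomial: "smooth (\<lambda>x. complex_of_real (\<Prod>i\<in>UNIV. (x $ i) ^ \<alpha> i))"
proof (rule poly_fun_smooth)
  have pw: "poly_fun (\<lambda>x. complex_of_real (x $ i) ^ k)" for i :: 'a and k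
    by (induction k) (auto intro: poly_fun.intros)
  have "poly_fun (\<lambda>x. \<Prod>i\<in>I. complex_of_real (x $ i) ^ \<alpha> i)" if "finite I" for I
    using that by (induction I) (auto intro: poly_fun.intros pw)
  then show "poly_fun (\<lambda>x. complex_of_real (\<Prod>i\<in>UNIV. (x $ i) ^ \<alpha> i))" by simp
qed

lemma mpd_symbol_poly:
  "mpd \<alpha> (symbol_poly m a) \<xi> =
    (\<Sum>\<beta> | mi_order \<beta> \<le> m. a \<beta> * mpd \<alpha> (\<lambda>x. of_real (\<Prod>i\<in>UNIV. (x $ i) ^ \<beta> i)) \<xi>)"
proof -
  have "symbol_poly m a = (\<lambda>\<xi>. \<Sum>\<beta> | mi_order \<beta> \<le> m. a \<beta> * of_real (\<Prod>i\<in>UNIV. (\<xi> $ i) ^ \<beta> i))"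
    by (simp add: fun_eq_iff symbol_poly_def)
  then have "mpd \<alpha> (symbol_poly m a) =
      (\<lambda>x. \<Sum>\<beta> | mi_order \<beta> \<le> m. mpd \<alpha> (\<lambda>x. a \<beta> * of_real (\<Prod>i\<in>UNIV. (x $ i) ^ \<beta> i)) x)"
    by (simp only: mpd_sum smooth_cmult smooth_monomial)
  then show ?thesis by (simp only: mpd_cmult smooth_monomial)
qed

lemma weight_L2: "weight m a \<xi> = L2_set (\<lambda>\<alpha>. cmod (mpd \<alpha> (symbol_poly m a) \<xi>)) {\<alpha>. mi_order \<alpha> \<le> m}"
  by (simp add: weight_def L2_set_def)

lemma weight_triangle: "weight m (\<lambda>\<alpha>. a \<alpha> + b \<alpha>) \<xi> \<le> weight m a \<xi> + weight m b \<xi>"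
proof -
  have "cmod (mpd \<alpha> (symbol_poly m (\<lambda>\<alpha>. a \<alpha> + b \<alpha>)) \<xi>)
      \<le> cmod (mpd \<alpha> (symbol_poly m a) \<xi>) + cmod (mpd \<alpha> (symbol_poly m b) \<xi>)" for \<alpha>
    by (simp add: mpd_symbol_poly distrib_right sum.distrib norm_triangle_ineq)
  then have "weight m (\<lambda>\<alpha>. a \<alpha> + b \<alpha>) \<xi> \<le> L2_set (\<lambda>\<alpha>. cmod (mpd \<alpha> (symbol_poly m a) \<xi>)
      + cmod (mpd \<alpha> (symbol_poly m b) \<xi>)) {\<alpha>. mi_order \<alpha> \<le> m}"
    unfolding weight_L2 by (intro L2_set_mono) auto
  also have "\<dots> \<le> weight m a \<xi> + weight m b \<xi>"
    unfolding weight_L2 by (rule L2_set_triangle_ineq)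
  finally show ?thesis .
qed

lemma weight_nonneg: "0 \<le> weight m a \<xi>"
  by (simp add: weight_def sum_nonneg)

lemma weight_le_sum:
  "weight m a \<xi> \<le> (\<Sum>\<alpha> | mi_order \<alpha> \<le> m. cmod (mpd \<alpha> (symbol_poly m a) \<xi>))"
  unfolding weight_L2 by (rule L2_set_le_sum) auto

text \<open>The generalized number \<open>[(weight m P\<^sub>\<epsilon> \<xi>)\<^sub>\<epsilon>]\<close>, with respect to any representatives of the coefficients\<close>

lift_definition gen_weight ::
    "nat \<Rightarrow> (('n::finite \<Rightarrow> nat) \<Rightarrow> complex gen) \<Rightarrow> real ^ 'n \<Rightarrow> real gen"
  is "\<lambda>m c \<xi> e. weight m (\<lambda>\<alpha>. c \<alpha> e) \<xi>"
proof -
  fix m :: nat and c d :: "('n \<Rightarrow> nat) \<Rightarrow> real \<Rightarrow> complex" and \<xi> :: "real ^ 'n"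
  assume *: "\<And>\<alpha>. gen_eq (c \<alpha>) (d \<alpha>)"
  have mod: "moderate (\<lambda>e. weight m (\<lambda>\<alpha>. c \<alpha> e) \<xi>)"
    if "\<And>\<alpha>. moderate (c \<alpha>)" for c :: "('n \<Rightarrow> nat) \<Rightarrow> real \<Rightarrow> complex"
  proof (rule moderate_bound)
    show "eventually (\<lambda>e. norm (weight m (\<lambda>\<alpha>. c \<alpha> e) \<xi>)
      \<le> (\<Sum>\<alpha> | mi_order \<alpha> \<le> m. cmod (mpd \<alpha> (symbol_poly m (\<lambda>\<alpha>. c \<alpha> e)) \<xi>))) (at_right 0)"
      by (intro always_eventually allI) (simp add: weight_le_sum weight_nonneg)
    show "moderate (\<lambda>e. \<Sum>\<alpha> | mi_order \<alpha> \<le> m. cmod (mpd \<alpha> (symbol_poly m (\<lambda>\<alpha>. c \<alpha> e)) \<xi>))"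
      unfolding mpd_symbol_poly
      by (intro moderate_sum) (unfold moderate_norm, intro moderate_sum moderate_mult that moderate_const)
  qed
  have "negligible_net (\<lambda>e. weight m (\<lambda>\<alpha>. c \<alpha> e) \<xi> - weight m (\<lambda>\<alpha>. d \<alpha> e) \<xi>)"
  proof (rule negligible_net_bound)
    let ?h = "\<lambda>e. \<Sum>\<alpha> | mi_order \<alpha> \<le> m. cmod (mpd \<alpha> (symbol_poly m (\<lambda>\<alpha>. c \<alpha> e - d \<alpha> e)) \<xi>)"
    have "negligible_net (\<lambda>e. M * (c \<beta> e - d \<beta> e))" for \<beta> M
      using * by (intro negligible_net_mult) (auto simp: gen_eq_def)
    then have "negligible_net (\<lambda>e. (c \<beta> e - d \<beta> e) * M)" for \<beta> M
      by (simp only: mult.commute)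
    then show "negligible_net ?h"
      unfolding mpd_symbol_poly
      by (intro negligible_net_sum) (unfold negligible_net_norm, intro negligible_net_sum, simp only:)
    have "norm (weight m (\<lambda>\<alpha>. c \<alpha> e) \<xi> - weight m (\<lambda>\<alpha>. d \<alpha> e) \<xi>) \<le> ?h e" for e
    proof -
      have sym: "weight m (\<lambda>\<alpha>. d \<alpha> e - c \<alpha> e) \<xi> = weight m (\<lambda>\<alpha>. c \<alpha> e - d \<alpha> e) \<xi>"
        unfolding weight_def mpd_symbol_poly
        by (simp add: left_diff_distrib sum_subtractf norm_minus_commute)
      show ?thesis
        using weight_triangle[of m "\<lambda>\<alpha>. c \<alpha> e - d \<alpha> e" "\<lambda>\<alpha>. d \<alpha> e" \<xi>]
          weight_triangle[of m "\<lambda>\<alpha>. d \<alpha> e - c \<alpha> e" "\<lambda>\<alpha>. c \<alpha> e" \<xi>]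
          weight_le_sum[of m "\<lambda>\<alpha>. c \<alpha> e - d \<alpha> e" \<xi>]
        by (simp add: sym)
    qed
    then show "eventually (\<lambda>e. norm (weight m (\<lambda>\<alpha>. c \<alpha> e) \<xi> - weight m (\<lambda>\<alpha>. d \<alpha> e) \<xi>) \<le> ?h e) (at_right 0)"
      by (intro always_eventually) auto
  qed
  then show "gen_eq (\<lambda>e. weight m (\<lambda>\<alpha>. c \<alpha> e) \<xi>) (\<lambda>e. weight m (\<lambda>\<alpha>. d \<alpha> e) \<xi>)"
    using mod * by (simp add: gen_eq_def)
qed

end

theory Submission
  imports Defs
    "HOL-Computational_Algebra.Fundamental_Theorem_Algebra"
    "HOL-Probability.Characteristic_Functions"
    "HOL-Probability.Sinc_Integral"
    "HOL-Complex_Analysis.Cauchy_Integral_Formula"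
begin

text \<open>
  All four parts follow from one construction: a linear operator on test functions that inverts a
  constant coefficient differential operator on both sides, with bounds that depend on the
  coefficients only through the reciprocal of the modulus of one of them.

  Let \<open>P \<noteq> 0\<close> be a polynomial of degree at most \<open>m\<close> with coefficients \<open>a\<^sub>\<alpha>\<close>.  For a test function
  \<open>w\<close> the Fourier-Laplace transform \<open>F w(\<zeta>) = \<integral> w(y) e\<^sup>i\<^sup>\<zeta>\<^sup>y dy\<close> is entire, and the operator
  \<open>P(-D)\<close> multiplies it by \<open>P(\<zeta>)\<close>.  The idea of Malgrange, in the form given to it by Hoermander,
  is to divide by \<open>P\<close> not on the real space, where \<open>P\<close> has zeros, but on circles around the real
  points \<open>\<xi>\<close>:
  \<open>sol w(x) = (2\<pi>)\<^sup>-\<^sup>n \<integral>\<integral> e\<^sup>-\<^sup>i\<^sup>\<zeta>\<^sup>x F w(\<zeta>) / P(\<zeta>) dt d\<xi>\<close>, where \<open>\<zeta> = \<xi> + r e\<^sup>2\<^sup>\<pi>\<^sup>i\<^sup>t \<theta>\<close> with a radius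
  \<open>r = r(\<xi>)\<close> and a complex direction \<open>\<theta> = \<theta>(\<xi>)\<close>.  If \<open>w\<close> is replaced by \<open>P(-D) w\<close>, then the factor
  \<open>1 / P\<close> cancels; the mean of an entire function over a circle is its value at the centre, so
  Fourier inversion returns \<open>w\<close> (lemma \<open>sol_cdiff_op\<close>).  As \<open>sol\<close> commutes with
  derivatives, it is a right inverse of \<open>P(-D)\<close> as well (lemma \<open>cdiff_op_sol\<close>).

  The circles are chosen as follows.  Some point \<open>y\<close> of the unit torus satisfies
  \<open>\<bar>P(y)\<bar> \<ge> \<bar>a\<^sub>\<alpha>\<bar>\<close> for all \<open>\<alpha>\<close> (lemma \<open>coeff_le_value_on_torus\<close>).  Let \<open>\<theta>(\<xi>)\<close>
  point from \<open>\<xi>\<close> to \<open>y\<close>.  The polynomial \<open>z \<mapsto> P(\<xi> + z\<theta>)\<close> in one variable has at most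
  \<open>m\<close> roots, so one of the circles of radius \<open>1, \<dots>, m + 1\<close> stays at distance \<open>1/2\<close> from all of them, and
  on such a circle the polynomial is at least \<open>\<bar>P(y)\<bar>\<close> divided by the \<open>m\<close>-th power of a number that
  grows linearly with the distance from \<open>\<xi>\<close> to \<open>y\<close> (lemma \<open>cpoly_lower_bound_on_circle\<close>).  Hence \<open>1 / P\<close> grows polynomially in \<open>\<xi>\<close>, whereas
  \<open>F w\<close> decays rapidly, and every seminorm of \<open>sol w\<close> of order \<open>l\<close> is bounded by \<open>C / \<bar>a\<^sub>\<alpha>\<bar>\<close> times the
  seminorm of \<open>w\<close> of order \<open>l + m + 2n\<close>, where \<open>C\<close> does not depend on \<open>P\<close> or \<open>l\<close>
  (lemma \<open>seminorm_sol_le\<close>).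

  Invertibility of the weight means that for small \<open>\<epsilon>\<close> one of the coefficients of \<open>P\<^sub>\<epsilon>\<close> exceeds a
  power of \<open>\<epsilon>\<close>.  So the operators \<open>sol\<close> for \<open>P\<^sub>\<epsilon>\<close> lose a power of \<open>\<epsilon>\<close> that is the same for derivatives
  of all orders; nets with supports in a fixed compact set stay moderate, negligible or regular.
  Since compactly supported generalized functions have such representatives (lemma
  \<open>compact_representative\<close>), there is a linear map \<open>gsol\<close> from \<open>Gc\<close> to the Colombeau algebra.
  Built from the transposed symbol it solves the equation in parts (i) and (ii).  Built from \<open>P\<close> itself
  it satisfies \<open>gsol (P(-D) w) = w\<close>, and so the composition \<open>v \<circ> gsol\<close> solves the equation for a
  functional \<open>v\<close>; the seminorm estimate shows that it is continuous and, if \<open>v\<close> is basic,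
  that it is basic.
\<close>

section \<open>Lower bounds for polynomials\<close>

text \<open>The symbol at complex points; its restriction to real points is \<^const>\<open>symbol_poly\<close>.\<close>

definition cpoly :: "nat \<Rightarrow> (('n::finite \<Rightarrow> nat) \<Rightarrow> complex) \<Rightarrow> complex ^ 'n \<Rightarrow> complex" where
  "cpoly m a \<zeta> = (\<Sum>\<alpha> | mi_order \<alpha> \<le> m. a \<alpha> * (\<Prod>i\<in>UNIV. (\<zeta> $ i) ^ \<alpha> i))"

lemma mi_order_ge_component: "\<alpha> i \<le> mi_order \<alpha>" for \<alpha> :: "'n::finite \<Rightarrow> nat"
  unfolding mi_order_def by (rule member_le_sum) auto

lemma sum_roots_of_unity_power:
  fixes N :: nat
  assumes "N > 0" "b < N" "c < N"
  defines "\<omega> \<equiv> exp (2 * of_real pi * \<i> / of_nat N)"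
  shows "(\<Sum>k<N. (\<omega> ^ k) ^ b * inverse ((\<omega> ^ k) ^ c)) = (if b = c then of_nat N else 0)"
proof -
  have pw: "\<omega> ^ j = exp (2 * of_real pi * \<i> * of_nat j / of_nat N)" for j
    unfolding \<omega>_def by (subst exp_of_nat_mult[symmetric]) (simp add: mult_ac)
  have nz: "\<omega> \<noteq> 0" by (simp add: \<omega>_def)
  have "\<omega> ^ N = 1"
    using \<open>N > 0\<close> exp_two_pi_i by (simp add: pw)
  define x where "x = \<omega> ^ b / \<omega> ^ c"
  have swap: "(\<omega> ^ k) ^ b = (\<omega> ^ b) ^ k" for k b
    by (metis mult.commute power_mult)
  have trm: "(\<omega> ^ k) ^ b * inverse ((\<omega> ^ k) ^ c) = x ^ k" for k
    by (simp only: swap[of k b] swap[of k c] x_def power_divide divide_inverse power_inverse power_mult_distrib)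
  have "(\<omega> ^ b) ^ N = 1" for b
    by (simp only: swap[of b N, symmetric] swap[of N b, symmetric] \<open>\<omega> ^ N = 1\<close> power_one)
  then have "x ^ N = 1"
    by (simp add: x_def power_divide)
  show ?thesis
  proof (cases "b = c")
    case True
    then have "x = 1" using nz by (simp add: x_def)
    with True show ?thesis unfolding trm by simp
  next
    case False
    have "\<omega> ^ b \<noteq> \<omega> ^ c"
      unfolding pw using complex_root_unity_eq[of N b c] assms False by simp
    then have "x \<noteq> 1" using nz by (simp add: x_def)
    then have "(\<Sum>k<N. x ^ k) = 0"
      using \<open>x ^ N = 1\<close> by (simp add: geometric_sum)
    with False show ?thesis unfolding trm by simp
  qed
qed

text \<open>
  By discrete Fourier inversion on the grid of \<open>(m + 1)\<close>-th roots of unity each coefficient is a mean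
  of values of the polynomial multiplied by numbers of modulus \<open>1\<close>.  A grid point where the modulus is
  maximal therefore dominates all coefficients at once.
\<close>

lemma coeff_le_value_on_torus:
  fixes a :: "('n::finite \<Rightarrow> nat) \<Rightarrow> complex"
  shows "\<exists>y. (\<forall>i. cmod (y $ i) = 1) \<and> (\<forall>\<alpha>. mi_order \<alpha> \<le> m \<longrightarrow> cmod (a \<alpha>) \<le> cmod (cpoly m a y))"
proof -
  define N where "N = Suc m"
  define \<omega> where "\<omega> = exp (2 * of_real pi * \<i> / of_nat N)"
  define G where "G = PiE (UNIV :: 'n set) (\<lambda>_. {..<N})"
  define y :: "('n \<Rightarrow> nat) \<Rightarrow> complex ^ 'n" where "y k = (\<chi> i. \<omega> ^ k i)" for k
  have nw: "cmod \<omega> = 1" by (simp add: \<omega>_def)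
  have fin: "finite G" unfolding G_def by (intro finite_PiE) auto
  have ne: "G \<noteq> {}" unfolding G_def N_def by (auto simp: PiE_eq_empty_iff)
  have card: "card G = N ^ CARD('n)" unfolding G_def by (simp add: card_PiE)
  define F where "F k = cmod (cpoly m a (y k))" for k
  have "Max (F ` G) \<in> F ` G" using fin ne by (intro Max_in) auto
  then obtain k0 where "k0 \<in> G" "Max (F ` G) = F k0" by (rule imageE)
  moreover have "F k \<le> Max (F ` G)" if "k \<in> G" for k
    using that fin by (intro Max_ge) auto
  ultimately have k0: "k0 \<in> G" "\<And>k. k \<in> G \<Longrightarrow> cmod (cpoly m a (y k)) \<le> cmod (cpoly m a (y k0))"
    by (auto simp: F_def)
  show ?thesis
  proof (intro exI[of _ "y k0"] conjI allI impI)
    show "cmod (y k0 $ i) = 1" for i by (simp add: y_def norm_power nw)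
    fix \<alpha> :: "'n \<Rightarrow> nat" assume \<alpha>: "mi_order \<alpha> \<le> m"
    define h where "h k = (\<Prod>i\<in>UNIV. inverse ((\<omega> ^ k i) ^ \<alpha> i))" for k :: "'n \<Rightarrow> nat"
    have nh: "cmod (h k) = 1" for k by (simp add: h_def prod_norm[symmetric] norm_inverse norm_power nw)
    have orth: "(\<Sum>k\<in>G. (\<Prod>i\<in>UNIV. (\<omega> ^ k i) ^ \<beta> i) * h k) = (if \<beta> = \<alpha> then of_nat (N ^ CARD('n)) else 0)"
      if \<beta>: "mi_order \<beta> \<le> m" for \<beta>
    proof -
      have lt: "\<beta> i < N" "\<alpha> i < N" for i
        using mi_order_ge_component[of \<beta> i] mi_order_ge_component[of \<alpha> i] \<alpha> \<beta> by (auto simp: N_def)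
      have "(\<Sum>k\<in>G. (\<Prod>i\<in>UNIV. (\<omega> ^ k i) ^ \<beta> i) * h k)
          = (\<Sum>k\<in>G. \<Prod>i\<in>UNIV. (\<omega> ^ k i) ^ \<beta> i * inverse ((\<omega> ^ k i) ^ \<alpha> i))"
        by (simp add: h_def prod.distrib)
      also have "\<dots> = (\<Prod>i\<in>UNIV. \<Sum>j<N. (\<omega> ^ j) ^ \<beta> i * inverse ((\<omega> ^ j) ^ \<alpha> i))"
        unfolding G_def by (subst prod_sum_PiE) auto
      also have "\<dots> = (\<Prod>i\<in>(UNIV::'n set). if \<beta> i = \<alpha> i then of_nat N else 0)"
        unfolding \<omega>_def using sum_roots_of_unity_power[of N] lt by (intro prod.cong) (auto simp: N_def)
      also have "\<dots> = (if \<beta> = \<alpha> then of_nat (N ^ CARD('n)) else 0)"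
      proof (cases "\<beta> = \<alpha>")
        case False
        then obtain i where "\<beta> i \<noteq> \<alpha> i" by blast
        then show ?thesis using False by (auto intro!: prod_zero)
      qed auto
      finally show ?thesis .
    qed
    have "(\<Sum>k\<in>G. cpoly m a (y k) * h k)
        = (\<Sum>\<beta> | mi_order \<beta> \<le> m. a \<beta> * (\<Sum>k\<in>G. (\<Prod>i\<in>UNIV. (\<omega> ^ k i) ^ \<beta> i) * h k))"
      unfolding cpoly_def y_def sum_distrib_right sum_distrib_left
      by (subst sum.swap) (simp add: mult.assoc)
    also have "\<dots> = (\<Sum>\<beta> | mi_order \<beta> \<le> m. if \<beta> = \<alpha> then a \<alpha> * of_nat (N ^ CARD('n)) else 0)"
      by (intro sum.cong) (auto simp: orth)
    also have "\<dots> = a \<alpha> * of_nat (N ^ CARD('n))"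
      using \<alpha> by (subst sum.delta[OF finite_mi_order]) auto
    finally have eq: "(\<Sum>k\<in>G. cpoly m a (y k) * h k) = a \<alpha> * of_nat (N ^ CARD('n))" .
    have "cmod (a \<alpha>) * real (N ^ CARD('n)) = cmod (\<Sum>k\<in>G. cpoly m a (y k) * h k)"
      unfolding eq by (simp add: norm_mult norm_power)
    also have "\<dots> \<le> (\<Sum>k\<in>G. cmod (cpoly m a (y k0)))"
      by (intro order_trans[OF norm_sum] sum_mono) (simp add: norm_mult nh k0)
    also have "\<dots> = cmod (cpoly m a (y k0)) * real (N ^ CARD('n))"
      by (simp add: card)
    finally show "cmod (a \<alpha>) \<le> cmod (cpoly m a (y k0))" by (simp add: N_def)
  qed
qed

lemma degree_linear_factor_mult:
  fixes q :: "'a::idom poly"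
  shows "q \<noteq> 0 \<Longrightarrow> degree ([:- l, 1:] * q) = Suc (degree q)"
  by (subst degree_mult_eq) auto

text \<open>
  Factor by factor: \<open>\<bar>w - \<lambda>\<bar> \<le> \<bar>w - z\<bar> + \<bar>z - \<lambda>\<bar> \<le> (1 + 2 \<bar>w - z\<bar>) \<bar>z - \<lambda>\<bar>\<close> as soon as the root \<open>\<lambda>\<close>
  has distance at least \<open>1/2\<close> from \<open>z\<close>.  The leading coefficient does not enter, which
  is what makes the bound uniform in the polynomial.
\<close>

lemma poly_compare_away_from_roots:
  fixes q :: "complex poly"
  assumes "degree q \<le> d" "\<And>l. poly q l = 0 \<Longrightarrow> 1/2 \<le> cmod (z - l)"
  shows "cmod (poly q w) \<le> (1 + 2 * cmod (w - z)) ^ d * cmod (poly q z)"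
  using assms
proof (induction d arbitrary: q)
  case 0
  then obtain c where "q = [:c:]" by (metis degree_eq_zeroE le_zero_eq)
  then show ?case by simp
next
  case (Suc d)
  show ?case
  proof (cases "degree q = 0")
    case True
    then obtain c where "q = [:c:]" by (metis degree_eq_zeroE)
    moreover have "1 \<le> (1 + 2 * cmod (w - z)) ^ Suc d" by (rule one_le_power) simp
    ultimately show ?thesis using mult_right_mono[of 1 "(1 + 2 * cmod (w - z)) ^ Suc d" "cmod c"]
      by simp
  next
    case False
    then have "\<not> constant (poly q)" by (simp add: constant_degree)
    from Fundamental_Theorem_Algebra.fundamental_theorem_of_algebra[OF this] obtain l where l: "poly q l = 0" by (elim exE)
    then have "[:-l, 1:] dvd q" by (simp add: poly_eq_0_iff_dvd)
    then obtain q' where q': "q = [:-l, 1:] * q'" by (rule dvdE)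
    have "q' \<noteq> 0" using False q' by auto
    then have "degree q = Suc (degree q')" unfolding q' by (rule degree_linear_factor_mult)
    then have IH: "cmod (poly q' w) \<le> (1 + 2 * cmod (w - z)) ^ d * cmod (poly q' z)"
      using Suc.prems by (intro Suc.IH) (auto simp: q')
    have zl: "1/2 \<le> cmod (z - l)" using Suc.prems(2) l by blast
    have "cmod (w - l) \<le> cmod (w - z) + cmod (z - l)"
      using norm_triangle_ineq[of "w - z" "z - l"] by simp
    also have "\<dots> \<le> (1 + 2 * cmod (w - z)) * cmod (z - l)"
      using mult_right_mono[OF zl, of "2 * cmod (w - z)"] by (simp add: algebra_simps)
    finally have "cmod (w - l) \<le> (1 + 2 * cmod (w - z)) * cmod (z - l)" .
    from mult_mono[OF this IH]
    have "cmod (w - l) * cmod (poly q' w)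
        \<le> (1 + 2 * cmod (w - z)) ^ Suc d * (cmod (z - l) * cmod (poly q' z))"
      by (simp add: mult_ac)
    moreover have "cmod (poly q x) = cmod (x - l) * cmod (poly q' x)" for x
      unfolding q' by (simp add: norm_mult[symmetric] left_diff_distrib)
    ultimately show ?thesis by simp
  qed
qed

text \<open>
  The closed annuli of width \<open>1\<close> around the circles of radius \<open>1, \<dots>, m + 1\<close> have disjoint
  interiors, so \<open>m\<close> roots cannot meet all of these interiors.
\<close>

lemma exists_radius_avoiding_roots:
  fixes q :: "complex poly"
  assumes "q \<noteq> 0" "degree q \<le> m"
  shows "\<exists>r\<in>{1..Suc m}. \<forall>l z. poly q l = 0 \<longrightarrow> cmod z = real r \<longrightarrow> 1/2 \<le> cmod (z - l)"
proof -
  define Z where "Z = {l. poly q l = 0}"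
  have "finite Z" using assms(1) by (simp add: Z_def poly_roots_finite)
  have "card Z \<le> m" using card_poly_roots_bound[OF assms(1)] assms(2) by (simp add: Z_def)
  define B where "B = (\<lambda>l. nat (round (cmod l))) ` Z"
  have "card B < card {1..Suc m}"
    using card_image_le[OF \<open>finite Z\<close>, of "\<lambda>l. nat (round (cmod l))"] \<open>card Z \<le> m\<close> by (simp add: B_def)
  then have "\<not> {1..Suc m} \<subseteq> B"
    using card_mono[of B "{1..Suc m}"] \<open>finite Z\<close> by (auto simp: B_def)
  then obtain r where r: "r \<in> {1..Suc m}" "r \<notin> B" by blast
  show ?thesis
  proof (intro bexI[OF _ r(1)] allI impI)
    fix l z assume "poly q l = 0" "cmod z = real r"
    show "1/2 \<le> cmod (z - l)"
    proof (rule ccontr)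
      assume "\<not> 1/2 \<le> cmod (z - l)"
      then have "\<bar>cmod l - real r\<bar> < 1/2"
        using norm_triangle_ineq3[of z l] \<open>cmod z = real r\<close> by linarith
      then have "round (cmod l) = int r" by (intro round_unique') simp
      then have "r \<in> B" using \<open>poly q l = 0\<close> by (force simp: B_def Z_def)
      then show False using r by simp
    qed
  qed
qed

lemma cpoly_on_line:
  fixes u v :: "complex ^ 'n::finite"
  obtains q where "degree q \<le> m" "\<And>z. poly q z = cpoly m a (u + z *s v)"
proof
  define q where "q = (\<Sum>\<alpha> | mi_order \<alpha> \<le> m. smult (a \<alpha>) (\<Prod>i\<in>UNIV. [:u $ i, v $ i:] ^ \<alpha> i))"
  show "poly q z = cpoly m a (u + z *s v)" for z
    by (simp add: q_def cpoly_def poly_sum poly_prod)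
  show "degree q \<le> m"
    unfolding q_def
  proof (rule degree_sum_le)
    show "finite {\<alpha>::'n \<Rightarrow> nat. mi_order \<alpha> \<le> m}" by (rule finite_mi_order)
    fix \<alpha> :: "'n \<Rightarrow> nat" assume "\<alpha> \<in> {\<alpha>. mi_order \<alpha> \<le> m}"
    have "degree (\<Prod>i\<in>UNIV. [:u $ i, v $ i:] ^ \<alpha> i) \<le> (\<Sum>i\<in>UNIV. degree ([:u $ i, v $ i:] ^ \<alpha> i))"
      by (rule degree_prod_sum_le[simplified o_def]) simp
    also have "\<dots> \<le> (\<Sum>i\<in>UNIV. \<alpha> i)"
    proof (rule sum_mono)
      fix i
      have "degree ([:u $ i, v $ i:] ^ \<alpha> i) \<le> degree [:u $ i, v $ i:] * \<alpha> i" by (rule degree_power_le)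
      also have "\<dots> \<le> 1 * \<alpha> i" by (intro mult_right_mono) auto
      finally show "degree ([:u $ i, v $ i:] ^ \<alpha> i) \<le> \<alpha> i" by simp
    qed
    also have "\<dots> \<le> m" using \<open>\<alpha> \<in> _\<close> by (simp add: mi_order_def)
    finally have "degree (\<Prod>i\<in>UNIV. [:u $ i, v $ i:] ^ \<alpha> i) \<le> m" .
    then show "degree (smult (a \<alpha>) (\<Prod>i\<in>UNIV. [:u $ i, v $ i:] ^ \<alpha> i)) \<le> m"
      using degree_smult_le order_trans by blast
  qed
qed

text \<open>
  The line through \<open>u\<close> in direction \<open>(y - u) / W\<close> reaches \<open>y\<close> at the parameter \<open>W\<close>, so that the value
  at \<open>y\<close> controls the values on a suitable small circle around \<open>u\<close>.  The direction has norm less than \<open>1\<close>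
  also when \<open>y\<close> is close or equal to \<open>u\<close>, and it depends continuously on \<open>u\<close>.
\<close>

lemma cpoly_lower_bound_on_circle:
  fixes y u :: "complex ^ 'n::finite"
  assumes "cpoly m a y \<noteq> 0"
  defines "W \<equiv> 1 + norm (y - u)"
  shows "\<exists>r\<in>{1..Suc m}. \<forall>z. cmod z = real r \<longrightarrow>
    cmod (cpoly m a y) / (1 + 2 * (W + real (Suc m))) ^ m
      \<le> cmod (cpoly m a (u + z *s ((1 / of_real W) *s (y - u))))"
proof -
  define v where "v = (1 / complex_of_real W) *s (y - u)"
  have "W \<ge> 1" by (simp add: W_def)
  obtain q where q: "degree q \<le> m" "\<And>z. poly q z = cpoly m a (u + z *s v)"
    using cpoly_on_line[of m a u v] by blast
  have "u + of_real W *s v = y"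
  proof (rule vec_eq_iff[THEN iffD2], rule allI)
    fix i
    have "complex_of_real W * (1 / complex_of_real W * (y $ i - u $ i)) = y $ i - u $ i"
      using \<open>W \<ge> 1\<close> by simp
    then show "(u + of_real W *s v) $ i = y $ i" using \<open>W \<ge> 1\<close> unfolding v_def by simp
  qed
  then have qW: "poly q (of_real W) = cpoly m a y" by (simp add: q(2))
  then have "q \<noteq> 0" using assms(1) by auto
  then obtain r where r: "r \<in> {1..Suc m}"
    "\<And>l z. poly q l = 0 \<Longrightarrow> cmod z = real r \<Longrightarrow> 1/2 \<le> cmod (z - l)"
    using exists_radius_avoiding_roots[OF _ q(1)] by blast
  show ?thesis
  proof (intro bexI[OF _ r(1)] allI impI)
    fix z assume z: "cmod z = real r"
    have "cmod (complex_of_real W - z) \<le> W + cmod z"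
      using norm_triangle_ineq4[of "complex_of_real W" z] \<open>W \<ge> 1\<close> by simp
    also have "\<dots> \<le> W + real (Suc m)" using z r(1) by simp
    finally have le: "(1 + 2 * cmod (of_real W - z)) ^ m \<le> (1 + 2 * (W + real (Suc m))) ^ m"
      by (intro power_mono) auto
    have "cmod (cpoly m a y) \<le> (1 + 2 * cmod (of_real W - z)) ^ m * cmod (poly q z)"
      using poly_compare_away_from_roots[OF q(1), of z "of_real W"] r(2)[OF _ z] qW by simp
    also have "\<dots> \<le> (1 + 2 * (W + real (Suc m))) ^ m * cmod (poly q z)"
      by (intro mult_right_mono le) simp
    finally have "cmod (cpoly m a y) / (1 + 2 * (W + real (Suc m))) ^ m \<le> cmod (poly q z)"
      using \<open>W \<ge> 1\<close> by (subst pos_divide_le_eq) (simp_all add: mult.commute)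
    then show "cmod (cpoly m a y) / (1 + 2 * (W + real (Suc m))) ^ m
        \<le> cmod (cpoly m a (u + z *s ((1 / of_real W) *s (y - u))))"
      unfolding q(2) v_def .
  qed
qed

section \<open>Integration by parts for compactly supported functions\<close>

lemma compact_subset_cball_0:
  fixes K :: "'a::real_normed_vector set"
  assumes "compact K"
  shows "\<exists>R. K \<subseteq> cball 0 R"
  using compact_imp_bounded[OF assms] by (auto simp: bounded_iff subset_iff)

lemma integrable_compact_support:
  fixes f :: "'a::euclidean_space \<Rightarrow> 'b::{banach, second_countable_topology}"
  assumes "continuous_on UNIV f" "compact K" "\<And>x. x \<notin> K \<Longrightarrow> f x = 0"
  shows "integrable lborel f"
proof -
  have "integrable lborel (\<lambda>x. indicator K x *\<^sub>R f x)"
    using assms by (intro borel_integrable_compact) (auto intro: continuous_on_subset)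
  moreover have "(\<lambda>x. indicator K x *\<^sub>R f x) = f"
    using assms(3) by (auto simp: indicator_def fun_eq_iff)
  ultimately show ?thesis by simp
qed

lemma norm_integral_le:
  fixes f :: "'a \<Rightarrow> 'b::{banach, second_countable_topology}"
  assumes "integrable M f" "integrable M g" "\<And>x. x \<in> space M \<Longrightarrow> norm (f x) \<le> g x"
  shows "norm (integral\<^sup>L M f) \<le> integral\<^sup>L M g"
proof -
  have "norm (integral\<^sup>L M f) \<le> (LINT x|M. norm (f x))" by (rule integral_norm_bound)
  also have "\<dots> \<le> integral\<^sup>L M g" using assms by (intro integral_mono) auto
  finally show ?thesis .
qed

lemma integral_lborel_translate:
  fixes f :: "'a::euclidean_space \<Rightarrow> 'b::{banach, second_countable_topology}"
  assumes "f \<in> borel_measurable borel"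
  shows "integral\<^sup>L lborel (\<lambda>x. f (x + a)) = integral\<^sup>L lborel f"
proof -
  have "integral\<^sup>L lborel f = integral\<^sup>L (distr lborel borel ((+) a)) f"
    by (simp add: lborel_distr_plus)
  also have "\<dots> = integral\<^sup>L lborel (\<lambda>x. f (a + x))"
    by (intro integral_distr) (use assms in auto)
  finally show ?thesis by (simp add: add.commute)
qed

lemma partial_deriv_line:
  fixes f :: "'n::finite cfun"
  assumes "\<And>x. f differentiable at x"
  shows "((\<lambda>t. f (x + t *\<^sub>R axis i 1)) has_vector_derivative partial_deriv i f (x + t *\<^sub>R axis i 1)) (at t within S)"
proof -
  have "((\<lambda>t. x + t *\<^sub>R axis i (1::real)) has_derivative (\<lambda>t. t *\<^sub>R axis i 1)) (at t within S)"
    by (auto intro!: derivative_eq_intros)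
  moreover have "(f has_derivative frechet_derivative f (at (x + t *\<^sub>R axis i 1))) (at (x + t *\<^sub>R axis i 1))"
    using assms by (simp add: frechet_derivative_works)
  ultimately have "((\<lambda>t. f (x + t *\<^sub>R axis i 1)) has_derivative
      (\<lambda>s. frechet_derivative f (at (x + t *\<^sub>R axis i 1)) (s *\<^sub>R axis i 1))) (at t within S)"
    by (rule has_derivative_compose)
  moreover have "frechet_derivative f (at y) (s *\<^sub>R axis i 1) = s *\<^sub>R partial_deriv i f y" for s y
    using linear_scale[OF linear_frechet_derivative[OF assms]] by (simp add: partial_deriv_def)
  ultimately show ?thesis by (simp add: has_vector_derivative_def)
qed

lemma has_vector_derivative_quotient:
  fixes g :: "'b::real_normed_vector \<Rightarrow> 'a::real_normed_vector"
  assumes "((\<lambda>t. g (x + t *\<^sub>R e)) has_vector_derivative d) (at 0)"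
  shows "((\<lambda>t. (1 / t) *\<^sub>R (g (x + t *\<^sub>R e) - g x)) \<longlongrightarrow> d) (at 0)"
proof -
  have "((\<lambda>h. norm (g (x + h *\<^sub>R e) - g x - h *\<^sub>R d) / norm h) \<longlongrightarrow> 0) (at 0)"
    using assms by (simp add: has_vector_derivative_def has_derivative_at)
  moreover have "eventually (\<lambda>h. norm (g (x + h *\<^sub>R e) - g x - h *\<^sub>R d) / norm h
      = norm ((1 / h) *\<^sub>R (g (x + h *\<^sub>R e) - g x) - d)) (at 0)"
  proof -
    have "eventually (\<lambda>h::real. h \<noteq> 0) (at 0)" by (simp add: eventually_at_filter)
    then show ?thesis
  proof eventually_elim
    case (elim h)
    have "(1 / h) *\<^sub>R (g (x + h *\<^sub>R e) - g x) - d = (1 / h) *\<^sub>R (g (x + h *\<^sub>R e) - g x - h *\<^sub>R d)"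
      using elim by (simp add: scaleR_diff_right)
    then show ?case by (simp add: divide_inverse mult.commute)
  qed
  qed
  ultimately have "((\<lambda>h. norm ((1 / h) *\<^sub>R (g (x + h *\<^sub>R e) - g x) - d)) \<longlongrightarrow> 0) (at 0)"
    by (rule Lim_transform_eventually)
  then show ?thesis using Lim_null tendsto_norm_zero_iff by blast
qed

lemma norm_increment_le:
  fixes f :: "'n::finite cfun"
  assumes "\<And>x. f differentiable at x" "\<And>x. cmod (partial_deriv i f x) \<le> B"
  shows "cmod (f (x + h *\<^sub>R axis i 1) - f x) \<le> B * \<bar>h\<bar>"
proof -
  have "norm ((\<lambda>t. f (x + t *\<^sub>R axis i 1)) h - (\<lambda>t. f (x + t *\<^sub>R axis i 1)) 0) \<le> B * norm (h - 0)"
  proof (rule differentiable_bound[where S = UNIV])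
    show "((\<lambda>t. f (x + t *\<^sub>R axis i 1)) has_derivative (\<lambda>s. s *\<^sub>R partial_deriv i f (x + t *\<^sub>R axis i 1)))
        (at t within UNIV)" for t
      using partial_deriv_line[OF assms(1)] by (simp add: has_vector_derivative_def)
    show "onorm (\<lambda>s. s *\<^sub>R partial_deriv i f (x + t *\<^sub>R axis i 1)) \<le> B" for t
      by (rule onorm_le) (use assms(2) in \<open>simp add: mult.commute[of B] mult_left_mono\<close>)
  qed auto
  then show ?thesis by simp
qed

text \<open>
  Difference quotients have integral \<open>0\<close> by translation invariance, and they converge boundedly on
  a compact set.
\<close>

lemma integral_partial_deriv_eq_0:
  fixes f :: "'n::finite cfun"
  assumes f: "\<And>x. f differentiable at x" and cont: "continuous_on UNIV (partial_deriv i f)"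
    and K: "compact K" "\<And>x. x \<notin> K \<Longrightarrow> f x = 0" "\<And>x. x \<notin> K \<Longrightarrow> partial_deriv i f x = 0"
  shows "integral\<^sup>L lborel (partial_deriv i f) = 0"
proof -
  let ?e = "axis i (1::real) :: real ^ 'n"
  have cf: "continuous_on UNIV f"
    using f by (auto intro!: continuous_at_imp_continuous_on differentiable_imp_continuous_within)
  obtain R where R: "K \<subseteq> cball 0 R" using compact_subset_cball_0[OF K(1)] by blast
  \<comment> \<open>a common support of the difference quotients, whose increments are at most \<open>1\<close>\<close>
  define K' where "K' = cball (0 :: real ^ 'n) (R + 1)"
  have "compact (partial_deriv i f ` K)"
    by (intro compact_continuous_image continuous_on_subset[OF cont] K) auto
  then obtain B0 where B0: "\<And>x. x \<in> K \<Longrightarrow> cmod (partial_deriv i f x) \<le> B0"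
    by (meson bounded_iff compact_imp_bounded imageI)
  define B where "B = max B0 0"
  have B: "cmod (partial_deriv i f x) \<le> B" for x
    using B0[of x] K(3)[of x] by (cases "x \<in> K") (auto simp: B_def)
  have "B \<ge> 0" by (simp add: B_def)
  define h where "h k = 1 / real (Suc k)" for k
  define q where "q k x = (1 / h k) *\<^sub>R (f (x + h k *\<^sub>R ?e) - f x)" for k x
  have hpos: "0 < h k" "h k \<le> 1" for k by (auto simp: h_def)
  have fi: "integrable lborel f" by (rule integrable_compact_support[OF cf K(1,2)])
  have mf [measurable]: "f \<in> borel_measurable borel" by (intro borel_measurable_continuous_onI cf)
  have fi': "integrable lborel (\<lambda>x. f (x + a))" for a
  proof (rule integrable_compact_support)
    show "continuous_on UNIV (\<lambda>x. f (x + a))"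
      by (intro continuous_on_compose2[OF cf] continuous_intros) auto
    show "compact ((\<lambda>x. x - a) ` K)"
      by (intro compact_continuous_image continuous_intros K)
    show "f (x + a) = 0" if "x \<notin> (\<lambda>x. x - a) ` K" for x
      using that by (intro K) (metis add_diff_cancel_right' image_eqI)
  qed
  have "integral\<^sup>L lborel (q k) = 0" for k
    unfolding q_def using fi fi' integral_lborel_translate[OF mf] by simp
  moreover have "(\<lambda>k. integral\<^sup>L lborel (q k)) \<longlonglongrightarrow> integral\<^sup>L lborel (partial_deriv i f)"
  proof (rule integral_dominated_convergence)
    show "partial_deriv i f \<in> borel_measurable lborel"
      using borel_measurable_continuous_onI[OF cont] by simp
    show "q k \<in> borel_measurable lborel" for k unfolding q_def by simp
    show "integrable lborel (\<lambda>x. indicator K' x *\<^sub>R B)"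
      unfolding K'_def by (intro borel_integrable_compact) auto
    show "AE x in lborel. (\<lambda>k. q k x) \<longlonglongrightarrow> partial_deriv i f x"
    proof (rule AE_I2)
      fix x
      have "((\<lambda>t. f (x + t *\<^sub>R ?e)) has_vector_derivative partial_deriv i f x) (at 0)"
        using partial_deriv_line[OF f, of x i 0] by simp
      then have "((\<lambda>t. (1 / t) *\<^sub>R (f (x + t *\<^sub>R ?e) - f x)) \<longlongrightarrow> partial_deriv i f x) (at 0)"
        by (rule has_vector_derivative_quotient)
      then show "(\<lambda>k. q k x) \<longlonglongrightarrow> partial_deriv i f x"
        unfolding q_def
      proof (rule filterlim_compose)
        have "h \<longlonglongrightarrow> 0" unfolding h_def by (rule lim_inverse_n'[THEN LIMSEQ_Suc])
        then show "filterlim h (at 0) sequentially"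
          using hpos by (auto simp: filterlim_at intro!: eventuallyI) (metis less_irrefl)
      qed
    qed
    show "AE x in lborel. norm (q k x) \<le> indicator K' x *\<^sub>R B" for k
    proof (rule AE_I2)
      fix x
      have 1: "norm (q k x) \<le> B"
        using norm_increment_le[OF f B, of x "h k"] hpos[of k]
        unfolding q_def norm_scaleR by (simp add: pos_divide_le_eq)
      have "q k x = 0" if "x \<notin> K'"
      proof -
        have "R + 1 < norm x" using that by (simp add: K'_def)
        moreover have "norm x \<le> norm (x + h k *\<^sub>R ?e) + norm (h k *\<^sub>R ?e)"
          using norm_triangle_ineq4[of "x + h k *\<^sub>R ?e" "h k *\<^sub>R ?e"] by simp
        ultimately have "x \<notin> K" "x + h k *\<^sub>R ?e \<notin> K"
          using R hpos[of k] by (auto simp: subset_iff)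
        then show ?thesis by (simp add: q_def K)
      qed
      then show "norm (q k x) \<le> indicator K' x *\<^sub>R B"
        using 1 by (cases "x \<in> K'") auto
    qed
  qed
  ultimately show ?thesis by (simp add: LIMSEQ_const_iff)
qed

section \<open>The Fourier-Laplace transform\<close>

text \<open>
  The bilinear pairing of \<open>\<complex>\<^sup>n\<close> and \<open>\<real>\<^sup>n\<close> (no complex conjugation), for which \<open>e\<^sup>i\<^sup>\<zeta>\<^sup>x\<close> is holomorphic
  in \<open>\<zeta>\<close>.
\<close>

definition cdot :: "complex ^ 'n \<Rightarrow> real ^ 'n::finite \<Rightarrow> complex" where
  "cdot \<zeta> x = (\<Sum>i\<in>UNIV. \<zeta> $ i * of_real (x $ i))"

definition fourier_laplace :: "'n::finite cfun \<Rightarrow> complex ^ 'n \<Rightarrow> complex" where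
  "fourier_laplace w \<zeta> = (LINT x|lborel. w x * exp (\<i> * cdot \<zeta> x))"

lemma cdot_add_right: "cdot \<zeta> (x + y) = cdot \<zeta> x + cdot \<zeta> y"
  by (simp add: cdot_def ring_distribs sum.distrib)

lemma cdot_scaleR_right: "cdot \<zeta> (c *\<^sub>R x) = of_real c * cdot \<zeta> x"
  by (simp add: cdot_def sum_distrib_left mult_ac)

lemma cdot_minus_right: "cdot \<zeta> (- x) = - cdot \<zeta> x"
  by (simp add: cdot_def sum_negf)

lemma cdot_axis: "cdot \<zeta> (axis i c) = \<zeta> $ i * of_real c"
proof -
  have "cdot \<zeta> (axis i c) = (\<Sum>j\<in>UNIV. if j = i then \<zeta> $ i * of_real c else 0)"
    unfolding cdot_def by (intro sum.cong) (auto simp: axis_def)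
  then show ?thesis by simp
qed

lemma continuous_cdot: "continuous_on S (cdot \<zeta>)"
  unfolding cdot_def by (intro continuous_intros)

lemma bounded_linear_cdot: "bounded_linear (cdot \<zeta>)"
proof -
  have "linear (cdot \<zeta>)"
    by (rule linearI) (simp_all add: cdot_add_right cdot_scaleR_right scaleR_conv_of_real[where 'a = complex])
  then show ?thesis by (rule linear_conv_bounded_linear[THEN iffD1])
qed

lemma measurable_cdot [measurable (raw)]:
  assumes "f \<in> borel_measurable M" "g \<in> borel_measurable M"
  shows "(\<lambda>s. cdot (f s) (g s :: real ^ 'n::finite)) \<in> borel_measurable M"
proof -
  have "continuous_on UNIV (\<lambda>p. cdot (fst p) (snd p :: real ^ 'n))"
    unfolding cdot_def by (intro continuous_intros)
  from borel_measurable_continuous_Pair[OF assms this] show ?thesis by simp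
qed

lemma norm_exp_cdot_le:
  fixes \<zeta> :: "complex ^ 'n::finite"
  assumes "\<And>i. \<bar>Im (\<zeta> $ i)\<bar> \<le> B" "norm x \<le> R"
  shows "cmod (exp (\<i> * cdot \<zeta> x)) \<le> exp (real CARD('n) * B * R)"
proof -
  have "0 \<le> B" using assms(1)[of undefined] by linarith
  have "Re (\<i> * cdot \<zeta> x) = (\<Sum>i\<in>UNIV. - Im (\<zeta> $ i) * x $ i)"
    by (simp add: cdot_def sum_negf)
  also have "\<dots> \<le> (\<Sum>i\<in>(UNIV :: 'n set). B * R)"
  proof (rule sum_mono)
    fix i
    have "- Im (\<zeta> $ i) * x $ i \<le> \<bar>Im (\<zeta> $ i)\<bar> * \<bar>x $ i\<bar>"
      using abs_ge_self[of "- Im (\<zeta> $ i) * x $ i"] by (simp add: abs_mult)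
    also have "\<dots> \<le> B * R"
      using assms component_le_norm_cart[of x i] \<open>0 \<le> B\<close> by (intro mult_mono) auto
    finally show "- Im (\<zeta> $ i) * x $ i \<le> B * R" .
  qed
  finally show ?thesis by simp
qed

lemma partial_deriv_vanish:
  assumes "open U" "\<And>x. x \<in> U \<Longrightarrow> f x = 0" "x \<in> U"
  shows "partial_deriv i f x = 0"
proof -
  have "((\<lambda>_. 0) has_derivative (\<lambda>_. 0)) (at x)" by simp
  then have "(f has_derivative (\<lambda>_. 0)) (at x)"
    by (rule has_derivative_transform_within_open[OF _ assms(1,3)]) (simp add: assms(2))
  then show ?thesis by (rule partial_deriv_eqI)
qed

lemma foldr_partial_deriv_vanish:
  assumes "open U" "\<And>x. x \<in> U \<Longrightarrow> f x = 0" "x \<in> U"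
  shows "foldr partial_deriv is f x = 0"
  using assms(3)
proof (induction "is" arbitrary: x)
  case (Cons i "is")
  then show ?case by (auto intro!: partial_deriv_vanish[OF assms(1)])
qed (use assms in simp)

lemma outside_tsupp: "tsupp f \<subseteq> K \<Longrightarrow> x \<notin> K \<Longrightarrow> f x = 0"
  unfolding tsupp_def using closure_subset[of "{x. f x \<noteq> 0}"] by auto

lemma tsupp_subsetI: "closed K \<Longrightarrow> (\<And>x. x \<notin> K \<Longrightarrow> f x = 0) \<Longrightarrow> tsupp f \<subseteq> K"
  unfolding tsupp_def by (rule closure_minimal) auto

lemma tsupp_foldr_partial_deriv: "tsupp f \<subseteq> K \<Longrightarrow> closed K \<Longrightarrow> tsupp (foldr partial_deriv is f) \<subseteq> K"
  by (rule tsupp_subsetI) (auto intro!: foldr_partial_deriv_vanish[of "- K"] intro: outside_tsupp)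

lemma C_infinity_on_foldr:
  "f \<in> C_infinity_on K \<Longrightarrow> closed K \<Longrightarrow> foldr partial_deriv is f \<in> C_infinity_on K"
  by (simp add: C_infinity_on_def smooth_foldr tsupp_foldr_partial_deriv)

lemma continuous_fourier_integrand:
  assumes "smooth w"
  shows "continuous_on S (\<lambda>x. w x * exp (\<i> * cdot \<zeta> x))"
  by (intro continuous_intros smooth_continuous_on[OF assms] continuous_cdot)

lemma integrable_fourier:
  assumes "w \<in> C_infinity_on K" "compact K"
  shows "integrable lborel (\<lambda>x. w x * exp (\<i> * cdot \<zeta> x))"
  using assms outside_tsupp
  by (intro integrable_compact_support[OF _ assms(2)] continuous_fourier_integrand)
    (auto simp: C_infinity_on_def)

lemma fourier_laplace_partial_deriv:
  assumes w: "w \<in> C_infinity_on K" and K: "compact K"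
  shows "fourier_laplace (partial_deriv j w) \<zeta> = - \<i> * \<zeta> $ j * fourier_laplace w \<zeta>"
proof -
  have sw: "smooth w" and supp: "\<And>x. x \<notin> K \<Longrightarrow> w x = 0"
    using w outside_tsupp by (auto simp: C_infinity_on_def)
  define g where "g x = w x * exp (\<i> * cdot \<zeta> x)" for x
  have d: "(g has_derivative (\<lambda>h. w x * (exp (\<i> * cdot \<zeta> x) * (\<i> * cdot \<zeta> h))
      + frechet_derivative w (at x) h * exp (\<i> * cdot \<zeta> x))) (at x)" for x
  proof -
    have "((\<lambda>x. exp (\<i> * cdot \<zeta> x)) has_derivative (\<lambda>h. exp (\<i> * cdot \<zeta> x) * (\<i> * cdot \<zeta> h))) (at x)"
      by (rule has_derivative_exp has_derivative_mult_right bounded_linear_imp_has_derivative bounded_linear_cdot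
            has_derivative_compose[where g = exp] DERIV_exp[THEN has_field_derivative_imp_has_derivative])+
    then show ?thesis
      unfolding g_def using smoothD[OF sw, of "[]" x]
      by (intro has_derivative_mult) (auto simp: frechet_derivative_works)
  qed
  have pg: "partial_deriv j g = (\<lambda>x. (\<i> * \<zeta> $ j) * g x + partial_deriv j w x * exp (\<i> * cdot \<zeta> x))"
    using partial_deriv_eqI[OF d, of j]
    by (simp add: fun_eq_iff g_def cdot_axis partial_deriv_def[of j w] mult_ac)
  have w': "partial_deriv j w \<in> C_infinity_on K"
    using C_infinity_on_foldr[OF w compact_imp_closed[OF K], of "[j]"] by simp
  have "integral\<^sup>L lborel (partial_deriv j g) = 0"
  proof (rule integral_partial_deriv_eq_0[OF _ _ K])
    show "g differentiable at x" for x using d differentiable_def by blast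
    show "continuous_on UNIV (partial_deriv j g)"
      unfolding pg g_def
      by (intro continuous_intros continuous_cdot smooth_continuous_on sw smooth_partial_deriv)
    show "g x = 0" if "x \<notin> K" for x using supp[OF that] by (simp add: g_def)
    show "partial_deriv j g x = 0" if "x \<notin> K" for x
      unfolding pg using supp[OF that] w' that outside_tsupp[of "partial_deriv j w" K x]
      by (simp add: g_def C_infinity_on_def)
  qed
  moreover have "integral\<^sup>L lborel (partial_deriv j g)
      = (\<i> * \<zeta> $ j) * fourier_laplace w \<zeta> + fourier_laplace (partial_deriv j w) \<zeta>"
    unfolding pg fourier_laplace_def g_def
    using integrable_fourier[OF w K, of \<zeta>] integrable_fourier[OF w' K, of \<zeta>] by simp
  ultimately show ?thesis by (simp add: add_eq_0_iff)
qed

lemma fourier_laplace_foldr: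
  assumes w: "w \<in> C_infinity_on K" and K: "compact K"
  shows "fourier_laplace (foldr partial_deriv is w) \<zeta> = (\<Prod>i\<leftarrow>is. - \<i> * \<zeta> $ i) * fourier_laplace w \<zeta>"
proof (induction "is")
  case (Cons i "is")
  have "foldr partial_deriv is w \<in> C_infinity_on K"
    by (rule C_infinity_on_foldr[OF w compact_imp_closed[OF K]])
  from fourier_laplace_partial_deriv[OF this K, of i \<zeta>] Cons show ?case by simp
qed simp

lemma mpd_replicate:
  assumes "smooth w"
  shows "foldr partial_deriv (replicate k i) w = mpd (\<lambda>j. if j = i then k else 0) w"
  by (rule mpd_eq[OF assms, symmetric]) (induction k; auto)

lemma norm_fourier_laplace_le:
  fixes w :: "'n::finite cfun"
  assumes w: "w \<in> C_infinity_on K" and K: "compact K" "K \<subseteq> cball 0 R"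
    and S: "\<And>x. x \<in> K \<Longrightarrow> cmod (w x) \<le> S" "0 \<le> S" and B: "\<And>i. \<bar>Im (\<zeta> $ i)\<bar> \<le> B"
  shows "cmod (fourier_laplace w \<zeta>) \<le> S * exp (real CARD('n) * B * R) * measure lborel (cball (0 :: real ^ 'n) R)"
proof -
  have "cmod (fourier_laplace w \<zeta>)
      \<le> (LINT x|lborel. indicator (cball (0 :: real ^ 'n) R) x *\<^sub>R (S * exp (real CARD('n) * B * R)))"
    unfolding fourier_laplace_def
  proof (rule norm_integral_le)
    show "integrable lborel (\<lambda>x. w x * exp (\<i> * cdot \<zeta> x))" by (rule integrable_fourier[OF w K(1)])
    show "integrable lborel (\<lambda>x::real^'n. indicator (cball 0 R) x *\<^sub>R (S * exp (real CARD('n) * B * R)))"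
      by (intro borel_integrable_compact) auto
    fix x
    show "cmod (w x * exp (\<i> * cdot \<zeta> x)) \<le> indicator (cball 0 R) x *\<^sub>R (S * exp (real CARD('n) * B * R))"
    proof (cases "x \<in> K")
      case True
      then have "norm x \<le> R" using K by auto
      then have "cmod (w x) * cmod (exp (\<i> * cdot \<zeta> x)) \<le> S * exp (real CARD('n) * B * R)"
        using S True norm_exp_cdot_le[OF B] by (intro mult_mono) auto
      then show ?thesis using True K by (auto simp: norm_mult indicator_def)
    next
      case False
      then have "w x = 0" using w outside_tsupp by (auto simp: C_infinity_on_def)
      then show ?thesis using S by (simp add: indicator_def)
    qed
  qed
  also have "\<dots> = S * exp (real CARD('n) * B * R) * measure lborel (cball (0 :: real ^ 'n) R)"
    by (simp add: mult_ac)
  finally show ?thesis .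
qed

text \<open>
  Paley-Wiener: in a complex neighbourhood of fixed width of the real space the transform decays faster than
  any power.  Derivatives of \<open>w\<close> in the direction of the largest coordinate of \<open>\<xi>\<close> suffice, since that coordinate
  controls the norm of \<open>\<xi>\<close>.
\<close>

lemma fourier_laplace_decay:
  fixes K :: "(real ^ 'n::finite) set"
  assumes K: "compact K" and "0 \<le> B"
  shows "\<exists>C\<ge>0. \<forall>w \<xi> \<zeta>. w \<in> C_infinity_on K \<longrightarrow> (\<forall>i. cmod (\<zeta> $ i - of_real (\<xi> $ i)) \<le> B) \<longrightarrow>
    (1 + norm \<xi>) ^ M * cmod (fourier_laplace w \<zeta>) \<le> C * seminorm K M w"
proof -
  obtain R where R: "K \<subseteq> cball 0 R" using compact_subset_cball_0[OF K] by blast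
  define V where "V = exp (real CARD('n) * B * R) * measure lborel (cball (0 :: real ^ 'n) R)"
  define n where "n = real CARD('n)"
  define A where "A = 1 + n * B + n"
  define C where "C = (2 * A) ^ M * (2 * V)"
  have "V \<ge> 0" "n \<ge> 0" "A \<ge> 1" using \<open>0 \<le> B\<close> by (auto simp: V_def n_def A_def)
  then have "C \<ge> 0" by (simp add: C_def)
  moreover have "(1 + norm \<xi>) ^ M * cmod (fourier_laplace w \<zeta>) \<le> C * seminorm K M w"
    if w: "w \<in> C_infinity_on K" and \<zeta>: "\<forall>i. cmod (\<zeta> $ i - of_real (\<xi> $ i)) \<le> B" for w \<xi> \<zeta>
  proof -
    have sw: "smooth w" using w by (simp add: C_infinity_on_def)
    define S where "S = seminorm K M w"
    have "0 \<le> S" unfolding S_def by (rule seminorm_nonneg[OF K sw])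
    have Im: "\<bar>Im (\<zeta> $ i)\<bar> \<le> B" for i
      using abs_Im_le_cmod[of "\<zeta> $ i - of_real (\<xi> $ i)"] \<zeta>[rule_format, of i] by simp
    have bd: "cmod (\<zeta> $ i) ^ k * cmod (fourier_laplace w \<zeta>) \<le> S * V" if "k \<le> M" for i k
    proof -
      have "foldr partial_deriv (replicate k i) w \<in> C_infinity_on K"
        by (rule C_infinity_on_foldr[OF w compact_imp_closed[OF K]])
      moreover have "cmod (foldr partial_deriv (replicate k i) w x) \<le> S" if "x \<in> K" for x
        unfolding mpd_replicate[OF sw] S_def
        using \<open>k \<le> M\<close> that by (intro seminorm_upper K sw) (auto simp: mi_order_def)
      ultimately have "cmod (fourier_laplace (foldr partial_deriv (replicate k i) w) \<zeta>) \<le> S * V"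
        using norm_fourier_laplace_le[OF _ K R _ \<open>0 \<le> S\<close> Im] by (auto simp: V_def mult_ac)
      then show ?thesis
        unfolding fourier_laplace_foldr[OF w K] by (simp add: norm_mult norm_power)
    qed
    \<comment> \<open>the largest coordinate of \<open>\<xi>\<close>, attained at \<open>i\<close>\<close>
    define t where "t = Max (range (\<lambda>i. \<bar>\<xi> $ i\<bar>))"
    have "t \<in> range (\<lambda>i. \<bar>\<xi> $ i\<bar>)" unfolding t_def by (intro Max_in) auto
    then obtain i where i: "t = \<bar>\<xi> $ i\<bar>" by blast
    have le_t: "\<bar>\<xi> $ j\<bar> \<le> t" for j unfolding t_def by (intro Max_ge) auto
    define s where "s = cmod (\<zeta> $ i)"
    have "s \<ge> 0" by (simp add: s_def)
    have "t \<le> B + s"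
      using norm_triangle_ineq4[of "\<zeta> $ i" "\<zeta> $ i - of_real (\<xi> $ i)"] \<zeta>[rule_format, of i]
      by (simp add: i s_def)
    have "norm \<xi> \<le> (\<Sum>j\<in>UNIV. \<bar>\<xi> $ j\<bar>)" by (rule norm_le_l1_cart)
    also have "\<dots> \<le> n * t" using sum_bounded_above[of UNIV "\<lambda>j. \<bar>\<xi> $ j\<bar>" t] le_t by (simp add: n_def)
    also have "\<dots> \<le> n * (B + s)" using \<open>t \<le> B + s\<close> \<open>n \<ge> 0\<close> by (rule mult_left_mono)
    finally have "norm \<xi> \<le> n * (B + s)" .
    moreover have "A * (1 + s) = 1 + n * (B + s) + (n + s + n * B * s)"
      by (simp add: A_def algebra_simps)
    moreover have "0 \<le> n + s + n * B * s"
      using \<open>n \<ge> 0\<close> \<open>s \<ge> 0\<close> \<open>0 \<le> B\<close> by simp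
    ultimately have "1 + norm \<xi> \<le> A * (1 + s)" by linarith
    also have "1 + s \<le> 2 * max 1 s" by simp
    finally have "1 + norm \<xi> \<le> 2 * A * max 1 s" using \<open>A \<ge> 1\<close> by simp
    then have "(1 + norm \<xi>) ^ M \<le> (2 * A * max 1 s) ^ M" by (intro power_mono) auto
    also have "\<dots> = (2 * A) ^ M * (max 1 s) ^ M" by (simp add: power_mult_distrib)
    also have "(max 1 s) ^ M \<le> 1 + s ^ M" using \<open>s \<ge> 0\<close> by (auto simp: max_def)
    finally have "(1 + norm \<xi>) ^ M \<le> (2 * A) ^ M * (1 + s ^ M)"
      using \<open>A \<ge> 1\<close> by simp
    then have "(1 + norm \<xi>) ^ M * cmod (fourier_laplace w \<zeta>)
        \<le> (2 * A) ^ M * (1 + s ^ M) * cmod (fourier_laplace w \<zeta>)" by (rule mult_right_mono) simp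
    also have "\<dots> = (2 * A) ^ M * (s ^ 0 * cmod (fourier_laplace w \<zeta>) + s ^ M * cmod (fourier_laplace w \<zeta>))"
      by (simp add: algebra_simps)
    also have "\<dots> \<le> (2 * A) ^ M * (S * V + S * V)"
      using bd[of 0 i] bd[of M i] \<open>A \<ge> 1\<close> by (intro mult_left_mono add_mono) (auto simp: s_def)
    also have "\<dots> = C * S" by (simp add: C_def)
    finally show ?thesis by (simp add: S_def)
  qed
  ultimately show ?thesis by blast
qed

lemma measurable_fourier_laplace [measurable]:
  assumes "w \<in> borel_measurable borel"
  shows "fourier_laplace w \<in> borel_measurable borel"
proof -
  note assms[measurable]
  have [measurable]: "(\<lambda>p. w (snd p) * exp (\<i> * cdot (fst p) (snd p))) \<in> borel_measurable (borel \<Otimes>\<^sub>M lborel)"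
    by measurable
  show ?thesis
    unfolding fourier_laplace_def
    by (rule lborel.borel_measurable_lebesgue_integral) (simp add: case_prod_beta)
qed

lemma fourier_laplace_add:
  assumes "v \<in> C_infinity_on K" "w \<in> C_infinity_on K" "compact K"
  shows "fourier_laplace (\<lambda>x. v x + w x) \<zeta> = fourier_laplace v \<zeta> + fourier_laplace w \<zeta>"
  using integrable_fourier[OF assms(1,3)] integrable_fourier[OF assms(2,3)]
  by (simp add: fourier_laplace_def distrib_right)

lemma fourier_laplace_cmult: "fourier_laplace (\<lambda>x. c * w x) \<zeta> = c * fourier_laplace w \<zeta>"
  by (simp add: fourier_laplace_def mult.assoc)

section \<open>Fourier inversion\<close>

text \<open>
  Lebesgue measure on a Euclidean space is the image of a finite product measure, hence integrals of products
  of functions of single coordinates factor.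
\<close>

lemma
  fixes g :: "'a::euclidean_space \<Rightarrow> real \<Rightarrow> 'b::{real_normed_field, banach, second_countable_topology}"
  assumes g: "\<And>b. b \<in> Basis \<Longrightarrow> integrable lborel (g b)"
  shows integrable_lborel_prod_Basis: "integrable lborel (\<lambda>x::'a. \<Prod>b\<in>Basis. g b (x \<bullet> b))"
    and integral_lborel_prod_Basis:
      "(LINT x|lborel. (\<Prod>b\<in>Basis. g b ((x::'a) \<bullet> b))) = (\<Prod>b\<in>Basis. LINT t|lborel. g b t)"
proof -
  interpret product_sigma_finite "\<lambda>b::'a. lborel :: real measure" ..
  have [measurable]: "g b \<in> borel_measurable borel" if "b \<in> Basis" for b
    using g[OF that] by (auto dest: borel_measurable_integrable)
  have lb: "(lborel :: 'a measure)
      = distr (\<Pi>\<^sub>M b\<in>Basis. lborel) borel (\<lambda>f. \<Sum>b\<in>Basis. f b *\<^sub>R b)"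
    unfolding lborel_def[where 'a = 'a] by (simp add: lborel_eq_real)
  have m [measurable]: "(\<lambda>f. \<Sum>b\<in>Basis. f b *\<^sub>R b) \<in> (\<Pi>\<^sub>M b\<in>Basis. lborel) \<rightarrow>\<^sub>M (borel :: 'a measure)"
    by measurable
  have m2 [measurable]: "(\<lambda>x::'a. \<Prod>b\<in>Basis. g b (x \<bullet> b)) \<in> borel_measurable borel"
    by measurable
  have eq: "(\<Prod>b\<in>Basis. g b ((\<Sum>c\<in>Basis. f c *\<^sub>R c) \<bullet> b)) = (\<Prod>b\<in>Basis. g b (f b))" for f :: "'a \<Rightarrow> real"
    by (intro prod.cong) auto
  show "integrable lborel (\<lambda>x::'a. \<Prod>b\<in>Basis. g b (x \<bullet> b))"
    unfolding lb by (subst integrable_distr_eq) (auto simp: eq intro!: product_integrable_prod g)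
  show "(LINT x|lborel. (\<Prod>b\<in>Basis. g b ((x::'a) \<bullet> b))) = (\<Prod>b\<in>Basis. LINT t|lborel. g b t)"
    by (subst lb, subst integral_distr) (auto simp: eq intro!: product_integral_prod g)
qed

lemma prod_Basis_vec: "(\<Prod>b\<in>(Basis :: (real ^ 'n::finite) set). h b) = (\<Prod>i\<in>UNIV. h (axis i 1))"
proof -
  have eq: "(Basis :: (real ^ 'n) set) = range (\<lambda>i. axis i 1)"
    by (auto simp: Basis_vec_def)
  have inj: "inj (\<lambda>i::'n. axis i (1::real) :: real^'n)" by (auto simp: inj_def axis_eq_axis)
  show ?thesis unfolding eq using prod.reindex[OF inj, of h] by (simp add: o_def)
qed

lemma
  fixes g :: "'n::finite \<Rightarrow> real \<Rightarrow> 'b::{real_normed_field, banach, second_countable_topology}"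
  assumes g: "\<And>i. integrable lborel (g i)"
  shows integrable_lborel_prod: "integrable lborel (\<lambda>x::real^'n. \<Prod>i\<in>UNIV. g i (x $ i))"
    and integral_lborel_prod:
      "(LINT x|lborel. (\<Prod>i\<in>UNIV. g i ((x::real^'n) $ i))) = (\<Prod>i\<in>UNIV. LINT t|lborel. g i t)"
proof -
  define G where "G b = g (SOME i. b = axis i (1::real))" for b :: "real ^ 'n"
  have G: "G (axis i 1) = g i" for i
    unfolding G_def by (rule arg_cong[where f = g], rule some_equality) (auto simp: axis_eq_axis)
  have "integrable lborel (G b)" if "b \<in> Basis" for b
    using that g G by (auto simp: Basis_vec_def)
  note * = integrable_lborel_prod_Basis[of G, OF this] integral_lborel_prod_Basis[of G, OF this]
  then show "integrable lborel (\<lambda>x::real^'n. \<Prod>i\<in>UNIV. g i (x $ i))"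
    and "(LINT x|lborel. (\<Prod>i\<in>UNIV. g i ((x::real^'n) $ i))) = (\<Prod>i\<in>UNIV. LINT t|lborel. g i t)"
    by (simp_all add: prod_Basis_vec G inner_axis)
qed

text \<open>
  The exponent \<open>2n\<close> is convenient rather than optimal: it allows domination by the product of the functions
  \<open>1 / (1 + x\<^sub>i\<^sup>2)\<close>.
\<close>

lemma integrable_inverse_power_norm:
  "integrable lborel (\<lambda>x::real^'n::finite. 1 / (1 + norm x) ^ (2 * CARD('n)))"
proof (rule Bochner_Integration.integrable_bound)
  have "integrable lborel (\<lambda>t::real. inverse (1 + t\<^sup>2))"
    using integrable_inverse_1_plus_square by (simp add: set_integrable_def einterval_def)
  then show "integrable lborel (\<lambda>x::real^'n. \<Prod>i\<in>UNIV. inverse (1 + (x $ i)\<^sup>2))"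
    by (intro integrable_lborel_prod)
  show "(\<lambda>x::real^'n. 1 / (1 + norm x) ^ (2 * CARD('n))) \<in> borel_measurable lborel" by measurable
  show "AE x::real^'n in lborel. norm (1 / (1 + norm x) ^ (2 * CARD('n)))
      \<le> norm (\<Prod>i\<in>UNIV. inverse (1 + (x $ i)\<^sup>2))"
  proof (rule AE_I2)
    fix x :: "real ^ 'n"
    have "(\<Prod>i\<in>(UNIV::'n set). inverse ((1 + norm x)\<^sup>2)) \<le> (\<Prod>i\<in>UNIV. inverse (1 + (x $ i)\<^sup>2))"
    proof (rule prod_mono, intro conjI)
      fix i
      have "1 + (x $ i)\<^sup>2 \<le> 1 + (norm x)\<^sup>2"
        using component_le_norm_cart[of x i] by (simp add: abs_le_square_iff[symmetric])
      also have "\<dots> \<le> (1 + norm x)\<^sup>2" by (simp add: power2_eq_square algebra_simps)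
      finally show "inverse ((1 + norm x)\<^sup>2) \<le> inverse (1 + (x $ i)\<^sup>2)"
        by (intro le_imp_inverse_le) (auto simp: add_pos_nonneg)
    qed auto
    moreover have "(\<Prod>i\<in>(UNIV::'n set). inverse ((1 + norm x)\<^sup>2)) = 1 / (1 + norm x) ^ (2 * CARD('n))"
      by (simp add: power_mult power_inverse divide_inverse)
    ultimately show "norm (1 / (1 + norm x) ^ (2 * CARD('n))) \<le> norm (\<Prod>i\<in>UNIV. inverse (1 + (x $ i)\<^sup>2))"
      by (simp add: abs_prod prod_nonneg)
  qed
qed

lemma integral_lborel_affine:
  fixes f :: "'a::euclidean_space \<Rightarrow> 'b::{banach, second_countable_topology}"
  assumes "f \<in> borel_measurable borel" "h > 0"
  shows "integral\<^sup>L lborel f = h ^ DIM('a) *\<^sub>R (LINT x|lborel. f (t + h *\<^sub>R x))"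
proof -
  note assms(1)[measurable]
  have "integral\<^sup>L lborel f = integral\<^sup>L (density (distr lborel borel (\<lambda>x. t + h *\<^sub>R x)) (\<lambda>_. \<bar>h\<bar>^DIM('a))) f"
    using lborel_affine[of h t] assms(2) by simp
  also have "\<dots> = (LINT x|distr lborel borel (\<lambda>x. t + h *\<^sub>R x). h ^ DIM('a) *\<^sub>R f x)"
    using assms(2) by (subst integral_density) auto
  also have "\<dots> = (LINT x|lborel. h ^ DIM('a) *\<^sub>R f (t + h *\<^sub>R x))"
    by (subst integral_distr) auto
  finally show ?thesis by simp
qed

lemma integrable_lborel_affine:
  fixes f :: "'a::euclidean_space \<Rightarrow> 'b::{banach, second_countable_topology}"
  assumes "integrable lborel f" "h > 0"
  shows "integrable lborel (\<lambda>x. f (t + h *\<^sub>R x))"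
proof -
  have [measurable]: "f \<in> borel_measurable borel"
    using borel_measurable_integrable[OF assms(1)] by simp
  have "integrable (density (distr lborel borel (\<lambda>x. t + h *\<^sub>R x)) (\<lambda>_. \<bar>h\<bar>^DIM('a))) f"
    using lborel_affine[of h t] assms by simp
  then have "integrable (distr lborel borel (\<lambda>x. t + h *\<^sub>R x)) (\<lambda>x. h ^ DIM('a) *\<^sub>R f x)"
    using assms(2) by (subst (asm) integrable_density) auto
  then have "integrable (distr lborel borel (\<lambda>x. t + h *\<^sub>R x)) f"
    using assms(2) integrable_scaleR_right[of "inverse (h ^ DIM('a))"] by fastforce
  then show ?thesis by (subst (asm) integrable_distr_eq) auto
qed

lemma integral_lborel_affine_eq:
  fixes f :: "'a::euclidean_space \<Rightarrow> complex"
  assumes "f \<in> borel_measurable borel" "h > 0"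
  shows "(LINT x|lborel. f (t + h *\<^sub>R x)) = integral\<^sup>L lborel f / of_real (h ^ DIM('a))"
  using integral_lborel_affine[OF assms, of t] assms(2) by (simp add: scaleR_conv_of_real)

lemma
  integrable_gaussian_1: "integrable lborel (\<lambda>t. exp (\<i> * of_real (u * t)) * of_real (exp (- t\<^sup>2 / 2)))" (is ?I)
  and fourier_gaussian_1: "(LINT t|lborel. exp (\<i> * of_real (u * t)) * of_real (exp (- t\<^sup>2 / 2)))
      = of_real (sqrt (2 * pi) * exp (- u\<^sup>2 / 2))" (is ?E)
proof -
  have eq: "std_normal_density t *\<^sub>R exp (\<i> * of_real (u * t))
      = of_real (1 / sqrt (2 * pi)) * (exp (\<i> * of_real (u * t)) * of_real (exp (- t\<^sup>2 / 2)))" for t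
    by (simp add: std_normal_density_def scaleR_conv_of_real)
  have "integrable lborel (\<lambda>t. std_normal_density t *\<^sub>R exp (\<i> * of_real (u * t)))"
    by (rule Bochner_Integration.integrable_bound[OF integrable_normal_density[of 1 0]]) auto
  then have "integrable lborel (\<lambda>t. of_real (sqrt (2 * pi)) * (std_normal_density t *\<^sub>R exp (\<i> * of_real (u * t))))"
    by (rule integrable_mult_right)
  moreover have "(\<lambda>t. of_real (sqrt (2 * pi)) * (std_normal_density t *\<^sub>R exp (\<i> * of_real (u * t))))
      = (\<lambda>t. exp (\<i> * of_real (u * t)) * of_real (exp (- t\<^sup>2 / 2)))"
    unfolding eq by (auto simp: fun_eq_iff)
  ultimately show ?I by simp
  have "complex_of_real (exp (- u\<^sup>2 / 2)) = char std_normal_distribution u"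
    by (simp add: char_std_normal_distribution)
  also have "\<dots> = (LINT t|lborel. std_normal_density t *\<^sub>R exp (\<i> * of_real (u * t)))"
    unfolding char_def by (subst integral_density) auto
  also have "\<dots> = of_real (1 / sqrt (2 * pi)) * (LINT t|lborel. exp (\<i> * of_real (u * t)) * of_real (exp (- t\<^sup>2 / 2)))"
    unfolding eq by simp
  finally show ?E by (simp add: field_simps)
qed

definition gaussian :: "real ^ 'n::finite \<Rightarrow> complex" where
  "gaussian x = of_real (exp (- (norm x)\<^sup>2 / 2))"

lemma gaussian_prod:
  fixes x u :: "real ^ 'n::finite"
  shows "exp (\<i> * of_real (u \<bullet> x)) * gaussian x
    = (\<Prod>i\<in>UNIV. exp (\<i> * of_real (u $ i * x $ i)) * of_real (exp (- (x $ i)\<^sup>2 / 2)))"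
proof -
  have "(norm x)\<^sup>2 = (\<Sum>i\<in>UNIV. (x $ i)\<^sup>2)"
    by (simp add: norm_vec_def L2_set_def sum_nonneg)
  then have "gaussian x = (\<Prod>i\<in>UNIV. of_real (exp (- (x $ i)\<^sup>2 / 2)))"
    unfolding gaussian_def
    by (simp add: exp_sum[symmetric] sum_negf sum_divide_distrib of_real_prod[symmetric] del: of_real_prod)
  moreover have "exp (\<i> * of_real (u \<bullet> x)) = (\<Prod>i\<in>UNIV. exp (\<i> * of_real (u $ i * x $ i)))"
    by (simp add: exp_sum[symmetric] inner_vec_def sum_distrib_left)
  ultimately show ?thesis by (simp add: prod.distrib)
qed

lemma
  fixes u :: "real ^ 'n::finite"
  shows integrable_gaussian: "integrable lborel (\<lambda>x. exp (\<i> * of_real (u \<bullet> x)) * gaussian x)"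
    and fourier_gaussian: "(LINT x|lborel. exp (\<i> * of_real (u \<bullet> x)) * gaussian x)
      = of_real (sqrt (2 * pi) ^ CARD('n)) * gaussian u"
proof -
  show "integrable lborel (\<lambda>x. exp (\<i> * of_real (u \<bullet> x)) * gaussian x)"
    unfolding gaussian_prod by (intro integrable_lborel_prod integrable_gaussian_1)
  have "(LINT x|lborel. exp (\<i> * of_real (u \<bullet> x)) * gaussian x)
      = (\<Prod>i\<in>UNIV. complex_of_real (sqrt (2 * pi) * exp (- (u $ i)\<^sup>2 / 2)))"
    unfolding gaussian_prod fourier_gaussian_1[symmetric] by (intro integral_lborel_prod integrable_gaussian_1)
  also have "\<dots> = of_real (sqrt (2 * pi) ^ CARD('n)) * (\<Prod>i\<in>UNIV. of_real (exp (- (u $ i)\<^sup>2 / 2)))"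
    by (simp add: prod.distrib)
  also have "(\<Prod>i\<in>UNIV. of_real (exp (- (u $ i)\<^sup>2 / 2))) = gaussian u"
    using gaussian_prod[of 0 u] by simp
  finally show "(LINT x|lborel. exp (\<i> * of_real (u \<bullet> x)) * gaussian x)
      = of_real (sqrt (2 * pi) ^ CARD('n)) * gaussian u" .
qed

lemma continuous_gaussian: "continuous_on S gaussian"
  unfolding gaussian_def by (intro continuous_intros) auto

lemma measurable_gaussian [measurable]: "gaussian \<in> borel_measurable borel"
  by (intro borel_measurable_continuous_onI continuous_gaussian)

lemma norm_gaussian_le: "cmod (gaussian x) \<le> 1"
  by (simp add: gaussian_def)

definition cvec :: "real ^ 'n::finite \<Rightarrow> complex ^ 'n" where
  "cvec \<xi> = (\<chi> i. of_real (\<xi> $ i))"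

lemma cvec_nth [simp]: "cvec \<xi> $ i = of_real (\<xi> $ i)"
  by (simp add: cvec_def)

lemma cdot_cvec: "cdot (cvec \<xi>) x = of_real (\<xi> \<bullet> x)"
  by (simp add: cdot_def inner_vec_def)

lemma continuous_cvec: "continuous_on S cvec"
  unfolding cvec_def by (intro continuous_intros)

lemma measurable_cvec [measurable]: "cvec \<in> borel_measurable borel"
  by (intro borel_measurable_continuous_onI continuous_cvec)

lemma integrable_fourier_laplace_cvec:
  fixes w :: "'n::finite cfun"
  assumes w: "w \<in> C_infinity_on K" and K: "compact K"
  shows "integrable lborel (\<lambda>\<xi>. fourier_laplace w (cvec \<xi>))"
proof -
  let ?N = "2 * CARD('n)"
  have [measurable]: "w \<in> borel_measurable borel"
    using w by (intro borel_measurable_continuous_onI smooth_continuous_on) (simp add: C_infinity_on_def)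
  obtain C where C: "\<And>\<xi> \<zeta>. (\<forall>i. cmod (\<zeta> $ i - of_real (\<xi> $ i)) \<le> 0) \<Longrightarrow>
      (1 + norm \<xi>) ^ ?N * cmod (fourier_laplace w \<zeta>) \<le> C * seminorm K ?N w"
    using fourier_laplace_decay[OF K order_refl, of ?N] w by blast
  show ?thesis
  proof (rule Bochner_Integration.integrable_bound)
    show "integrable lborel (\<lambda>\<xi>::real^'n. C * seminorm K ?N w * (1 / (1 + norm \<xi>) ^ ?N))"
      by (intro integrable_mult_right integrable_inverse_power_norm)
    show "(\<lambda>\<xi>. fourier_laplace w (cvec \<xi>)) \<in> borel_measurable lborel" by measurable
    show "AE \<xi> in lborel. norm (fourier_laplace w (cvec \<xi>)) \<le> norm (C * seminorm K ?N w * (1 / (1 + norm \<xi>) ^ ?N))"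
    proof (rule AE_I2)
      fix \<xi> :: "real ^ 'n"
      have "(1 + norm \<xi>) ^ ?N * cmod (fourier_laplace w (cvec \<xi>)) \<le> C * seminorm K ?N w"
        by (rule C) simp
      then have "cmod (fourier_laplace w (cvec \<xi>)) \<le> C * seminorm K ?N w * (1 / (1 + norm \<xi>) ^ ?N)"
        by (simp add: pos_le_divide_eq mult.commute add_pos_nonneg)
      then show "norm (fourier_laplace w (cvec \<xi>)) \<le> norm (C * seminorm K ?N w * (1 / (1 + norm \<xi>) ^ ?N))"
        by (smt (verit) real_norm_def)
    qed
  qed
qed

text \<open>
  Fubini's theorem for the inversion integral with a Gaussian factor that makes it absolutely
  convergent in both variables.  The scaled Gaussian transforms to a Gaussian of width \<open>h\<close> around \<open>x\<close>, and a
  change of variables removes the width.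
\<close>

lemma fourier_regularised:
  fixes w :: "'n::finite cfun"
  assumes w: "w \<in> C_infinity_on K" and K: "compact K" and h: "h > 0"
  shows "(LINT \<xi>|lborel. exp (- \<i> * of_real (\<xi> \<bullet> x)) * gaussian (h *\<^sub>R \<xi>) * fourier_laplace w (cvec \<xi>))
    = of_real (sqrt (2 * pi) ^ CARD('n)) * (LINT y|lborel. w (x + h *\<^sub>R y) * gaussian y)"
proof -
  let ?k = "complex_of_real (sqrt (2 * pi) ^ CARD('n))"
  let ?hn = "complex_of_real (h ^ CARD('n))"
  have [measurable]: "w \<in> borel_measurable borel"
    using w by (intro borel_measurable_continuous_onI smooth_continuous_on) (simp add: C_infinity_on_def)
  have iw: "integrable lborel w"
    using integrable_fourier[OF w K, of 0] by (simp add: cdot_def)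
  define G where "G u = (LINT \<xi>|lborel. exp (\<i> * of_real (u \<bullet> \<xi>)) * gaussian (h *\<^sub>R \<xi>))" for u :: "real^'n"
  have G: "G u = ?k * gaussian (u /\<^sub>R h) / ?hn" for u
  proof -
    have "G u = (LINT \<xi>|lborel. exp (\<i> * of_real ((u /\<^sub>R h) \<bullet> (0 + h *\<^sub>R \<xi>))) * gaussian (0 + h *\<^sub>R \<xi>))"
    proof -
      have "(u /\<^sub>R h) \<bullet> (0 + h *\<^sub>R \<xi>) = u \<bullet> \<xi>" for \<xi> using h by simp
      then show ?thesis unfolding G_def by (simp only: add_0)
    qed
    also have "\<dots> = (LINT \<xi>|lborel. exp (\<i> * of_real ((u /\<^sub>R h) \<bullet> \<xi>)) * gaussian \<xi>) / ?hn"
      using integral_lborel_affine_eq[OF _ h, of "\<lambda>\<xi>. exp (\<i> * of_real ((u /\<^sub>R h) \<bullet> \<xi>)) * gaussian \<xi>" 0]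
      by (simp only: DIM_cart DIM_real mult_1_right) (simp add: borel_measurable_times)
    finally show ?thesis by (simp only: fourier_gaussian)
  qed
  have ig: "integrable lborel (\<lambda>\<xi>::real^'n. gaussian (h *\<^sub>R \<xi>))"
  proof -
    have "integrable lborel (gaussian :: real^'n \<Rightarrow> complex)"
      using integrable_gaussian[of 0] by simp
    from integrable_lborel_affine[OF this h, of 0] show ?thesis by simp
  qed
  define F where "F p = w (snd p) * exp (\<i> * of_real ((snd p - x) \<bullet> fst p)) * gaussian (h *\<^sub>R fst p)" for p :: "(real^'n) \<times> (real^'n)"
  have mF [measurable]: "F \<in> borel_measurable (lborel \<Otimes>\<^sub>M lborel)" unfolding F_def by measurable
  have nF: "norm (F (\<xi>, y)) = norm (w y) * norm (gaussian (h *\<^sub>R \<xi>))" for \<xi> y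
    by (simp add: F_def norm_mult)
  have iF: "integrable (lborel \<Otimes>\<^sub>M lborel) F"
  proof (rule lborel_pair.Fubini_integrable)
    show "integrable lborel (\<lambda>\<xi>. LINT y|lborel. norm (F (\<xi>, y)))"
      unfolding nF using iw ig by simp
    show "AE \<xi> in lborel. integrable lborel (\<lambda>y. F (\<xi>, y))"
    proof (rule AE_I2)
      fix \<xi>
      show "integrable lborel (\<lambda>y. F (\<xi>, y))"
      proof (rule Bochner_Integration.integrable_bound)
        show "integrable lborel (\<lambda>y. norm (w y) * norm (gaussian (h *\<^sub>R \<xi>)))"
          using iw by simp
      qed (use nF in \<open>auto simp: F_def norm_mult\<close>)
    qed
  qed (rule mF)
  have "(LINT \<xi>|lborel. exp (- \<i> * of_real (\<xi> \<bullet> x)) * gaussian (h *\<^sub>R \<xi>) * fourier_laplace w (cvec \<xi>))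
      = (LINT \<xi>|lborel. LINT y|lborel. F (\<xi>, y))"
  proof (rule Bochner_Integration.integral_cong[OF refl])
    fix \<xi> :: "real^'n"
    have "(LINT y|lborel. F (\<xi>, y))
        = (LINT y|lborel. exp (- \<i> * of_real (\<xi> \<bullet> x)) * gaussian (h *\<^sub>R \<xi>) * (w y * exp (\<i> * cdot (cvec \<xi>) y)))"
      by (intro Bochner_Integration.integral_cong)
        (auto simp: F_def cdot_cvec inner_commute algebra_simps mult_exp_exp)
    then show "exp (- \<i> * of_real (\<xi> \<bullet> x)) * gaussian (h *\<^sub>R \<xi>) * fourier_laplace w (cvec \<xi>) = (LINT y|lborel. F (\<xi>, y))"
      by (simp add: fourier_laplace_def)
  qed
  also have "\<dots> = (LINT y|lborel. LINT \<xi>|lborel. F (\<xi>, y))"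
    using lborel_pair.Fubini_integral[of "\<lambda>\<xi> y. F (\<xi>, y)"] iF by simp
  also have "\<dots> = (LINT y|lborel. w y * G (y - x))"
    by (simp add: F_def G_def mult.assoc)
  also have "\<dots> = ?k / ?hn * (LINT y|lborel. w y * gaussian ((y - x) /\<^sub>R h))"
  proof -
    have "w y * G (y - x) = ?k / ?hn * (w y * gaussian ((y - x) /\<^sub>R h))" for y
      unfolding G by simp
    then show ?thesis by (simp only: integral_mult_right_zero)
  qed
  also have "(LINT y|lborel. w y * gaussian ((y - x) /\<^sub>R h)) = ?hn * (LINT y|lborel. w (x + h *\<^sub>R y) * gaussian y)"
    using integral_lborel_affine_eq[OF _ h, of "\<lambda>y. w y * gaussian ((y - x) /\<^sub>R h)" x] h by simp
  finally show ?thesis using h by simp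
qed

text \<open>
  The limit \<open>h \<rightarrow> 0\<close> of the preceding identity, by dominated convergence on both sides.
\<close>

theorem fourier_inversion:
  fixes w :: "'n::finite cfun"
  assumes w: "w \<in> C_infinity_on K" and K: "compact K"
  shows "(LINT \<xi>|lborel. exp (- \<i> * of_real (\<xi> \<bullet> x)) * fourier_laplace w (cvec \<xi>))
    = of_real ((2 * pi) ^ CARD('n)) * w x"
proof -
  let ?k = "complex_of_real (sqrt (2 * pi) ^ CARD('n))"
  have sw: "smooth w" using w by (simp add: C_infinity_on_def)
  have [measurable]: "w \<in> borel_measurable borel"
    by (intro borel_measurable_continuous_onI smooth_continuous_on sw)
  define h where "h k = 1 / real (Suc k)" for k
  have h: "h k > 0" for k by (simp add: h_def)
  have h0: "h \<longlonglongrightarrow> 0" unfolding h_def by (rule lim_inverse_n'[THEN LIMSEQ_Suc])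
  obtain S where S: "\<And>y. cmod (w y) \<le> S"
  proof -
    have "compact (w ` K)" by (intro compact_continuous_image smooth_continuous_on sw K)
    then obtain S where "\<And>y. y \<in> K \<Longrightarrow> cmod (w y) \<le> S" by (meson bounded_iff compact_imp_bounded imageI)
    moreover have "cmod (w y) \<le> 0" if "y \<notin> K" for y
      using w that outside_tsupp by (auto simp: C_infinity_on_def)
    ultimately have "cmod (w y) \<le> max S 0" for y by (meson max.coboundedI1 max.coboundedI2)
    then show ?thesis by (rule that)
  qed
  have 1: "(\<lambda>k. LINT \<xi>|lborel. exp (- \<i> * of_real (\<xi> \<bullet> x)) * gaussian (h k *\<^sub>R \<xi>) * fourier_laplace w (cvec \<xi>))
      \<longlonglongrightarrow> (LINT \<xi>|lborel. exp (- \<i> * of_real (\<xi> \<bullet> x)) * fourier_laplace w (cvec \<xi>))"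
  proof (rule integral_dominated_convergence)
    show "integrable lborel (\<lambda>\<xi>. norm (fourier_laplace w (cvec \<xi>)))"
      by (intro integrable_norm integrable_fourier_laplace_cvec[OF w K])
    show "AE \<xi> in lborel. (\<lambda>k. exp (- \<i> * of_real (\<xi> \<bullet> x)) * gaussian (h k *\<^sub>R \<xi>) * fourier_laplace w (cvec \<xi>))
        \<longlonglongrightarrow> exp (- \<i> * of_real (\<xi> \<bullet> x)) * fourier_laplace w (cvec \<xi>)"
    proof (rule AE_I2)
      fix \<xi> :: "real^'n"
      have "(\<lambda>k. gaussian (h k *\<^sub>R \<xi>)) \<longlonglongrightarrow> gaussian (0 *\<^sub>R \<xi>)"
        using continuous_gaussian[of UNIV]
        by (intro continuous_on_tendsto_compose[of UNIV gaussian] tendsto_scaleR h0 tendsto_const) auto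
      then have "(\<lambda>k. exp (- \<i> * of_real (\<xi> \<bullet> x)) * gaussian (h k *\<^sub>R \<xi>) * fourier_laplace w (cvec \<xi>))
          \<longlonglongrightarrow> exp (- \<i> * of_real (\<xi> \<bullet> x)) * gaussian (0 *\<^sub>R \<xi>) * fourier_laplace w (cvec \<xi>)"
        by (intro tendsto_mult tendsto_const)
      then show "(\<lambda>k. exp (- \<i> * of_real (\<xi> \<bullet> x)) * gaussian (h k *\<^sub>R \<xi>) * fourier_laplace w (cvec \<xi>))
          \<longlonglongrightarrow> exp (- \<i> * of_real (\<xi> \<bullet> x)) * fourier_laplace w (cvec \<xi>)"
        by (simp add: gaussian_def)
    qed
    show "AE \<xi> in lborel. norm (exp (- \<i> * of_real (\<xi> \<bullet> x)) * gaussian (h k *\<^sub>R \<xi>) * fourier_laplace w (cvec \<xi>))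
        \<le> norm (fourier_laplace w (cvec \<xi>))" for k
    proof (rule AE_I2)
      fix \<xi> :: "real^'n"
      have "cmod (gaussian (h k *\<^sub>R \<xi>)) * cmod (fourier_laplace w (cvec \<xi>)) \<le> 1 * cmod (fourier_laplace w (cvec \<xi>))"
        by (intro mult_right_mono norm_gaussian_le) simp
      then show "norm (exp (- \<i> * of_real (\<xi> \<bullet> x)) * gaussian (h k *\<^sub>R \<xi>) * fourier_laplace w (cvec \<xi>))
        \<le> norm (fourier_laplace w (cvec \<xi>))" by (simp add: norm_mult)
    qed
  qed measurable
  have 2: "(\<lambda>k. LINT y|lborel. w (x + h k *\<^sub>R y) * gaussian y) \<longlonglongrightarrow> (LINT y|lborel. w x * gaussian (y :: real^'n))"
  proof (rule integral_dominated_convergence)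
    show "integrable lborel (\<lambda>y::real^'n. S * norm (gaussian y))"
      using integrable_gaussian[of "0 :: real^'n"] by (intro integrable_mult_right integrable_norm) simp
    show "AE y in lborel. (\<lambda>k. w (x + h k *\<^sub>R y) * gaussian y) \<longlonglongrightarrow> w x * gaussian y"
    proof (rule AE_I2)
      fix y :: "real^'n"
      have "(\<lambda>k. w (x + h k *\<^sub>R y)) \<longlonglongrightarrow> w (x + 0 *\<^sub>R y)"
        by (intro continuous_on_tendsto_compose[OF smooth_continuous_on[OF sw, of UNIV]]
            tendsto_intros h0) auto
      then show "(\<lambda>k. w (x + h k *\<^sub>R y) * gaussian y) \<longlonglongrightarrow> w x * gaussian y"
        by (intro tendsto_mult tendsto_const) simp
    qed
    show "AE y in lborel. norm (w (x + h k *\<^sub>R y) * gaussian y) \<le> S * norm (gaussian y)" for k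
      using S by (intro AE_I2) (simp add: norm_mult mult_right_mono)
  qed measurable
  have "(\<lambda>k. ?k * (LINT y|lborel. w (x + h k *\<^sub>R y) * gaussian y)) \<longlonglongrightarrow> ?k * (LINT y|lborel. w x * gaussian (y :: real^'n))"
    by (intro tendsto_mult tendsto_const 2)
  then have "(LINT \<xi>|lborel. exp (- \<i> * of_real (\<xi> \<bullet> x)) * fourier_laplace w (cvec \<xi>))
      = ?k * (LINT y|lborel. w x * gaussian (y :: real^'n))"
    using 1 unfolding fourier_regularised[OF w K h] by (rule LIMSEQ_unique[rotated])
  also have "(LINT y|lborel. w x * gaussian (y :: real^'n)) = w x * ?k"
    using fourier_gaussian[of "0 :: real^'n"] by (simp add: gaussian_def)
  also have "?k * (w x * ?k) = of_real ((sqrt (2 * pi) * sqrt (2 * pi)) ^ CARD('n)) * w x"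
    by (simp only: power_mult_distrib of_real_mult mult_ac)
  also have "sqrt (2 * pi) * sqrt (2 * pi) = 2 * pi" by simp
  finally show ?thesis .
qed

section \<open>Mean values of exponentials over circles\<close>

text \<open>
  The mean value property at the centre of a circle, for exponential functions.  By Fubini's
  theorem this is all that is needed for transforms of test functions.
\<close>

lemma circle_mean_exp:
  assumes "r > 0"
  shows "(LINT t|lborel. indicator {0..1} t *\<^sub>R exp (b * (of_real r * exp (2 * of_real pi * \<i> * of_real t)))) = 1"
proof -
  let ?g = "\<lambda>t. exp (b * (of_real r * exp (2 * of_real pi * \<i> * of_real t)))"
  have hol: "(\<lambda>z. exp (b * z)) holomorphic_on cball 0 r" by (intro holomorphic_intros)
  have "((\<lambda>u. exp (b * u) / (u - 0)) has_contour_integral (2 * of_real pi * \<i> * exp (b * 0))) (circlepath 0 r)"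
    by (rule Cauchy_integral_circlepath_simple[OF hol]) (use assms in simp)
  then have "((\<lambda>t. exp (b * circlepath 0 r t) / circlepath 0 r t * vector_derivative (circlepath 0 r) (at t within {0..1}))
      has_integral (2 * of_real pi * \<i>)) {0..1}"
    by (simp add: has_contour_integral_def)
  then have "((\<lambda>t. 2 * of_real pi * \<i> * ?g t) has_integral (2 * of_real pi * \<i>)) {0..1}"
    by (rule has_integral_eq[rotated])
      (use assms in \<open>simp add: vector_derivative_circlepath01, simp add: circlepath mult_ac\<close>)
  then have "((\<lambda>t. inverse (2 * of_real pi * \<i>) * (2 * of_real pi * \<i> * ?g t))
      has_integral (inverse (2 * of_real pi * \<i>) * (2 * of_real pi * \<i>))) {0..1}"
    by (rule has_integral_mult_right)
  moreover have "(\<lambda>t. inverse (2 * of_real pi * \<i>) * (2 * of_real pi * \<i> * ?g t)) = ?g"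
    by (simp add: fun_eq_iff field_simps)
  moreover have "inverse (2 * of_real pi * \<i>) * (2 * of_real pi * \<i>) = (1 :: complex)"
    by (rule left_inverse) simp
  ultimately have hk: "(?g has_integral 1) {0..1}" by (simp only:)
  have "set_integrable lborel {0..1} ?g"
    by (intro borel_integrable_atLeastAtMost' continuous_intros)
  from set_borel_integral_eq_integral(2)[OF this] integral_unique[OF hk]
  show ?thesis by (simp add: set_lebesgue_integral_def)
qed

section \<open>The solution operator\<close>

lemma integrable_lborel_pair_mult:
  fixes f :: "'a::euclidean_space \<Rightarrow> real" and g :: "'b::euclidean_space \<Rightarrow> real"
  assumes f: "integrable lborel f" and g: "integrable lborel g"
  shows "integrable (lborel \<Otimes>\<^sub>M lborel) (\<lambda>p. f (fst p) * g (snd p))"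
proof (rule lborel_pair.Fubini_integrable)
  have [measurable]: "f \<in> borel_measurable borel" "g \<in> borel_measurable borel"
    using f g by (auto dest: borel_measurable_integrable)
  show "(\<lambda>p. f (fst p) * g (snd p)) \<in> borel_measurable (lborel \<Otimes>\<^sub>M lborel)" by measurable
  show "integrable lborel (\<lambda>x. LINT y|lborel. norm (f (fst (x, y)) * g (snd (x, y))))"
    using f g by (simp add: abs_mult)
  show "AE x in lborel. integrable lborel (\<lambda>y. f (fst (x, y)) * g (snd (x, y)))"
    using g by simp
qed

text \<open>
The \<open>l\<^sup>1\<close>-norm, which bounds the pairing with a vector of \<open>\<real>\<^sup>n\<close> without constants.
\<close>

definition size_sum :: "complex ^ 'n::finite \<Rightarrow> real" where
  "size_sum \<zeta> = (\<Sum>i\<in>UNIV. cmod (\<zeta> $ i))"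

lemma size_sum_nonneg: "0 \<le> size_sum \<zeta>"
  by (simp add: size_sum_def sum_nonneg)

lemma norm_cdot_le: "cmod (cdot \<zeta> h) \<le> size_sum \<zeta> * norm h"
proof -
  have "cmod (cdot \<zeta> h) \<le> (\<Sum>i\<in>UNIV. cmod (\<zeta> $ i) * \<bar>h $ i\<bar>)"
    unfolding cdot_def by (rule order_trans[OF norm_sum]) (simp add: norm_mult)
  also have "\<dots> \<le> (\<Sum>i\<in>UNIV. cmod (\<zeta> $ i) * norm h)"
    by (intro sum_mono mult_left_mono component_le_norm_cart) simp
  finally show ?thesis by (simp add: size_sum_def sum_distrib_right)
qed

lemma exp_taylor_1: "cmod (exp u - 1 - u) \<le> exp \<bar>Re u\<bar> * (cmod u)\<^sup>2"
  using Taylor_exp[of u 1] by (simp add: power2_eq_square diff_diff_eq)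

lemma has_derivative_of_quadratic_remainder:
  fixes f :: "'a::real_normed_vector \<Rightarrow> 'b::real_normed_vector"
  assumes "bounded_linear D" "0 \<le> C"
    and q: "\<And>h. norm h \<le> 1 \<Longrightarrow> norm (f (x + h) - f x - D h) \<le> C * (norm h)\<^sup>2"
  shows "(f has_derivative D) (at x)"
  unfolding has_derivative_at_alt
proof (intro conjI allI impI)
  fix e :: real assume "0 < e"
  define d where "d = min 1 (e / (C + 1))"
  have "d > 0" using \<open>0 < e\<close> \<open>0 \<le> C\<close> by (simp add: d_def)
  moreover have "norm (f y - f x - D (y - x)) \<le> e * norm (y - x)" if "norm (y - x) < d" for y
  proof -
    have "norm (f (x + (y - x)) - f x - D (y - x)) \<le> C * (norm (y - x))\<^sup>2"
      using that by (intro q) (simp add: d_def)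
    also have "\<dots> = (C * norm (y - x)) * norm (y - x)" by (simp add: power2_eq_square)
    also have "\<dots> \<le> e * norm (y - x)"
    proof (rule mult_right_mono)
      have "C * norm (y - x) \<le> (C + 1) * norm (y - x)" by (simp add: algebra_simps)
      also have "\<dots> \<le> (C + 1) * (e / (C + 1))"
        using that \<open>0 \<le> C\<close> by (intro mult_left_mono) (auto simp: d_def)
      also have "\<dots> = e" using \<open>0 \<le> C\<close> by simp
      finally show "C * norm (y - x) \<le> e" .
    qed simp
    finally show ?thesis by simp
  qed
  ultimately show "\<exists>d>0. \<forall>y. norm (y - x) < d \<longrightarrow> norm (f y - f x - D (y - x)) \<le> e * norm (y - x)"
    by blast
qed (rule assms(1))

text \<open>
  Differentiation under the integral sign.  The Taylor remainder of the exponential is quadratic in the increment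
  \<open>h\<close> with a constant that is integrable, because the imaginary parts of \<open>Z\<close> are bounded and \<open>g\<close>
  absorbs two powers of \<open>Z\<close>.
\<close>

lemma has_derivative_exponential_integral:
  fixes Z :: "'a \<Rightarrow> complex ^ 'n::finite" and g :: "'a \<Rightarrow> complex" and x :: "real ^ 'n"
  assumes [measurable]: "Z \<in> borel_measurable M" "g \<in> borel_measurable M"
    and Im: "\<And>p i. \<bar>Im (Z p $ i)\<bar> \<le> B"
    and H: "integrable M H" "\<And>p. cmod (g p) \<le> H p" "\<And>p. (size_sum (Z p))\<^sup>2 * cmod (g p) \<le> H p"
  shows "((\<lambda>x. LINT p|M. exp (- \<i> * cdot (Z p) x) * g p) has_derivative
    (\<lambda>h. LINT p|M. exp (- \<i> * cdot (Z p) x) * (- \<i> * cdot (Z p) h) * g p)) (at x)"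
proof (rule has_derivative_of_quadratic_remainder)
  define n where "n = real CARD('n)"
  have "0 \<le> B" using Im[of undefined undefined] by linarith
  have ex: "cmod (exp (- \<i> * cdot (Z p) x)) \<le> exp (n * B * norm x)" for p x
    using norm_exp_cdot_le[OF Im, of "- x" "norm x" p] by (simp add: cdot_minus_right n_def)
  define E where "E = exp (n * B * norm x)"
  have "0 < E" by (simp add: E_def)
  have Hnn: "0 \<le> H p" for p using H(2)[of p] norm_ge_zero[of "g p"] by linarith
  have H1: "size_sum (Z p) * cmod (g p) \<le> 2 * H p" for p
  proof -
    have "0 \<le> (size_sum (Z p) - 1)\<^sup>2" by simp
    then have "size_sum (Z p) \<le> 1 + (size_sum (Z p))\<^sup>2"
      using size_sum_nonneg[of "Z p"] unfolding power2_diff by simp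
    then have "size_sum (Z p) * cmod (g p) \<le> (1 + (size_sum (Z p))\<^sup>2) * cmod (g p)"
      by (rule mult_right_mono) simp
    also have "\<dots> \<le> 2 * H p" using H(2,3)[of p] by (simp add: algebra_simps)
    finally show ?thesis .
  qed
  have i0: "integrable M (\<lambda>p. exp (- \<i> * cdot (Z p) x) * g p)" for x
  proof (rule Bochner_Integration.integrable_bound)
    show "integrable M (\<lambda>p. exp (n * B * norm x) * H p)" using H(1) by simp
    show "AE p in M. norm (exp (- \<i> * cdot (Z p) x) * g p) \<le> norm (exp (n * B * norm x) * H p)"
      using mult_mono[OF ex H(2)] Hnn by (intro AE_I2) (simp add: norm_mult)
  qed measurable
  have i1: "integrable M (\<lambda>p. exp (- \<i> * cdot (Z p) x) * (- \<i> * cdot (Z p) h) * g p)" for h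
  proof (rule Bochner_Integration.integrable_bound)
    show "integrable M (\<lambda>p. E * (norm h * (2 * H p)))" using H(1) by simp
    show "AE p in M. norm (exp (- \<i> * cdot (Z p) x) * (- \<i> * cdot (Z p) h) * g p) \<le> norm (E * (norm h * (2 * H p)))"
    proof (rule AE_I2)
      fix p
      have "cmod (cdot (Z p) h) * cmod (g p) \<le> size_sum (Z p) * norm h * cmod (g p)"
        by (intro mult_right_mono norm_cdot_le) simp
      also have "\<dots> \<le> norm h * (2 * H p)"
        using mult_left_mono[OF H1[of p], of "norm h"] by (simp add: mult_ac)
      finally have "cmod (exp (- \<i> * cdot (Z p) x)) * (cmod (cdot (Z p) h) * cmod (g p)) \<le> E * (norm h * (2 * H p))"
        by (rule mult_mono[OF ex[of p x, folded E_def]]) (use \<open>0 < E\<close> in auto)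
      then show "norm (exp (- \<i> * cdot (Z p) x) * (- \<i> * cdot (Z p) h) * g p) \<le> norm (E * (norm h * (2 * H p)))"
        using Hnn[of p] \<open>0 < E\<close> by (simp add: norm_mult abs_mult mult.assoc)
    qed
  qed measurable
  define D where "D h = (LINT p|M. exp (- \<i> * cdot (Z p) x) * (- \<i> * cdot (Z p) h) * g p)" for h
  have "linear D"
  proof (rule linearI)
    show "D (h + k) = D h + D k" for h k
      unfolding D_def using i1[of h] i1[of k] by (simp add: cdot_add_right ring_distribs flip: Bochner_Integration.integral_add)
    show "D (r *\<^sub>R h) = r *\<^sub>R D h" for r h
    proof -
      have "exp (- \<i> * cdot (Z p) x) * (- \<i> * cdot (Z p) (r *\<^sub>R h)) * g p
          = of_real r * (exp (- \<i> * cdot (Z p) x) * (- \<i> * cdot (Z p) h) * g p)" for p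
        by (simp add: cdot_scaleR_right)
      then show ?thesis unfolding D_def by (simp only: integral_mult_right_zero scaleR_conv_of_real)
    qed
  qed
  then show "bounded_linear (\<lambda>h. LINT p|M. exp (- \<i> * cdot (Z p) x) * (- \<i> * cdot (Z p) h) * g p)"
    unfolding D_def by (rule linear_conv_bounded_linear[THEN iffD1])
  define C where "C = E * exp (n * B) * integral\<^sup>L M H"
  show "0 \<le> C" unfolding C_def using \<open>0 < E\<close> Hnn by (intro mult_nonneg_nonneg integral_nonneg) auto
  fix h :: "real ^ 'n" assume h: "norm h \<le> 1"
  let ?R = "\<lambda>p. exp (- \<i> * cdot (Z p) (x + h)) * g p - exp (- \<i> * cdot (Z p) x) * g p
      - exp (- \<i> * cdot (Z p) x) * (- \<i> * cdot (Z p) h) * g p"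
  have "norm (LINT p|M. ?R p) \<le> (LINT p|M. E * exp (n * B) * (norm h)\<^sup>2 * H p)"
  proof (rule norm_integral_le)
    show "integrable M ?R" by (intro Bochner_Integration.integrable_diff i0 i1)
    show "integrable M (\<lambda>p. E * exp (n * B) * (norm h)\<^sup>2 * H p)" using H(1) by simp
    fix p
    define u where "u = - \<i> * cdot (Z p) h"
    have R: "?R p = exp (- \<i> * cdot (Z p) x) * (exp u - 1 - u) * g p"
    proof -
      have "exp (- \<i> * cdot (Z p) (x + h)) = exp (- \<i> * cdot (Z p) x) * exp u"
        by (simp add: u_def cdot_add_right ring_distribs mult_exp_exp)
      then show ?thesis by (simp add: u_def algebra_simps)
    qed
    have "cmod u \<le> size_sum (Z p) * norm h" using norm_cdot_le[of "Z p" h] by (simp add: u_def norm_mult)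
    then have u2: "(cmod u)\<^sup>2 \<le> (size_sum (Z p))\<^sup>2 * (norm h)\<^sup>2"
      by (metis norm_ge_zero power_mono power_mult_distrib)
    have "\<bar>Re u\<bar> \<le> n * B"
    proof -
      have nb: "n * B * norm h \<le> n * B"
        using h \<open>0 \<le> B\<close> by (intro mult_left_le) (auto simp: n_def)
      have "exp (Re u) \<le> exp (n * B * norm h)" "exp (- Re u) \<le> exp (n * B * norm h)"
        using ex[of p h] norm_exp_cdot_le[OF Im, of h "norm h" p] by (auto simp: u_def n_def)
      then show ?thesis using nb by (auto simp: abs_le_iff)
    qed
    then have "cmod (exp u - 1 - u) \<le> exp (n * B) * ((size_sum (Z p))\<^sup>2 * (norm h)\<^sup>2)"
      using u2 by (intro order_trans[OF exp_taylor_1] mult_mono) auto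
    then have "cmod (exp (- \<i> * cdot (Z p) x)) * cmod (exp u - 1 - u) * cmod (g p)
        \<le> E * (exp (n * B) * ((size_sum (Z p))\<^sup>2 * (norm h)\<^sup>2)) * cmod (g p)"
      using ex[of p x] \<open>0 < E\<close> unfolding E_def by (intro mult_right_mono mult_mono) auto
    also have "\<dots> = E * exp (n * B) * (norm h)\<^sup>2 * ((size_sum (Z p))\<^sup>2 * cmod (g p))" by simp
    also have "\<dots> \<le> E * exp (n * B) * (norm h)\<^sup>2 * H p"
      using \<open>0 < E\<close> by (intro mult_left_mono H) auto
    finally show "norm (?R p) \<le> E * exp (n * B) * (norm h)\<^sup>2 * H p"
      unfolding R by (simp add: norm_mult)
  qed
  also have "\<dots> = C * (norm h)\<^sup>2" by (simp add: C_def)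
  finally have "norm (LINT p|M. ?R p) \<le> C * (norm h)\<^sup>2" .
  moreover have "(LINT p|M. ?R p) = (LINT p|M. exp (- \<i> * cdot (Z p) (x + h)) * g p)
      - (LINT p|M. exp (- \<i> * cdot (Z p) x) * g p)
      - (LINT p|M. exp (- \<i> * cdot (Z p) x) * (- \<i> * cdot (Z p) h) * g p)"
    using Bochner_Integration.integral_diff[OF Bochner_Integration.integrable_diff[OF i0[of "x + h"] i0[of x]] i1[of h]]
      Bochner_Integration.integral_diff[OF i0[of "x + h"] i0[of x]] by (simp only:)
  ultimately show "norm ((LINT p|M. exp (- \<i> * cdot (Z p) (x + h)) * g p)
      - (LINT p|M. exp (- \<i> * cdot (Z p) x) * g p)
      - (LINT p|M. exp (- \<i> * cdot (Z p) x) * (- \<i> * cdot (Z p) h) * g p)) \<le> C * (norm h)\<^sup>2"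
    by simp
qed

subsection \<open>The integration cycle\<close>

text \<open>
A point of the unit torus at which the symbol dominates all its coefficients.
\<close>

definition torus_point :: "nat \<Rightarrow> (('n::finite \<Rightarrow> nat) \<Rightarrow> complex) \<Rightarrow> complex ^ 'n" where
  "torus_point m a = (SOME y. (\<forall>i. cmod (y $ i) = 1) \<and>
     (\<forall>\<alpha>. mi_order \<alpha> \<le> m \<longrightarrow> cmod (a \<alpha>) \<le> cmod (cpoly m a y)))"

lemma torus_point:
  "cmod (torus_point m a $ i) = 1"
  "mi_order \<alpha> \<le> m \<Longrightarrow> cmod (a \<alpha>) \<le> cmod (cpoly m a (torus_point m a))"
  using someI_ex[OF coeff_le_value_on_torus[where a = a and m = m]] unfolding torus_point_def by blast+

text \<open>
  The parameter at which the line through \<open>\<xi>\<close> in the direction \<open>cycle_dir m a \<xi>\<close> meets the torus point.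
\<close>

definition stretch :: "nat \<Rightarrow> (('n::finite \<Rightarrow> nat) \<Rightarrow> complex) \<Rightarrow> real ^ 'n \<Rightarrow> real" where
  "stretch m a \<xi> = 1 + norm (torus_point m a - cvec \<xi>)"

definition cycle_dir :: "nat \<Rightarrow> (('n::finite \<Rightarrow> nat) \<Rightarrow> complex) \<Rightarrow> real ^ 'n \<Rightarrow> complex ^ 'n" where
  "cycle_dir m a \<xi> = (\<chi> i. (torus_point m a $ i - of_real (\<xi> $ i)) / of_real (stretch m a \<xi>))"

definition circle_point :: "nat \<Rightarrow> (('n::finite \<Rightarrow> nat) \<Rightarrow> complex) \<Rightarrow> real ^ 'n \<Rightarrow> complex \<Rightarrow> complex ^ 'n" where
  "circle_point m a \<xi> z = (\<chi> i. of_real (\<xi> $ i) + z * cycle_dir m a \<xi> $ i)"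

definition symbol_bound :: "nat \<Rightarrow> (('n::finite \<Rightarrow> nat) \<Rightarrow> complex) \<Rightarrow> real ^ 'n \<Rightarrow> real" where
  "symbol_bound m a \<xi> = cmod (cpoly m a (torus_point m a)) / (1 + 2 * (stretch m a \<xi> + real (Suc m))) ^ m"

definition good_radius :: "nat \<Rightarrow> (('n::finite \<Rightarrow> nat) \<Rightarrow> complex) \<Rightarrow> real ^ 'n \<Rightarrow> nat \<Rightarrow> bool" where
  "good_radius m a \<xi> r \<longleftrightarrow> 1 \<le> r \<and>
    (\<forall>z. cmod z = real r \<longrightarrow> symbol_bound m a \<xi> \<le> cmod (cpoly m a (circle_point m a \<xi> z)))"

text \<open>
Choosing the least good radius makes the choice measurable in \<open>\<xi>\<close>.
\<close>

definition radius :: "nat \<Rightarrow> (('n::finite \<Rightarrow> nat) \<Rightarrow> complex) \<Rightarrow> real ^ 'n \<Rightarrow> nat" where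
  "radius m a \<xi> = (LEAST r. good_radius m a \<xi> r)"

definition circle_param :: "real \<Rightarrow> complex" where
  "circle_param t = exp (2 * of_real pi * \<i> * of_real t)"

text \<open>
  The family of circles over which the reciprocal of the symbol is integrated: a circle of radius
  \<open>radius m a \<xi>\<close> in a complex line through each real point \<open>\<xi>\<close>, parametrized by \<open>t \<in> [0, 1]\<close>.
\<close>

definition cycle :: "nat \<Rightarrow> (('n::finite \<Rightarrow> nat) \<Rightarrow> complex) \<Rightarrow> (real ^ 'n) \<times> real \<Rightarrow> complex ^ 'n" where
  "cycle m a p = circle_point m a (fst p) (of_real (real (radius m a (fst p))) * circle_param (snd p))"

definition nonzero_coeffs :: "nat \<Rightarrow> (('n::finite \<Rightarrow> nat) \<Rightarrow> complex) \<Rightarrow> bool" where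
  "nonzero_coeffs m a \<longleftrightarrow> (\<exists>\<alpha>. mi_order \<alpha> \<le> m \<and> a \<alpha> \<noteq> 0)"

lemma norm_circle_param [simp]: "cmod (circle_param t) = 1"
  by (simp add: circle_param_def)

lemma stretch_ge_1: "1 \<le> stretch m a \<xi>"
  by (simp add: stretch_def)

lemma norm_cycle_dir_le: "cmod (cycle_dir m a \<xi> $ i) \<le> 1"
proof -
  have "cmod ((torus_point m a - cvec \<xi>) $ i) \<le> norm (torus_point m a - cvec \<xi>)" by (rule Finite_Cartesian_Product.norm_nth_le)
  also have "\<dots> \<le> stretch m a \<xi>" by (simp add: stretch_def)
  finally show ?thesis
    using stretch_ge_1[of m a \<xi>] by (simp add: cycle_dir_def norm_divide divide_le_eq)
qed

lemma good_radius_exists: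
  assumes "nonzero_coeffs m a"
  shows "\<exists>r\<le>Suc m. good_radius m a \<xi> r"
proof -
  from assms obtain \<alpha> where "mi_order \<alpha> \<le> m" "a \<alpha> \<noteq> 0" by (auto simp: nonzero_coeffs_def)
  then have "cpoly m a (torus_point m a) \<noteq> 0" using torus_point(2)[of \<alpha> m a] by auto
  from cpoly_lower_bound_on_circle[OF this, of "cvec \<xi>"]
  obtain r where r: "r \<in> {1..Suc m}" and *: "\<And>z. cmod z = real r \<Longrightarrow> symbol_bound m a \<xi>
      \<le> cmod (cpoly m a (cvec \<xi> + z *s ((1 / of_real (stretch m a \<xi>)) *s (torus_point m a - cvec \<xi>))))"
    unfolding symbol_bound_def stretch_def by blast
  have "cvec \<xi> + z *s ((1 / of_real (stretch m a \<xi>)) *s (torus_point m a - cvec \<xi>)) = circle_point m a \<xi> z" for z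
    by (simp add: vec_eq_iff circle_point_def cycle_dir_def diff_divide_distrib right_diff_distrib)
  then show ?thesis using r * by (auto simp: good_radius_def)
qed

lemma
  assumes "nonzero_coeffs m a"
  shows radius_ge_1: "1 \<le> radius m a \<xi>" and radius_le: "radius m a \<xi> \<le> Suc m"
    and symbol_bound_le: "symbol_bound m a \<xi> \<le> cmod (cpoly m a (cycle m a (\<xi>, t)))"
proof -
  obtain r where r: "r \<le> Suc m" "good_radius m a \<xi> r" using good_radius_exists[OF assms] by blast
  have good: "good_radius m a \<xi> (radius m a \<xi>)" unfolding radius_def by (rule LeastI[where P = "good_radius m a \<xi>", OF r(2)])
  then show "1 \<le> radius m a \<xi>" by (simp add: good_radius_def)
  show "radius m a \<xi> \<le> Suc m"
    unfolding radius_def using Least_le[of "good_radius m a \<xi>", OF r(2)] r(1) by linarith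
  show "symbol_bound m a \<xi> \<le> cmod (cpoly m a (cycle m a (\<xi>, t)))"
    using good by (simp add: good_radius_def cycle_def norm_mult)
qed

lemma cycle_near_real:
  assumes "nonzero_coeffs m a"
  shows "cmod (cycle m a p $ i - of_real (fst p $ i)) \<le> real (Suc m)"
proof -
  have "cmod (cycle m a p $ i - of_real (fst p $ i)) = real (radius m a (fst p)) * cmod (cycle_dir m a (fst p) $ i)"
    by (simp add: cycle_def circle_point_def norm_mult)
  also have "\<dots> \<le> real (Suc m) * 1"
    using radius_le[OF assms, of "fst p"] by (intro mult_mono norm_cycle_dir_le) auto
  finally show ?thesis by simp
qed

lemma Im_cycle_le:
  assumes "nonzero_coeffs m a"
  shows "\<bar>Im (cycle m a p $ i)\<bar> \<le> real (Suc m)"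
  using abs_Im_le_cmod[of "cycle m a p $ i - of_real (fst p $ i)"] cycle_near_real[OF assms, of p i] by simp

lemma norm_cvec: "norm (cvec \<xi>) = norm \<xi>"
  by (simp add: norm_vec_def cvec_def)

lemma stretch_le: "stretch m a (\<xi> :: real ^ 'n::finite) \<le> 1 + real CARD('n) + norm \<xi>"
proof -
  have "norm (torus_point m a) \<le> (\<Sum>i\<in>(UNIV :: 'n set). cmod (torus_point m a $ i))"
    unfolding norm_vec_def by (rule L2_set_le_sum) simp
  then have "norm (torus_point m a) \<le> real CARD('n)" by (simp add: torus_point)
  then show ?thesis
    using norm_triangle_ineq4[of "torus_point m a" "cvec \<xi>"] by (simp add: stretch_def norm_cvec)
qed

text \<open>
  Along the cycle the reciprocal of the symbol grows at most polynomially, and the bound involves the symbol only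
  through the modulus of an arbitrary nonzero coefficient.
\<close>

lemma inverse_symbol_le:
  fixes a :: "('n::finite \<Rightarrow> nat) \<Rightarrow> complex"
  assumes \<alpha>: "mi_order \<alpha> \<le> m" "a \<alpha> \<noteq> 0"
  shows "cpoly m a (cycle m a p) \<noteq> 0"
    and "1 / cmod (cpoly m a (cycle m a p))
      \<le> (5 + 2 * real CARD('n) + 2 * real m) ^ m * (1 + norm (fst p)) ^ m / cmod (a \<alpha>)"
proof -
  have nz: "nonzero_coeffs m a" using \<alpha> by (auto simp: nonzero_coeffs_def)
  define \<xi> where "\<xi> = fst p"
  define Q where "Q = 1 + 2 * (stretch m a \<xi> + real (Suc m))"
  have "0 < Q" using stretch_ge_1[of m a \<xi>] by (simp add: Q_def)
  have "Q \<le> 5 + 2 * real CARD('n) + 2 * real m + 2 * norm \<xi>"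
    using stretch_le[of m a \<xi>] by (simp add: Q_def)
  also have "\<dots> \<le> (5 + 2 * real CARD('n) + 2 * real m) * (1 + norm \<xi>)"
  proof -
    have "2 * norm \<xi> \<le> (5 + 2 * real CARD('n) + 2 * real m) * norm \<xi>"
      by (intro mult_right_mono) auto
    then show ?thesis by (simp add: ring_distribs)
  qed
  finally have "Q ^ m \<le> ((5 + 2 * real CARD('n) + 2 * real m) * (1 + norm \<xi>)) ^ m"
    using \<open>0 < Q\<close> by (intro power_mono) auto
  then have Qm: "Q ^ m \<le> (5 + 2 * real CARD('n) + 2 * real m) ^ m * (1 + norm \<xi>) ^ m"
    by (simp add: power_mult_distrib)
  have "cmod (a \<alpha>) / Q ^ m \<le> symbol_bound m a \<xi>"
    unfolding symbol_bound_def Q_def[symmetric]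
    using torus_point(2)[where a = a, OF \<alpha>(1)] \<open>0 < Q\<close> by (intro divide_right_mono) auto
  also have "\<dots> \<le> cmod (cpoly m a (cycle m a p))"
    using symbol_bound_le[OF nz, of \<xi> "snd p"] by (simp add: \<xi>_def)
  finally have *: "cmod (a \<alpha>) / Q ^ m \<le> cmod (cpoly m a (cycle m a p))" .
  have pos: "0 < cmod (a \<alpha>) / Q ^ m" using \<alpha> \<open>0 < Q\<close> by simp
  then show "cpoly m a (cycle m a p) \<noteq> 0" using * by auto
  have "1 / cmod (cpoly m a (cycle m a p)) \<le> 1 / (cmod (a \<alpha>) / Q ^ m)"
    using * pos by (intro divide_left_mono mult_pos_pos less_le_trans[OF pos *]) auto
  also have "\<dots> = Q ^ m / cmod (a \<alpha>)" by simp
  also have "\<dots> \<le> (5 + 2 * real CARD('n) + 2 * real m) ^ m * (1 + norm \<xi>) ^ m / cmod (a \<alpha>)"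
    by (intro divide_right_mono Qm) simp
  finally show "1 / cmod (cpoly m a (cycle m a p))
      \<le> (5 + 2 * real CARD('n) + 2 * real m) ^ m * (1 + norm (fst p)) ^ m / cmod (a \<alpha>)"
    by (simp add: \<xi>_def)
qed

lemma continuous_cpoly: "continuous_on S (cpoly m a)"
  unfolding cpoly_def by (intro continuous_intros)

lemma continuous_stretch: "continuous_on UNIV (stretch m a)"
  unfolding stretch_def by (intro continuous_intros continuous_cvec)

lemma continuous_circle_point: "continuous_on UNIV (\<lambda>q. circle_point m a (fst q) (snd q))"
proof -
  have "stretch m a \<xi> \<noteq> 0" for \<xi> using stretch_ge_1[of m a \<xi>] by linarith
  then show ?thesis
    unfolding circle_point_def cycle_dir_def vec_lambda_beta
    by (intro continuous_on_vec_lambda continuous_intros continuous_on_compose2[OF continuous_stretch]) auto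
qed

text \<open>
  For each \<open>r\<close> the set of points \<open>\<xi>\<close> for which \<open>r\<close> is good is closed, as an intersection of closed
  conditions indexed by the points of the circle.
\<close>

lemma measurable_radius: "radius m a \<in> measurable borel (count_space UNIV)"
  unfolding radius_def
proof (rule measurable_Least)
  fix r
  have "closed {\<xi>. symbol_bound m a \<xi> \<le> cmod (cpoly m a (circle_point m a \<xi> z))}" for z
  proof (rule closed_Collect_le)
    have "(1 + 2 * (stretch m a \<xi> + real (Suc m))) ^ m \<noteq> 0" for \<xi>
      using stretch_ge_1[of m a \<xi>] by simp
    then show "continuous_on UNIV (symbol_bound m a)"
      unfolding symbol_bound_def
      by (intro continuous_intros)
        (auto intro: continuous_stretch)
    show "continuous_on UNIV (\<lambda>\<xi>. cmod (cpoly m a (circle_point m a \<xi> z)))"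
      by (intro continuous_intros continuous_on_compose2[OF continuous_cpoly[of UNIV]]
          continuous_on_compose2[OF continuous_circle_point, of _ "\<lambda>\<xi>. (\<xi>, z)", simplified]) auto
  qed
  then have "closed (\<Inter>z\<in>{z. cmod z = real r}. {\<xi>. symbol_bound m a \<xi> \<le> cmod (cpoly m a (circle_point m a \<xi> z))})"
    by (intro closed_INT) auto
  moreover have "{\<xi>. good_radius m a \<xi> r} = (if 1 \<le> r then
      (\<Inter>z\<in>{z. cmod z = real r}. {\<xi>. symbol_bound m a \<xi> \<le> cmod (cpoly m a (circle_point m a \<xi> z))}) else {})"
    by (auto simp: good_radius_def)
  ultimately have "closed {\<xi>. good_radius m a \<xi> r}" by simp
  then show "Measurable.pred borel (\<lambda>\<xi>. good_radius m a \<xi> r)"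
    by (simp add: pred_def borel_closed)
qed

lemma measurable_cycle [measurable]: "cycle m a \<in> borel_measurable (lborel \<Otimes>\<^sub>M lborel)"
proof -
  have r [measurable]: "(\<lambda>\<xi>. real (radius m a \<xi>)) \<in> borel_measurable borel"
    by (rule measurable_compose[OF measurable_radius]) simp
  have [measurable]: "circle_param \<in> borel_measurable borel"
    unfolding circle_param_def by (intro borel_measurable_continuous_onI continuous_intros)
  have "(\<lambda>p. of_real (real (radius m a (fst p))) * circle_param (snd p))
      \<in> borel_measurable (lborel \<Otimes>\<^sub>M (lborel :: real measure))" by measurable
  then show ?thesis
    unfolding cycle_def
    by (intro borel_measurable_continuous_Pair[OF _ _ continuous_circle_point]) measurable
qed

subsection \<open>Inverting the symbol along the cycle\<close>

text \<open>
  The indicator restricts the circle parameter to \<open>[0, 1]\<close>.  If all coefficients of order at most \<open>m\<close>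
  vanish, then the density is \<open>0\<close>, because division by \<open>0\<close> gives \<open>0\<close>; so \<open>sol\<close> below is the zero operator
  for the zero symbol.
\<close>

definition sol_density :: "nat \<Rightarrow> (('n::finite \<Rightarrow> nat) \<Rightarrow> complex) \<Rightarrow> 'n cfun \<Rightarrow> (real ^ 'n) \<times> real \<Rightarrow> complex" where
  "sol_density m a w p = of_real (indicator {0..1} (snd p) / (2 * pi) ^ CARD('n)) *
     fourier_laplace w (cycle m a p) / cpoly m a (cycle m a p)"

definition sol :: "nat \<Rightarrow> (('n::finite \<Rightarrow> nat) \<Rightarrow> complex) \<Rightarrow> 'n cfun \<Rightarrow> 'n cfun" where
  "sol m a w x = (LINT p|(lborel \<Otimes>\<^sub>M lborel). exp (- \<i> * cdot (cycle m a p) x) * sol_density m a w p)"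

definition sol_majorant :: "(real ^ 'n::finite) \<times> real \<Rightarrow> real" where
  "sol_majorant p = 1 / (1 + norm (fst p)) ^ (2 * CARD('n)) * indicator {0..1} (snd p)"

lemma integrable_sol_majorant: "integrable (lborel \<Otimes>\<^sub>M lborel) (sol_majorant :: (real ^ 'n::finite) \<times> real \<Rightarrow> real)"
  unfolding sol_majorant_def
  by (intro integrable_lborel_pair_mult integrable_inverse_power_norm) auto

lemma sol_majorant_nonneg: "0 \<le> sol_majorant p"
  by (simp add: sol_majorant_def)

lemma C_infinity_on_smooth: "w \<in> C_infinity_on K \<Longrightarrow> smooth w"
  by (simp add: C_infinity_on_def)

lemma C_infinity_on_measurable: "w \<in> C_infinity_on K \<Longrightarrow> w \<in> borel_measurable borel"
  by (intro borel_measurable_continuous_onI smooth_continuous_on C_infinity_on_smooth)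

lemma measurable_sol_density:
  assumes "w \<in> C_infinity_on K"
  shows "sol_density m a w \<in> borel_measurable (lborel \<Otimes>\<^sub>M lborel)"
proof -
  have [measurable]: "w \<in> borel_measurable borel" by (rule C_infinity_on_measurable[OF assms])
  have [measurable]: "cpoly m a \<in> borel_measurable borel"
    by (intro borel_measurable_continuous_onI continuous_cpoly)
  show ?thesis unfolding sol_density_def by measurable
qed

lemma cpoly_eq_0: "\<not> nonzero_coeffs m a \<Longrightarrow> cpoly m a \<zeta> = 0"
  by (auto simp: cpoly_def nonzero_coeffs_def)

lemma sol_eq_0: "\<not> nonzero_coeffs m a \<Longrightarrow> sol m a w = (\<lambda>_. 0)"
  by (simp add: sol_def sol_density_def cpoly_eq_0 fun_eq_iff)

text \<open>
  The rapid decay of the transform pays for the growth \<open>(1 + \<bar>\<xi>\<bar>)\<^sup>m\<close> of the reciprocal symbol, for the integrability weight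
  \<open>(1 + \<bar>\<xi>\<bar>)\<^sup>-\<^sup>2\<^sup>n\<close> and for \<open>k\<close> further powers, needed for \<open>k\<close> derivatives in \<open>x\<close>.
\<close>

lemma sol_density_bound:
  fixes K :: "(real ^ 'n::finite) set"
  assumes K: "compact K"
  shows "\<exists>C\<ge>0. \<forall>a \<alpha> w p. mi_order \<alpha> \<le> m \<longrightarrow> a \<alpha> \<noteq> 0 \<longrightarrow> w \<in> C_infinity_on K \<longrightarrow>
    (1 + norm (fst p)) ^ k * cmod (sol_density m a w p)
      \<le> C / cmod (a \<alpha>) * seminorm K (m + 2 * CARD('n) + k) w * sol_majorant p"
proof -
  let ?n2 = "2 * CARD('n)" and ?M = "m + 2 * CARD('n) + k"
  obtain C1 where C1: "0 \<le> C1" "\<And>w \<xi> \<zeta>. w \<in> C_infinity_on K \<Longrightarrow> (\<forall>i. cmod (\<zeta> $ i - of_real (\<xi> $ i)) \<le> real (Suc m))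
      \<Longrightarrow> (1 + norm \<xi>) ^ ?M * cmod (fourier_laplace w \<zeta>) \<le> C1 * seminorm K ?M w"
    using fourier_laplace_decay[OF K, of "real (Suc m)" ?M] by auto
  define D where "D = (5 + 2 * real CARD('n) + 2 * real m) ^ m"
  have "0 \<le> D" by (simp add: D_def)
  have "(1 + norm (fst p)) ^ k * cmod (sol_density m a w p)
      \<le> D * C1 / cmod (a \<alpha>) * seminorm K ?M w * sol_majorant p"
    if \<alpha>: "mi_order \<alpha> \<le> m" "a \<alpha> \<noteq> 0" and w: "w \<in> C_infinity_on K" for a \<alpha> w p
  proof -
    have nz: "nonzero_coeffs m a" using \<alpha> by (auto simp: nonzero_coeffs_def)
    define s where "s = 1 + norm (fst p)"
    have "1 \<le> s" by (simp add: s_def)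
    define F where "F = cmod (fourier_laplace w (cycle m a p))"
    define J where "J = (indicator {0..1} (snd p) :: real)"
    have J: "0 \<le> J" "sol_majorant p = J / s ^ ?n2" by (auto simp: J_def sol_majorant_def s_def)
    have "s ^ ?M * F \<le> C1 * seminorm K ?M w"
      unfolding s_def F_def by (rule C1(2)[OF w]) (use cycle_near_real[OF nz, of p] in blast)
    then have F: "s ^ (k + m) * F \<le> C1 * seminorm K ?M w / s ^ ?n2"
      using \<open>1 \<le> s\<close> by (subst pos_le_divide_eq) (auto simp: power_add mult_ac)
    have one: "J / (2 * pi) ^ CARD('n) \<le> J"
    proof -
      have "1 \<le> (2 * pi) ^ CARD('n)" using pi_ge_two by (intro one_le_power) simp
      then show ?thesis using J(1) by (simp add: divide_le_eq mult_le_cancel_left1)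
    qed
    have "cmod (sol_density m a w p) = J / (2 * pi) ^ CARD('n) * F * (1 / cmod (cpoly m a (cycle m a p)))"
      by (simp add: sol_density_def norm_mult norm_divide F_def J_def norm_power)
    also have "\<dots> \<le> J * F * (D * s ^ m / cmod (a \<alpha>))"
      using inverse_symbol_le(2)[where a = a and p = p, OF \<alpha>] one J(1) \<open>0 \<le> D\<close> \<open>1 \<le> s\<close>
      by (intro mult_mono) (auto simp: D_def s_def F_def)
    finally have "s ^ k * cmod (sol_density m a w p) \<le> s ^ k * (J * F * (D * s ^ m / cmod (a \<alpha>)))"
      using \<open>1 \<le> s\<close> by (intro mult_left_mono) auto
    also have "\<dots> = (J * D / cmod (a \<alpha>)) * (s ^ (k + m) * F)" by (simp add: power_add)
    also have "\<dots> \<le> (J * D / cmod (a \<alpha>)) * (C1 * seminorm K ?M w / s ^ ?n2)"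
      using F J(1) \<open>0 \<le> D\<close> by (intro mult_left_mono) auto
    also have "\<dots> = D * C1 / cmod (a \<alpha>) * seminorm K ?M w * sol_majorant p"
      unfolding J(2) by simp
    finally show ?thesis by (simp only: s_def)
  qed
  then show ?thesis using \<open>0 \<le> D\<close> C1(1) by (intro exI[of _ "D * C1"]) auto
qed

lemma size_sum_cycle_le:
  fixes a :: "('n::finite \<Rightarrow> nat) \<Rightarrow> complex"
  assumes "nonzero_coeffs m a"
  shows "size_sum (cycle m a p) \<le> real CARD('n) * real (Suc m) * (1 + norm (fst p))"
proof -
  have "size_sum (cycle m a p) \<le> (\<Sum>i\<in>(UNIV :: 'n set). real (Suc m) * (1 + norm (fst p)))"
    unfolding size_sum_def
  proof (rule sum_mono)
    fix i
    have "cmod (cycle m a p $ i) \<le> cmod (cycle m a p $ i - of_real (fst p $ i)) + \<bar>fst p $ i\<bar>"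
      using norm_triangle_ineq[of "cycle m a p $ i - of_real (fst p $ i)" "of_real (fst p $ i)"] by simp
    also have "\<dots> \<le> real (Suc m) + norm (fst p)"
      by (intro add_mono cycle_near_real[OF assms] component_le_norm_cart)
    also have "\<dots> \<le> real (Suc m) * (1 + norm (fst p))" by (simp add: algebra_simps)
    finally show "cmod (cycle m a p $ i) \<le> real (Suc m) * (1 + norm (fst p))" .
  qed
  then show ?thesis by simp
qed

lemma exp_cycle_le:
  fixes a :: "('n::finite \<Rightarrow> nat) \<Rightarrow> complex"
  assumes "nonzero_coeffs m a" "norm x \<le> R"
  shows "cmod (exp (- \<i> * cdot (cycle m a p) x)) \<le> exp (real CARD('n) * real (Suc m) * R)"
  using norm_exp_cdot_le[OF Im_cycle_le[OF assms(1)], of "- x" R p] assms(2) by (simp add: cdot_minus_right)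

lemma integrable_sol:
  assumes w: "w \<in> C_infinity_on K" and K: "compact K"
  shows "integrable (lborel \<Otimes>\<^sub>M lborel) (\<lambda>p. exp (- \<i> * cdot (cycle m a p) x) * sol_density m a w p)"
proof (cases "nonzero_coeffs m a")
  case False
  then show ?thesis by (simp add: sol_density_def cpoly_eq_0)
next
  case True
  note [measurable] = measurable_sol_density[OF w]
  let ?n = "CARD('a)"
  from True obtain \<alpha> where \<alpha>: "mi_order \<alpha> \<le> m" "a \<alpha> \<noteq> 0" by (auto simp: nonzero_coeffs_def)
  obtain C where "\<And>p. (1 + norm (fst p)) ^ 0 * cmod (sol_density m a w p)
      \<le> C / cmod (a \<alpha>) * seminorm K (m + 2 * ?n + 0) w * sol_majorant p"
    using sol_density_bound[OF K, of m 0] \<alpha> w by blast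
  then have C: "cmod (sol_density m a w p) \<le> C / cmod (a \<alpha>) * seminorm K (m + 2 * ?n) w * sol_majorant p" for p
    by (simp only: power_0 mult_1_left add_0_right)
  show ?thesis
  proof (rule Bochner_Integration.integrable_bound)
    show "integrable (lborel \<Otimes>\<^sub>M lborel) (\<lambda>p. exp (real ?n * real (Suc m) * norm x) *
        (C / cmod (a \<alpha>) * seminorm K (m + 2 * ?n) w * sol_majorant p))"
      by (intro integrable_mult_right integrable_sol_majorant)
    show "AE p in lborel \<Otimes>\<^sub>M lborel. norm (exp (- \<i> * cdot (cycle m a p) x) * sol_density m a w p)
        \<le> norm (exp (real ?n * real (Suc m) * norm x) * (C / cmod (a \<alpha>) * seminorm K (m + 2 * ?n) w * sol_majorant p))"
    proof (rule AE_I2)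
      fix p
      have "cmod (exp (- \<i> * cdot (cycle m a p) x)) * cmod (sol_density m a w p)
          \<le> exp (real ?n * real (Suc m) * norm x) * (C / cmod (a \<alpha>) * seminorm K (m + 2 * ?n) w * sol_majorant p)"
        by (intro mult_mono exp_cycle_le[OF True order_refl] C) auto
      then show "norm (exp (- \<i> * cdot (cycle m a p) x) * sol_density m a w p)
        \<le> norm (exp (real ?n * real (Suc m) * norm x) * (C / cmod (a \<alpha>) * seminorm K (m + 2 * ?n) w * sol_majorant p))"
        unfolding norm_mult[of "exp (- \<i> * cdot (cycle m a p) x)"] real_norm_def by linarith
    qed
  qed measurable
qed

lemma sol_bound:
  fixes K K' :: "(real ^ 'n::finite) set"
  assumes K: "compact K" and K': "compact K'"
  shows "\<exists>C\<ge>0. \<forall>a \<alpha> w x. mi_order \<alpha> \<le> m \<longrightarrow> a \<alpha> \<noteq> 0 \<longrightarrow> w \<in> C_infinity_on K \<longrightarrow> x \<in> K' \<longrightarrow>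
    cmod (sol m a w x) \<le> C / cmod (a \<alpha>) * seminorm K (m + 2 * CARD('n)) w"
proof -
  let ?n = "CARD('n)"
  let ?I = "integral\<^sup>L (lborel \<Otimes>\<^sub>M lborel) (sol_majorant :: (real ^ 'n) \<times> real \<Rightarrow> real)"
  obtain R where R: "K' \<subseteq> cball 0 R" using compact_subset_cball_0[OF K'] by blast
  obtain C where "0 \<le> C" and C0: "\<And>a \<alpha> w p. mi_order \<alpha> \<le> m \<Longrightarrow> a \<alpha> \<noteq> 0 \<Longrightarrow> w \<in> C_infinity_on K \<Longrightarrow>
      (1 + norm (fst p)) ^ 0 * cmod (sol_density m a w p)
      \<le> C / cmod (a \<alpha>) * seminorm K (m + 2 * ?n + 0) w * sol_majorant p"
    using sol_density_bound[OF K, of m 0] by blast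
  note C = \<open>0 \<le> C\<close> C0[unfolded power_0 mult_1_left add_0_right]
  let ?E = "exp (real ?n * real (Suc m) * R)"
  have "cmod (sol m a w x) \<le> ?E * C * ?I / cmod (a \<alpha>) * seminorm K (m + 2 * ?n) w"
    if \<alpha>: "mi_order \<alpha> \<le> m" "a \<alpha> \<noteq> 0" and w: "w \<in> C_infinity_on K" and x: "x \<in> K'" for a \<alpha> w x
  proof -
    have nz: "nonzero_coeffs m a" using \<alpha> by (auto simp: nonzero_coeffs_def)
    have "norm x \<le> R" using x R by auto
    have "cmod (sol m a w x)
        \<le> (LINT p|((lborel :: (real ^ 'n) measure) \<Otimes>\<^sub>M lborel). ?E * (C / cmod (a \<alpha>) * seminorm K (m + 2 * ?n) w) * sol_majorant p)"
      unfolding sol_def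
    proof (rule norm_integral_le[OF integrable_sol[OF w K]])
      show "integrable (lborel \<Otimes>\<^sub>M lborel) (\<lambda>p. ?E * (C / cmod (a \<alpha>) * seminorm K (m + 2 * ?n) w) * sol_majorant p)"
        by (intro integrable_mult_right integrable_sol_majorant)
      fix p
      have "cmod (exp (- \<i> * cdot (cycle m a p) x)) * cmod (sol_density m a w p)
          \<le> ?E * (C / cmod (a \<alpha>) * seminorm K (m + 2 * ?n) w * sol_majorant p)"
        by (intro mult_mono exp_cycle_le[OF nz \<open>norm x \<le> R\<close>] C(2)[where a = a and \<alpha> = \<alpha>, OF \<alpha> w]) auto
      then show "norm (exp (- \<i> * cdot (cycle m a p) x) * sol_density m a w p)
          \<le> ?E * (C / cmod (a \<alpha>) * seminorm K (m + 2 * ?n) w) * sol_majorant p"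
        by (simp add: norm_mult mult.assoc)
    qed
    also have "\<dots> = ?E * C * ?I / cmod (a \<alpha>) * seminorm K (m + 2 * ?n) w" by simp
    finally show ?thesis .
  qed
  moreover have "0 \<le> ?I" by (rule integral_nonneg_AE) (simp add: sol_majorant_nonneg)
  ultimately show ?thesis using C(1) by (intro exI[of _ "?E * C * ?I"]) auto
qed

text \<open>
  Differentiating the exponential in \<open>x\<close> produces the factor \<open>-i\<zeta>\<^sub>j\<close>, which also turns the transform of
  \<open>w\<close> into that of its \<open>j\<close>-th derivative.
\<close>

lemma
  assumes w: "w \<in> C_infinity_on K" and K: "compact K"
  shows sol_differentiable: "sol m a w differentiable at x"
    and partial_deriv_sol: "partial_deriv j (sol m a w) = sol m a (partial_deriv j w)"
proof -
  have "sol m a w differentiable at x \<and> partial_deriv j (sol m a w) x = sol m a (partial_deriv j w) x" for x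
  proof (cases "nonzero_coeffs m a")
    case False
    then show ?thesis by (simp add: sol_eq_0 partial_deriv_zero)
  next
    case True
    note [measurable] = measurable_sol_density[OF w]
    let ?n = "real CARD('a)"
    from True obtain \<alpha> where \<alpha>: "mi_order \<alpha> \<le> m" "a \<alpha> \<noteq> 0" by (auto simp: nonzero_coeffs_def)
    define S where "S = seminorm K (m + 2 * CARD('a) + 2) w"
    obtain C where C: "0 \<le> C" "\<And>p. (1 + norm (fst p))\<^sup>2 * cmod (sol_density m a w p) \<le> C / cmod (a \<alpha>) * S * sol_majorant p"
      using sol_density_bound[OF K, of m 2] \<alpha> w unfolding S_def by blast
    define H where "H p = (1 + (?n * real (Suc m))\<^sup>2) * (C / cmod (a \<alpha>) * S * sol_majorant p)" for p :: "(real ^ 'a) \<times> real"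
    have base: "0 \<le> C / cmod (a \<alpha>) * S * sol_majorant p" for p
      using C(1) seminorm_nonneg[OF K C_infinity_on_smooth[OF w]] by (simp add: S_def sol_majorant_nonneg)
    have "((\<lambda>x. LINT p|(lborel \<Otimes>\<^sub>M lborel). exp (- \<i> * cdot (cycle m a p) x) * sol_density m a w p) has_derivative
        (\<lambda>h. LINT p|(lborel \<Otimes>\<^sub>M lborel). exp (- \<i> * cdot (cycle m a p) x) * (- \<i> * cdot (cycle m a p) h) * sol_density m a w p)) (at x)"
    proof (rule has_derivative_exponential_integral[where H = H])
      show "\<bar>Im (cycle m a p $ i)\<bar> \<le> real (Suc m)" for p i by (rule Im_cycle_le[OF True])
      show "integrable (lborel \<Otimes>\<^sub>M lborel) H"
        unfolding H_def by (intro integrable_mult_right integrable_sol_majorant)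
      fix p :: "(real ^ 'a) \<times> real"
      have "1 * cmod (sol_density m a w p) \<le> (1 + norm (fst p))\<^sup>2 * cmod (sol_density m a w p)"
        by (intro mult_right_mono one_le_power) auto
      also note C(2)
      also have "C / cmod (a \<alpha>) * S * sol_majorant p \<le> H p"
        using mult_right_mono[OF _ base[of p], of 1 "1 + (?n * real (Suc m))\<^sup>2"] by (simp add: H_def)
      finally show "cmod (sol_density m a w p) \<le> H p" by simp
      have "(size_sum (cycle m a p))\<^sup>2 \<le> (?n * real (Suc m) * (1 + norm (fst p)))\<^sup>2"
        by (intro power_mono size_sum_cycle_le True size_sum_nonneg)
      also have "\<dots> \<le> (1 + (?n * real (Suc m))\<^sup>2) * (1 + norm (fst p))\<^sup>2"
        unfolding power_mult_distrib[of _ "1 + norm (fst p)"] by (intro mult_right_mono) auto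
      finally have "(size_sum (cycle m a p))\<^sup>2 * cmod (sol_density m a w p)
          \<le> (1 + (?n * real (Suc m))\<^sup>2) * (1 + norm (fst p))\<^sup>2 * cmod (sol_density m a w p)"
        by (rule mult_right_mono) simp
      also have "\<dots> = (1 + (?n * real (Suc m))\<^sup>2) * ((1 + norm (fst p))\<^sup>2 * cmod (sol_density m a w p))"
        by (simp only: mult.assoc)
      also have "\<dots> \<le> H p" unfolding H_def by (intro mult_left_mono C(2)) simp
      finally show "(size_sum (cycle m a p))\<^sup>2 * cmod (sol_density m a w p) \<le> H p" .
    qed measurable
    then have d: "(sol m a w has_derivative (\<lambda>h. LINT p|(lborel \<Otimes>\<^sub>M lborel).
        exp (- \<i> * cdot (cycle m a p) x) * (- \<i> * cdot (cycle m a p) h) * sol_density m a w p)) (at x)"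
      by (simp only: sol_def[abs_def])
    have "- \<i> * cdot (cycle m a p) (axis j 1) * sol_density m a w p = sol_density m a (partial_deriv j w) p" for p
      by (simp add: sol_density_def fourier_laplace_partial_deriv[OF w K] cdot_axis)
    then have "partial_deriv j (sol m a w) x = sol m a (partial_deriv j w) x"
      unfolding partial_deriv_eqI[OF d] sol_def by (simp only: mult.assoc)
    then show ?thesis using d differentiable_def by blast
  qed
  then show "sol m a w differentiable at x" "partial_deriv j (sol m a w) = sol m a (partial_deriv j w)"
    by auto
qed

lemma foldr_partial_deriv_sol:
  assumes w: "w \<in> C_infinity_on K" and K: "compact K"
  shows "foldr partial_deriv is (sol m a w) = sol m a (foldr partial_deriv is w)"
proof (induction "is")
  case (Cons i "is")
  then show ?case
    using partial_deriv_sol[OF C_infinity_on_foldr[OF w compact_imp_closed[OF K]] K, of i m a "is"] by simp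
qed simp

lemma smooth_sol:
  assumes w: "w \<in> C_infinity_on K" and K: "compact K"
  shows "smooth (sol m a w)"
  unfolding smooth_def foldr_partial_deriv_sol[OF assms]
  using sol_differentiable[OF C_infinity_on_foldr[OF w compact_imp_closed[OF K]] K] by blast

lemma mpd_sol:
  assumes w: "w \<in> C_infinity_on K" and K: "compact K"
  shows "mpd \<beta> (sol m a w) = sol m a (mpd \<beta> w)"
  unfolding mpd_def by (rule foldr_partial_deriv_sol[OF assms])

lemma C_infinity_on_mpd: "w \<in> C_infinity_on K \<Longrightarrow> closed K \<Longrightarrow> mpd \<beta> w \<in> C_infinity_on K"
  unfolding mpd_def by (rule C_infinity_on_foldr)

lemma mi_order_add: "mi_order (\<lambda>i. \<alpha> i + \<beta> i) = mi_order \<alpha> + mi_order \<beta>"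
  by (simp add: mi_order_def sum.distrib)

lemma seminorm_mpd_le:
  assumes "compact K" "smooth w" "mi_order \<beta> \<le> l"
  shows "seminorm K M (mpd \<beta> w) \<le> seminorm K (M + l) w"
proof (rule seminorm_least)
  fix \<alpha> :: "'a \<Rightarrow> nat" and x assume "mi_order \<alpha> \<le> M" "x \<in> K"
  then show "cmod (mpd \<alpha> (mpd \<beta> w) x) \<le> seminorm K (M + l) w"
    unfolding mpd_mpd[OF assms(2)] using assms by (intro seminorm_upper) (auto simp: mi_order_add)
qed (use assms seminorm_nonneg in auto)

text \<open>
  The loss of derivatives and the constant are the same for all orders \<open>l\<close>, since \<open>sol\<close> commutes with derivatives.
  This uniformity is what preserves regularity in the sense of \<^const>\<open>Ginf\<close>.
\<close>

theorem seminorm_sol_le: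
  fixes K K' :: "(real ^ 'n::finite) set"
  assumes K: "compact K" and K': "compact K'"
  shows "\<exists>C\<ge>0. \<forall>a \<alpha> w l. mi_order \<alpha> \<le> m \<longrightarrow> a \<alpha> \<noteq> 0 \<longrightarrow> w \<in> C_infinity_on K \<longrightarrow>
    seminorm K' l (sol m a w) \<le> C / cmod (a \<alpha>) * seminorm K (m + 2 * CARD('n) + l) w"
proof -
  let ?M = "m + 2 * CARD('n)"
  obtain C where C: "0 \<le> C" "\<And>a \<alpha> w x. mi_order \<alpha> \<le> m \<Longrightarrow> a \<alpha> \<noteq> 0 \<Longrightarrow> w \<in> C_infinity_on K \<Longrightarrow> x \<in> K' \<Longrightarrow>
      cmod (sol m a w x) \<le> C / cmod (a \<alpha>) * seminorm K ?M w"
    using sol_bound[OF K K', of m] by blast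
  have "seminorm K' l (sol m a w) \<le> C / cmod (a \<alpha>) * seminorm K (?M + l) w"
    if \<alpha>: "mi_order \<alpha> \<le> m" "a \<alpha> \<noteq> 0" and w: "w \<in> C_infinity_on K" for a \<alpha> w l
  proof (rule seminorm_least)
    note sw = C_infinity_on_smooth[OF w]
    show "0 \<le> C / cmod (a \<alpha>) * seminorm K (?M + l) w" using C(1) seminorm_nonneg[OF K sw] by simp
    fix \<beta> :: "'n \<Rightarrow> nat" and x assume *: "mi_order \<beta> \<le> l" "x \<in> K'"
    have "cmod (mpd \<beta> (sol m a w) x) \<le> C / cmod (a \<alpha>) * seminorm K ?M (mpd \<beta> w)"
      unfolding mpd_sol[OF w K]
      by (rule C(2)[where a = a and \<alpha> = \<alpha>, OF \<alpha> C_infinity_on_mpd[OF w compact_imp_closed[OF K]] *(2)])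
    also have "\<dots> \<le> C / cmod (a \<alpha>) * seminorm K (?M + l) w"
      using C(1) by (intro mult_left_mono seminorm_mpd_le K sw *) auto
    finally show "cmod (mpd \<beta> (sol m a w) x) \<le> C / cmod (a \<alpha>) * seminorm K (?M + l) w" .
  qed
  then show ?thesis using C(1) by blast
qed

lemma sol_add:
  assumes "v \<in> C_infinity_on K" "w \<in> C_infinity_on K" "compact K"
  shows "sol m a (\<lambda>x. v x + w x) = (\<lambda>x. sol m a v x + sol m a w x)"
proof
  fix x
  have "sol_density m a (\<lambda>x. v x + w x) p = sol_density m a v p + sol_density m a w p" for p
    by (simp add: sol_density_def fourier_laplace_add[OF assms] ring_distribs add_divide_distrib)
  then show "sol m a (\<lambda>x. v x + w x) x = sol m a v x + sol m a w x"
    unfolding sol_def using integrable_sol[OF assms(1,3), of m a x] integrable_sol[OF assms(2,3), of m a x]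
    by (simp add: distrib_left)
qed

lemma sol_cmult: "sol m a (\<lambda>x. c * w x) = (\<lambda>x. c * sol m a w x)"
proof
  fix x
  have "exp (- \<i> * cdot (cycle m a p) x) * sol_density m a (\<lambda>x. c * w x) p
      = c * (exp (- \<i> * cdot (cycle m a p) x) * sol_density m a w p)" for p
    by (simp add: sol_density_def fourier_laplace_cmult)
  then show "sol m a (\<lambda>x. c * w x) x = c * sol m a w x"
    unfolding sol_def by (simp only: integral_mult_right_zero)
qed

lemma sol_zero: "sol m a (\<lambda>_. 0) = (\<lambda>_. 0)"
  using sol_cmult[of m a 0 "\<lambda>_. 0"] by simp

lemma C_infinity_on_outside: "w \<in> C_infinity_on K \<Longrightarrow> x \<notin> K \<Longrightarrow> w x = 0"
  by (auto simp: C_infinity_on_def intro: outside_tsupp)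

lemma C_infinity_onI: "smooth w \<Longrightarrow> closed K \<Longrightarrow> (\<And>x. x \<notin> K \<Longrightarrow> w x = 0) \<Longrightarrow> w \<in> C_infinity_on K"
  by (simp add: C_infinity_on_def tsupp_subsetI)

lemma C_infinity_on_add: "v \<in> C_infinity_on K \<Longrightarrow> w \<in> C_infinity_on K \<Longrightarrow> closed K \<Longrightarrow> (\<lambda>x. v x + w x) \<in> C_infinity_on K"
  by (rule C_infinity_onI) (simp_all add: C_infinity_on_outside smooth_add C_infinity_on_smooth[of _ K])

lemma C_infinity_on_cmult: "w \<in> C_infinity_on K \<Longrightarrow> closed K \<Longrightarrow> (\<lambda>x. c * w x) \<in> C_infinity_on K"
  by (rule C_infinity_onI) (simp_all add: C_infinity_on_outside smooth_cmult C_infinity_on_smooth[of _ K])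

lemma C_infinity_on_zero: "closed K \<Longrightarrow> (\<lambda>_. 0) \<in> C_infinity_on K"
  by (rule C_infinity_onI) auto

lemma
  assumes "\<And>i. i \<in> I \<Longrightarrow> v i \<in> C_infinity_on K" "compact K"
  shows C_infinity_on_sum: "(\<lambda>x. \<Sum>i\<in>I. v i x) \<in> C_infinity_on K"
    and sol_sum: "sol m a (\<lambda>x. \<Sum>i\<in>I. v i x) = (\<lambda>x. \<Sum>i\<in>I. sol m a (v i) x)"
    and fourier_laplace_sum: "fourier_laplace (\<lambda>x. \<Sum>i\<in>I. v i x) \<zeta> = (\<Sum>i\<in>I. fourier_laplace (v i) \<zeta>)"
proof -
  have "(\<lambda>x. \<Sum>i\<in>I. v i x) \<in> C_infinity_on K \<and> sol m a (\<lambda>x. \<Sum>i\<in>I. v i x) = (\<lambda>x. \<Sum>i\<in>I. sol m a (v i) x)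
      \<and> fourier_laplace (\<lambda>x. \<Sum>i\<in>I. v i x) \<zeta> = (\<Sum>i\<in>I. fourier_laplace (v i) \<zeta>)"
    using assms(1)
  proof (induction I rule: infinite_finite_induct)
    case (insert i I)
    then show ?case
      using sol_add[OF insert.prems[of i] _ assms(2), of "\<lambda>x. \<Sum>i\<in>I. v i x" m a]
        fourier_laplace_add[OF insert.prems[of i] _ assms(2), of "\<lambda>x. \<Sum>i\<in>I. v i x" \<zeta>]
        C_infinity_on_add[OF insert.prems[of i] _ compact_imp_closed[OF assms(2)], of "\<lambda>x. \<Sum>i\<in>I. v i x"]
      by simp
  qed (simp_all add: C_infinity_on_zero compact_imp_closed assms sol_zero fourier_laplace_def)
  then show "(\<lambda>x. \<Sum>i\<in>I. v i x) \<in> C_infinity_on K" "sol m a (\<lambda>x. \<Sum>i\<in>I. v i x) = (\<lambda>x. \<Sum>i\<in>I. sol m a (v i) x)"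
    "fourier_laplace (\<lambda>x. \<Sum>i\<in>I. v i x) \<zeta> = (\<Sum>i\<in>I. fourier_laplace (v i) \<zeta>)" by blast+
qed

subsection \<open>The solution operator inverts the differential operator\<close>

definition cdiff_op :: "nat \<Rightarrow> (('n::finite \<Rightarrow> nat) \<Rightarrow> complex) \<Rightarrow> 'n cfun \<Rightarrow> 'n cfun" where
  "cdiff_op m a w x = (\<Sum>\<alpha> | mi_order \<alpha> \<le> m. a \<alpha> * ((- \<i>) ^ mi_order \<alpha> * mpd \<alpha> w x))"

text \<open>
The coefficients of \<open>P(-D)\<close>, the transpose of \<open>P(D)\<close>.
\<close>

definition ctranspose :: "(('n::finite \<Rightarrow> nat) \<Rightarrow> complex) \<Rightarrow> ('n \<Rightarrow> nat) \<Rightarrow> complex" where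
  "ctranspose a \<alpha> = (- 1) ^ mi_order \<alpha> * a \<alpha>"

lemma prod_list_count:
  fixes f :: "'n::finite \<Rightarrow> complex"
  shows "(\<Prod>i\<leftarrow>is. f i) = (\<Prod>i\<in>UNIV. f i ^ count_list is i)"
proof (induction "is")
  case (Cons a "is")
  have "(\<Prod>i\<in>UNIV. f i ^ count_list (a # is) i) = (\<Prod>i\<in>UNIV. (if a = i then f i else 1) * f i ^ count_list is i)"
    by (intro prod.cong) auto
  also have "\<dots> = f a * (\<Prod>i\<in>UNIV. f i ^ count_list is i)" by (simp add: prod.distrib)
  finally show ?case using Cons by simp
qed simp

lemma fourier_laplace_mpd:
  assumes w: "w \<in> C_infinity_on K" and K: "compact K"
  shows "fourier_laplace (mpd \<alpha> w) \<zeta> = (- \<i>) ^ mi_order \<alpha> * (\<Prod>i\<in>UNIV. (\<zeta> $ i) ^ \<alpha> i) * fourier_laplace w \<zeta>"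
proof -
  obtain "is" where is': "\<forall>i. count_list is i = \<alpha> i" using ex_multiindex_list by blast
  have "mpd \<alpha> w = foldr partial_deriv is w" using is' by (intro mpd_eq C_infinity_on_smooth[OF w]) auto
  then have "fourier_laplace (mpd \<alpha> w) \<zeta> = (\<Prod>i\<in>UNIV. (- \<i> * \<zeta> $ i) ^ \<alpha> i) * fourier_laplace w \<zeta>"
    using is' by (simp add: fourier_laplace_foldr[OF w K] prod_list_count)
  also have "(\<Prod>i\<in>UNIV. (- \<i> * \<zeta> $ i) ^ \<alpha> i) = (- \<i>) ^ mi_order \<alpha> * (\<Prod>i\<in>UNIV. (\<zeta> $ i) ^ \<alpha> i)"
    by (simp only: power_mult_distrib prod.distrib mi_order_def power_sum)
  finally show ?thesis .
qed

lemma C_infinity_on_cdiff_op: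
  assumes w: "w \<in> C_infinity_on K" and K: "compact K"
  shows "cdiff_op m a w \<in> C_infinity_on K"
  unfolding cdiff_op_def[abs_def] using compact_imp_closed[OF K]
  by (intro C_infinity_on_sum C_infinity_on_cmult C_infinity_on_mpd) (auto simp: w K)

lemma fourier_laplace_cdiff_op:
  assumes w: "w \<in> C_infinity_on K" and K: "compact K"
  shows "fourier_laplace (cdiff_op m (ctranspose a) w) \<zeta> = cpoly m a \<zeta> * fourier_laplace w \<zeta>"
proof -
  have "fourier_laplace (cdiff_op m (ctranspose a) w) \<zeta>
      = (\<Sum>\<alpha> | mi_order \<alpha> \<le> m. fourier_laplace (\<lambda>x. ctranspose a \<alpha> * ((- \<i>) ^ mi_order \<alpha> * mpd \<alpha> w x)) \<zeta>)"
    unfolding cdiff_op_def[abs_def] using compact_imp_closed[OF K]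
    by (intro fourier_laplace_sum C_infinity_on_cmult C_infinity_on_mpd) (auto simp: w K)
  also have "\<dots> = (\<Sum>\<alpha> | mi_order \<alpha> \<le> m. a \<alpha> * (\<Prod>i\<in>UNIV. (\<zeta> $ i) ^ \<alpha> i) * fourier_laplace w \<zeta>)"
  proof (intro sum.cong refl)
    fix \<alpha> :: "'a \<Rightarrow> nat"
    have one: "(- 1) ^ k * (- \<i>) ^ k * (- \<i>) ^ k = (1 :: complex)" for k
      by (simp flip: power_mult_distrib)
    have "fourier_laplace (\<lambda>x. ctranspose a \<alpha> * ((- \<i>) ^ mi_order \<alpha> * mpd \<alpha> w x)) \<zeta>
        = ((- 1) ^ mi_order \<alpha> * (- \<i>) ^ mi_order \<alpha> * (- \<i>) ^ mi_order \<alpha>) *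
          (a \<alpha> * (\<Prod>i\<in>UNIV. (\<zeta> $ i) ^ \<alpha> i) * fourier_laplace w \<zeta>)"
      unfolding fourier_laplace_cmult fourier_laplace_mpd[OF w K] ctranspose_def by (simp only: mult_ac)
    then show "fourier_laplace (\<lambda>x. ctranspose a \<alpha> * ((- \<i>) ^ mi_order \<alpha> * mpd \<alpha> w x)) \<zeta>
        = a \<alpha> * (\<Prod>i\<in>UNIV. (\<zeta> $ i) ^ \<alpha> i) * fourier_laplace w \<zeta>"
      by (simp only: one mult_1_left)
  qed
  finally show ?thesis by (simp add: cpoly_def sum_distrib_right)
qed

lemma cdot_diff_right: "cdot \<zeta> (x - y) = cdot \<zeta> x - cdot \<zeta> y"
  by (simp add: cdot_def right_diff_distrib sum_subtractf)

lemma cdot_circle_point: "cdot (circle_point m a \<xi> z) x = of_real (\<xi> \<bullet> x) + z * cdot (cycle_dir m a \<xi>) x"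
  by (simp add: cdot_def circle_point_def ring_distribs sum.distrib sum_distrib_left inner_vec_def mult.assoc)

text \<open>
  The function \<open>\<zeta> \<mapsto> e\<^sup>-\<^sup>i\<^sup>\<zeta>\<^sup>x F w(\<zeta>)\<close> is a superposition of exponentials \<open>e\<^sup>i\<^sup>\<zeta>\<^sup>(\<^sup>y\<^sup>-\<^sup>x\<^sup>)\<close>, each of which has
  the mean value property on the circle around \<open>\<xi>\<close>.
\<close>

lemma circle_mean_fourier_laplace:
  fixes w :: "'n::finite cfun"
  assumes w: "w \<in> C_infinity_on K" and K: "compact K" and nz: "nonzero_coeffs m a"
  shows "(LINT t|lborel. indicator {0..1} t *\<^sub>R (exp (- \<i> * cdot (cycle m a (\<xi>, t)) x) * fourier_laplace w (cycle m a (\<xi>, t))))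
    = exp (- \<i> * of_real (\<xi> \<bullet> x)) * fourier_laplace w (cvec \<xi>)"
proof -
  define Z where "Z t = cycle m a (\<xi>, t)" for t
  define r where "r = real (radius m a \<xi>)"
  have "0 < r" using radius_ge_1[OF nz, of \<xi>] by (simp add: r_def)
  have [measurable]: "w \<in> borel_measurable borel" by (rule C_infinity_on_measurable[OF w])
  have mZ [measurable]: "Z \<in> borel_measurable borel"
    unfolding Z_def using measurable_compose[OF measurable_Pair1' measurable_cycle, of \<xi>]
    by (simp add: space_pair_measure)
  have iw: "integrable lborel w"
    using integrable_fourier[OF w K, of 0] by (simp add: cdot_def)
  obtain R where R: "K \<subseteq> cball 0 R" using compact_subset_cball_0[OF K] by blast
  define E where "E = exp (real CARD('n) * real (Suc m) * (R + norm x))"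
  define F where "F p = indicator {0..1} (fst p) *\<^sub>R (w (snd p) * exp (\<i> * cdot (Z (fst p)) (snd p - x)))" for p :: "real \<times> (real ^ 'n)"
  have mF [measurable]: "F \<in> borel_measurable (lborel \<Otimes>\<^sub>M lborel)" unfolding F_def by measurable
  have nF: "norm (F p) \<le> indicator {0..1} (fst p) * (E * cmod (w (snd p)))" for p
  proof (cases "snd p \<in> K")
    case True
    then have "norm (snd p) \<le> R" using R by auto
    then have "norm (snd p - x) \<le> R + norm x" using norm_triangle_ineq4[of "snd p" x] by linarith
    from norm_exp_cdot_le[OF Im_cycle_le[OF nz] this, of "(\<xi>, fst p)"]
    have "cmod (w (snd p)) * cmod (exp (\<i> * cdot (Z (fst p)) (snd p - x))) \<le> cmod (w (snd p)) * E"
      unfolding Z_def E_def by (intro mult_left_mono) auto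
    then show ?thesis by (simp add: F_def norm_mult indicator_def mult.commute)
  next
    case False
    then have "w (snd p) = 0" using w outside_tsupp by (auto simp: C_infinity_on_def)
    then show ?thesis by (simp add: F_def)
  qed
  have iF: "integrable (lborel \<Otimes>\<^sub>M lborel) F"
  proof (rule Bochner_Integration.integrable_bound[OF _ mF])
    show "integrable (lborel \<Otimes>\<^sub>M lborel) (\<lambda>p :: real \<times> (real ^ 'n). indicator {0..1} (fst p) * (E * cmod (w (snd p))) :: real)"
      by (intro integrable_lborel_pair_mult integrable_mult_right integrable_norm iw) auto
    show "AE p :: real \<times> (real ^ 'n) in lborel \<Otimes>\<^sub>M lborel. norm (F p) \<le> norm (indicator {0..1} (fst p) * (E * cmod (w (snd p))) :: real)"
      using nF by (intro AE_I2) (metis abs_ge_self order_trans real_norm_def)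
  qed
  have "(LINT t|lborel. indicator {0..1} t *\<^sub>R (exp (- \<i> * cdot (Z t) x) * fourier_laplace w (Z t)))
      = (LINT t|lborel. (LINT y|lborel. F (t, y)))"
  proof (rule Bochner_Integration.integral_cong[OF refl])
    fix t
    have "F (t, y) = (indicator {0..1} t *\<^sub>R exp (- \<i> * cdot (Z t) x)) * (w y * exp (\<i> * cdot (Z t) y))" for y
    proof -
      have "exp (\<i> * cdot (Z t) (y - x)) = exp (- \<i> * cdot (Z t) x) * exp (\<i> * cdot (Z t) y)"
        by (simp add: cdot_diff_right mult_exp_exp algebra_simps)
      then show ?thesis by (simp add: F_def mult_ac)
    qed
    then show "indicator {0..1} t *\<^sub>R (exp (- \<i> * cdot (Z t) x) * fourier_laplace w (Z t)) = (LINT y|lborel. F (t, y))"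
      unfolding fourier_laplace_def by (simp only: integral_mult_right_zero) (simp only: mult_scaleR_left)
  qed
  also have "\<dots> = (LINT y|lborel. (LINT t|lborel. F (t, y)))"
    using lborel_pair.Fubini_integral[of "\<lambda>t y. F (t, y)"] iF by simp
  also have "\<dots> = (LINT y|lborel. exp (- \<i> * of_real (\<xi> \<bullet> x)) * (w y * exp (\<i> * cdot (cvec \<xi>) y)))"
  proof (rule Bochner_Integration.integral_cong[OF refl])
    fix y
    define b where "b = \<i> * cdot (cycle_dir m a \<xi>) (y - x)"
    have "F (t, y) = (w y * exp (\<i> * of_real (\<xi> \<bullet> (y - x)))) *
        (indicator {0..1} t *\<^sub>R exp (b * (of_real r * exp (2 * of_real pi * \<i> * of_real t))))" for t
    proof -
      have "\<i> * cdot (Z t) (y - x) = \<i> * of_real (\<xi> \<bullet> (y - x)) + b * (of_real r * exp (2 * of_real pi * \<i> * of_real t))"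
        by (simp add: Z_def cycle_def cdot_circle_point b_def r_def circle_param_def ring_distribs mult_ac)
      then show ?thesis by (simp add: F_def exp_add)
    qed
    then have "(LINT t|lborel. F (t, y)) = w y * exp (\<i> * of_real (\<xi> \<bullet> (y - x)))"
      using circle_mean_exp[OF \<open>0 < r\<close>, of b] by (simp only: integral_mult_right_zero mult_1_right)
    also have "exp (\<i> * of_real (\<xi> \<bullet> (y - x))) = exp (- \<i> * of_real (\<xi> \<bullet> x)) * exp (\<i> * cdot (cvec \<xi>) y)"
      by (simp add: cdot_cvec mult_exp_exp inner_diff_right algebra_simps)
    finally show "(LINT t|lborel. F (t, y)) = exp (- \<i> * of_real (\<xi> \<bullet> x)) * (w y * exp (\<i> * cdot (cvec \<xi>) y))"
      by (simp only: mult_ac)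
  qed
  also have "\<dots> = exp (- \<i> * of_real (\<xi> \<bullet> x)) * fourier_laplace w (cvec \<xi>)"
    by (simp only: integral_mult_right_zero fourier_laplace_def)
  finally show ?thesis by (simp only: Z_def)
qed

text \<open>
  The symbol cancels, the circle means collapse to their real centres, and Fourier inversion applies.
\<close>

theorem sol_cdiff_op:
  fixes w :: "'n::finite cfun"
  assumes w: "w \<in> C_infinity_on K" and K: "compact K" and nz: "nonzero_coeffs m a"
  shows "sol m a (cdiff_op m (ctranspose a) w) = w"
proof
  fix x
  let ?c = "complex_of_real (1 / (2 * pi) ^ CARD('n))"
  from nz obtain \<alpha> where \<alpha>: "mi_order \<alpha> \<le> m" "a \<alpha> \<noteq> 0" by (auto simp: nonzero_coeffs_def)
  define G where "G p = exp (- \<i> * cdot (cycle m a p) x) * sol_density m a (cdiff_op m (ctranspose a) w) p" for p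
  have iG: "integrable (lborel \<Otimes>\<^sub>M lborel) G"
    unfolding G_def by (rule integrable_sol[OF C_infinity_on_cdiff_op[OF w K] K])
  have G: "G p = ?c * (indicator {0..1} (snd p) *\<^sub>R (exp (- \<i> * cdot (cycle m a p) x) * fourier_laplace w (cycle m a p)))" for p
    using inverse_symbol_le(1)[where a = a, OF \<alpha>]
    by (simp add: G_def sol_density_def fourier_laplace_cdiff_op[OF w K] scaleR_conv_of_real divide_inverse mult_ac)
  have "sol m a (cdiff_op m (ctranspose a) w) x = (LINT \<xi>|lborel. (LINT t|lborel. G (\<xi>, t)))"
    unfolding sol_def G_def[symmetric] using lborel_pair.integral_fst'[OF iG] by simp
  also have "\<dots> = ?c * (LINT \<xi>|lborel. exp (- \<i> * of_real (\<xi> \<bullet> x)) * fourier_laplace w (cvec \<xi>))"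
    unfolding G integral_mult_right_zero snd_conv circle_mean_fourier_laplace[OF assms] ..
  also have "\<dots> = w x" unfolding fourier_inversion[OF w K] by simp
  finally show "sol m a (cdiff_op m (ctranspose a) w) x = w x" .
qed

text \<open>
A left inverse that commutes with derivatives is a right inverse.
\<close>

theorem cdiff_op_sol:
  assumes w: "w \<in> C_infinity_on K" and K: "compact K" and nz: "nonzero_coeffs m a"
  shows "cdiff_op m (ctranspose a) (sol m a w) = w"
proof -
  have "cdiff_op m (ctranspose a) (sol m a w)
      = (\<lambda>x. \<Sum>\<alpha> | mi_order \<alpha> \<le> m. sol m a (\<lambda>x. ctranspose a \<alpha> * ((- \<i>) ^ mi_order \<alpha> * mpd \<alpha> w x)) x)"
    by (simp only: cdiff_op_def[abs_def] mpd_sol[OF w K] sol_cmult)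
  also have "\<dots> = sol m a (cdiff_op m (ctranspose a) w)"
    unfolding cdiff_op_def[abs_def] using compact_imp_closed[OF K]
    by (intro sol_sum[symmetric] C_infinity_on_cmult C_infinity_on_mpd) (auto simp: w K)
  finally show ?thesis by (simp only: sol_cdiff_op[OF assms])
qed

section \<open>Products and cutoff functions\<close>

text \<open>
  The functions \<open>p(1/t) e\<^sup>-\<^sup>1\<^sup>/\<^sup>t\<close>, extended by \<open>0\<close> to \<open>t \<le> 0\<close>.  Allowing an arbitrary
  polynomial \<open>p\<close> makes the family closed under differentiation.
\<close>

definition bump :: "real poly \<Rightarrow> real \<Rightarrow> real" where
  "bump p t = (if 0 < t then poly p (1 / t) * exp (- (1 / t)) else 0)"

definition bump_deriv :: "real poly \<Rightarrow> real poly" where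
  "bump_deriv p = [:0, 0, 1:] * (p - pderiv p)"

lemma poly_over_exp_tendsto_0: "((\<lambda>y. poly p y * exp (- y)) \<longlongrightarrow> (0 :: real)) at_top"
proof -
  have "((\<lambda>y. \<Sum>i\<le>degree p. coeff p i * (y ^ i / exp y)) \<longlongrightarrow> (\<Sum>i\<le>degree p. coeff p i * 0)) at_top"
    by (intro tendsto_sum tendsto_mult tendsto_const tendsto_power_div_exp_0)
  then show ?thesis by (simp add: poly_altdef sum_distrib_right exp_minus divide_inverse mult.assoc)
qed

lemma bump_over_identity_tendsto_0: "((\<lambda>h. bump p h / h) \<longlongrightarrow> 0) (at 0)"
proof -
  have "((\<lambda>h. poly (pCons 0 p) (inverse h) * exp (- inverse h)) \<longlongrightarrow> (0::real)) (at_right 0)"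
    by (rule filterlim_compose[OF poly_over_exp_tendsto_0 filterlim_inverse_at_top_right])
  moreover have "eventually (\<lambda>h. poly (pCons 0 p) (inverse h) * exp (- inverse h) = bump p h / h) (at_right (0::real))"
    using eventually_at_right_less[of "0::real"]
    by eventually_elim (simp add: bump_def divide_inverse mult_ac)
  ultimately have "((\<lambda>h. bump p h / h) \<longlongrightarrow> 0) (at_right 0)"
    by (rule Lim_transform_eventually)
  moreover have "((\<lambda>h. bump p h / h) \<longlongrightarrow> 0) (at_left 0)"
  proof (rule Lim_transform_eventually)
    show "eventually (\<lambda>h. 0 = bump p h / h) (at_left (0::real))"
      unfolding eventually_at_filter by (rule always_eventually) (simp add: bump_def)
  qed simp
  ultimately show ?thesis by (simp add: filterlim_at_split)
qed

lemma bump_has_derivative: "(bump p has_real_derivative bump (bump_deriv p) t) (at t)"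
proof (cases t "0 :: real" rule: linorder_cases)
  case less
  have "((\<lambda>_. 0) has_real_derivative 0) (at t)" by simp
  then have "(bump p has_real_derivative 0) (at t)"
    by (rule has_field_derivative_transform_within_open[where S = "{..<0}"]) (use less in \<open>auto simp: bump_def\<close>)
  then show ?thesis using less by (simp add: bump_def)
next
  case equal
  have "((\<lambda>h. (bump p (0 + h) - bump p 0) / h) \<longlongrightarrow> 0) (at 0)"
    using bump_over_identity_tendsto_0[of p] by (simp add: bump_def[of p 0])
  then show ?thesis using equal by (simp add: DERIV_def bump_def[of "bump_deriv p" 0])
next
  case greater
  have "((\<lambda>t. poly p (1 / t) * exp (- (1 / t))) has_real_derivative
      poly p (1 / t) * (exp (- (1 / t)) * (1 / t\<^sup>2)) + poly (pderiv p) (1 / t) * (- (1 / t\<^sup>2)) * exp (- (1 / t))) (at t)"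
    using greater by (auto intro!: derivative_eq_intros DERIV_chain'[where g = "poly p", OF _ poly_DERIV] simp: power2_eq_square divide_simps)
  also have "poly p (1 / t) * (exp (- (1 / t)) * (1 / t\<^sup>2)) + poly (pderiv p) (1 / t) * (- (1 / t\<^sup>2)) * exp (- (1 / t))
      = bump (bump_deriv p) t"
    using greater by (simp add: bump_def bump_deriv_def power2_eq_square field_simps)
  finally have "((\<lambda>t. poly p (1 / t) * exp (- (1 / t))) has_real_derivative bump (bump_deriv p) t) (at t)" .
  then show ?thesis
    by (rule has_field_derivative_transform_within_open[where S = "{0<..}"]) (use greater in \<open>auto simp: bump_def\<close>)
qed

lemma partial_deriv_mult:
  assumes "\<And>x. f differentiable at x" "\<And>x. g differentiable at x"
  shows "partial_deriv i (\<lambda>x. f x * g x) = (\<lambda>x. f x * partial_deriv i g x + partial_deriv i f x * g x)"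
proof
  fix x
  have "((\<lambda>x. f x * g x) has_derivative
      (\<lambda>h. f x * frechet_derivative g (at x) h + frechet_derivative f (at x) h * g x)) (at x)"
    using assms by (intro has_derivative_mult) (auto simp: frechet_derivative_works)
  from partial_deriv_eqI[OF this, of i]
  show "partial_deriv i (\<lambda>x. f x * g x) x = f x * partial_deriv i g x + partial_deriv i f x * g x"
    by (simp add: partial_deriv_def[of i f] partial_deriv_def[of i g])
qed

text \<open>
  A class of functions that is visibly closed under partial derivatives and consists of differentiable functions;
  all its members are therefore smooth.  It contains products and quotients, whose smoothness is awkward to obtain
  from the recursive definition directly, and radial bump functions.
\<close>

inductive smooth_closure :: "'n::finite cfun \<Rightarrow> bool" where
  base: "smooth f \<Longrightarrow> smooth_closure f"
| add: "smooth_closure f \<Longrightarrow> smooth_closure g \<Longrightarrow> smooth_closure (\<lambda>x. f x + g x)"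
| mult: "smooth_closure f \<Longrightarrow> smooth_closure g \<Longrightarrow> smooth_closure (\<lambda>x. f x * g x)"
| inverse: "smooth_closure f \<Longrightarrow> (\<And>x. f x \<noteq> 0) \<Longrightarrow> smooth_closure (\<lambda>x. inverse (f x))"
| radial: "smooth_closure (\<lambda>x. of_real (bump p (s + d * (x \<bullet> x))))"

lemma smooth_closure_derivative:
  fixes f :: "'n::finite cfun"
  shows "smooth_closure f \<Longrightarrow> (\<forall>x. f differentiable at x) \<and> smooth_closure (partial_deriv i f)"
proof (induction rule: smooth_closure.induct)
  case (base f)
  then show ?case using smoothD[of f "[]"] by (auto intro: smooth_closure.base smooth_partial_deriv)
next
  case (add f g)
  then show ?case by (auto simp: partial_deriv_add intro: smooth_closure.add)
next
  case (mult f g)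
  then show ?case
    by (auto simp: partial_deriv_mult intro!: smooth_closure.add smooth_closure.mult differentiable_mult)
next
  case (inverse f)
  have d: "((\<lambda>x. inverse (f x)) has_derivative
      (\<lambda>h. - (inverse (f x) * frechet_derivative f (at x) h * inverse (f x)))) (at x)" for x
    using inverse by (intro Deriv.has_derivative_inverse) (auto simp: frechet_derivative_works)
  have "partial_deriv i (\<lambda>x. inverse (f x)) = (\<lambda>x. (-1) * ((inverse (f x) * inverse (f x)) * partial_deriv i f x))"
    using partial_deriv_eqI[OF d, of i] by (simp add: fun_eq_iff partial_deriv_def[of i f])
  moreover have "smooth_closure (\<lambda>x. (-1) * ((inverse (f x) * inverse (f x)) * partial_deriv i f x))"
    using inverse poly_fun_smooth[OF poly_fun.const[of "-1"]]
    by (intro smooth_closure.mult smooth_closure.inverse) (auto intro: smooth_closure.base)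
  ultimately show ?case using d differentiable_def by auto
next
  case (radial p s d)
  let ?q = "\<lambda>x :: real ^ 'n. s + d * (x \<bullet> x)"
  have dq: "(?q has_derivative (\<lambda>h. d * (x \<bullet> h + h \<bullet> x))) (at x)" for x
    by (auto intro!: derivative_eq_intros)
  have D: "((\<lambda>x. complex_of_real (bump p (?q x))) has_derivative
      (\<lambda>h. of_real ((d * (x \<bullet> h + h \<bullet> x)) *\<^sub>R bump (bump_deriv p) (?q x)))) (at x)" for x
  proof (rule bounded_linear.has_derivative[OF bounded_linear_of_real])
    have "(bump p has_vector_derivative bump (bump_deriv p) (?q x)) (at (?q x))"
      using bump_has_derivative by (simp add: has_real_derivative_iff_has_vector_derivative)
    then show "((\<lambda>x. bump p (?q x)) has_derivative (\<lambda>h. (d * (x \<bullet> h + h \<bullet> x)) *\<^sub>R bump (bump_deriv p) (?q x))) (at x)"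
      unfolding has_vector_derivative_def by (rule has_derivative_compose[OF dq, unfolded o_def])
  qed
  have "partial_deriv i (\<lambda>x. complex_of_real (bump p (?q x)))
      = (\<lambda>x. (of_real (2 * d) * of_real (x $ i)) * of_real (bump (bump_deriv p) (?q x)))"
    using partial_deriv_eqI[OF D, of i]
    by (simp add: fun_eq_iff inner_axis inner_axis' mult_ac)
  moreover have "poly_fun (\<lambda>x :: real ^ 'n. of_real (2 * d) * of_real (x $ i))"
    by (intro poly_fun.intros)
  ultimately have "smooth_closure (partial_deriv i (\<lambda>x. complex_of_real (bump p (?q x))))"
    using smooth_closure.mult[OF smooth_closure.base[OF poly_fun_smooth] smooth_closure.radial] by simp
  then show ?case using D differentiable_def by blast
qed

lemma smooth_closure_smooth:
  assumes "smooth_closure f"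
  shows "smooth f"
proof -
  have "smooth_closure (foldr partial_deriv is f)" for "is"
    by (induction "is") (simp_all add: assms smooth_closure_derivative)
  then show ?thesis using smooth_closure_derivative by (auto simp: smooth_def)
qed

lemma smooth_mult: "smooth f \<Longrightarrow> smooth g \<Longrightarrow> smooth (\<lambda>x. f x * g x)"
  by (rule smooth_closure_smooth[OF smooth_closure.mult[OF smooth_closure.base smooth_closure.base]])

text \<open>
  With \<open>f\<close> positive exactly for \<open>\<bar>x\<bar> < R + 1\<close> and \<open>g\<close> positive exactly for \<open>\<bar>x\<bar> > R\<close>, the quotient
  \<open>f / (f + g)\<close> is a cutoff function.
\<close>

lemma cutoff_exists:
  fixes K :: "(real ^ 'n::finite) set"
  assumes "compact K"
  obtains cf :: "'n cfun" and U K'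
  where "smooth cf" "open U" "K \<subseteq> U" "\<And>x. x \<in> U \<Longrightarrow> cf x = 1" "compact K'" "U \<subseteq> K'" "\<And>x. x \<notin> K' \<Longrightarrow> cf x = 0"
proof -
  obtain R0 where R0: "K \<subseteq> cball 0 R0" using compact_subset_cball_0[OF assms] by blast
  define R where "R = max R0 0 + 1"
  have "R > 0" by (simp add: R_def)
  have KR: "K \<subseteq> ball 0 R" using R0 by (auto simp: R_def)
  define f where "f x = complex_of_real (bump 1 ((R + 1)\<^sup>2 + (-1) * (x \<bullet> x)))" for x :: "real ^ 'n"
  define g where "g x = complex_of_real (bump 1 (- R\<^sup>2 + 1 * (x \<bullet> x)))" for x :: "real ^ 'n"
  define cf where "cf x = f x * inverse (f x + g x)" for x
  have b: "bump 1 t = (if 0 < t then exp (- (1 / t)) else 0)" for t by (simp add: bump_def)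
  have bn: "0 \<le> bump 1 t" and bp: "0 < t \<Longrightarrow> 0 < bump 1 t" for t by (auto simp: b)
  have nz: "f x + g x \<noteq> 0" for x
  proof -
    have "R\<^sup>2 < (R + 1)\<^sup>2" using \<open>R > 0\<close> by (simp add: power2_eq_square algebra_simps)
    then have "0 < (R + 1)\<^sup>2 + (-1) * (x \<bullet> x) \<or> 0 < - R\<^sup>2 + 1 * (x \<bullet> x)" by linarith
    then have "0 < bump 1 ((R + 1)\<^sup>2 + (-1) * (x \<bullet> x)) + bump 1 (- R\<^sup>2 + 1 * (x \<bullet> x))"
      using bn bp by (meson add_nonneg_pos add_pos_nonneg)
    then show ?thesis unfolding f_def g_def of_real_add[symmetric] of_real_eq_0_iff by linarith
  qed
  have "smooth cf"
    unfolding cf_def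
    by (intro smooth_closure_smooth smooth_closure.mult smooth_closure.inverse smooth_closure.add nz)
      (unfold f_def g_def, (rule smooth_closure.radial)+)
  moreover have "cf x = 1" if "x \<in> ball 0 R" for x
  proof -
    have "(norm x)\<^sup>2 < R\<^sup>2" using that by (intro power_strict_mono) auto
    then have "g x = 0" by (simp add: g_def b dot_square_norm)
    then show ?thesis using nz[of x] by (simp add: cf_def)
  qed
  moreover have "cf x = 0" if "x \<notin> cball 0 (R + 1)" for x
  proof -
    have "(R + 1)\<^sup>2 < (norm x)\<^sup>2" using that \<open>R > 0\<close> by (intro power_strict_mono) auto
    then have "f x = 0" by (simp add: f_def b dot_square_norm)
    then show ?thesis by (simp add: cf_def)
  qed
  moreover have "ball 0 R \<subseteq> cball 0 (R + 1 :: real)" by auto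
  ultimately show ?thesis using that[of cf "ball 0 R" "cball 0 (R + 1)"] KR by auto
qed

subsection \<open>Derivatives of products\<close>

text \<open>
  A pointwise bound for all derivatives up to order \<open>k\<close>.  It turns the Leibniz rule into a
  submultiplicative estimate without multinomial coefficients.
\<close>

definition jet_norm :: "nat \<Rightarrow> 'n::finite cfun \<Rightarrow> real ^ 'n \<Rightarrow> real" where
  "jet_norm k f x = (\<Sum>\<beta> | mi_order \<beta> \<le> k. cmod (mpd \<beta> f x))"

lemma jet_norm_nonneg: "0 \<le> jet_norm k f x"
  by (simp add: jet_norm_def sum_nonneg)

lemma jet_norm_mono: "k \<le> l \<Longrightarrow> jet_norm k f x \<le> jet_norm l f x"
  unfolding jet_norm_def by (intro sum_mono2 finite_mi_order) auto

lemma norm_le_jet_norm: "cmod (f x) \<le> jet_norm k f x"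
proof -
  have "cmod (mpd (\<lambda>_. 0) f x) \<le> jet_norm k f x"
    unfolding jet_norm_def by (rule member_le_sum[OF _ _ finite_mi_order]) (auto simp: mi_order_def)
  then show ?thesis by (simp add: mpd_zero_index)
qed

lemma jet_norm_partial_deriv:
  fixes f :: "'n::finite cfun"
  assumes "smooth f"
  shows "jet_norm k (partial_deriv i f) x \<le> jet_norm (Suc k) f x"
proof -
  define s where "s \<beta> = (\<lambda>j. \<beta> j + (if j = i then 1 else 0))" for \<beta> :: "'n \<Rightarrow> nat"
  have "partial_deriv i f = mpd (\<lambda>j. if j = i then 1 else 0) f"
    using mpd_replicate[OF assms, of 1 i] by simp
  then have m: "mpd \<beta> (partial_deriv i f) = mpd (s \<beta>) f" for \<beta>
    using mpd_mpd[OF assms] by (simp add: s_def)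
  have order_s: "mi_order (s \<beta>) = Suc (mi_order \<beta>)" for \<beta>
    unfolding s_def mi_order_add by (simp add: mi_order_def)
  have inj: "inj_on s A" for A by (auto simp: inj_on_def s_def fun_eq_iff)
  have "jet_norm k (partial_deriv i f) x = (\<Sum>\<gamma>\<in>s ` {\<beta>. mi_order \<beta> \<le> k}. cmod (mpd \<gamma> f x))"
    unfolding jet_norm_def m by (subst sum.reindex[OF inj]) simp
  also have "\<dots> \<le> jet_norm (Suc k) f x"
    unfolding jet_norm_def
    by (intro sum_mono2 finite_mi_order) (auto simp: order_s)
  finally show ?thesis .
qed

lemma foldr_partial_deriv_mult_le:
  assumes "smooth f" "smooth g"
  shows "cmod (foldr partial_deriv is (\<lambda>x. f x * g x) x)
    \<le> 2 ^ length is * (jet_norm (length is) f x * jet_norm (length is) g x)"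
  using assms
proof (induction "is" arbitrary: f g rule: rev_induct)
  case Nil
  then show ?case using mult_mono[OF norm_le_jet_norm norm_le_jet_norm] by (simp add: norm_mult jet_norm_nonneg)
next
  case (snoc i "is")
  let ?k = "length is" and ?J = "\<lambda>k f. jet_norm k f x"
  have d: "f differentiable at x" "g differentiable at x" for x
    using smoothD[OF snoc.prems(1), of "[]"] smoothD[OF snoc.prems(2), of "[]"] by auto
  have "foldr partial_deriv (is @ [i]) (\<lambda>x. f x * g x) x
      = foldr partial_deriv is (\<lambda>x. f x * partial_deriv i g x) x + foldr partial_deriv is (\<lambda>x. partial_deriv i f x * g x) x"
    using snoc.prems d
    by (simp add: partial_deriv_mult foldr_partial_deriv_add smooth_mult smooth_partial_deriv)
  also have "cmod \<dots> \<le> 2 ^ ?k * (?J ?k f * ?J ?k (partial_deriv i g)) + 2 ^ ?k * (?J ?k (partial_deriv i f) * ?J ?k g)"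
    by (intro norm_triangle_le add_mono snoc.IH smooth_partial_deriv snoc.prems)
  also have "\<dots> \<le> 2 ^ ?k * (?J (Suc ?k) f * ?J (Suc ?k) g) + 2 ^ ?k * (?J (Suc ?k) f * ?J (Suc ?k) g)"
    by (intro add_mono mult_left_mono mult_mono jet_norm_partial_deriv jet_norm_mono snoc.prems jet_norm_nonneg) auto
  finally show ?case by (simp add: mult_ac)
qed

lemma mpd_mult_le:
  fixes f g :: "'n::finite cfun"
  assumes "smooth f" "smooth g"
  shows "cmod (mpd \<alpha> (\<lambda>x. f x * g x) x) \<le> 2 ^ mi_order \<alpha> * (jet_norm (mi_order \<alpha>) f x * jet_norm (mi_order \<alpha>) g x)"
proof -
  obtain "is" where is': "\<forall>i. count_list is i = \<alpha> i" using ex_multiindex_list by blast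
  have "mi_order \<alpha> = sum (count_list is) UNIV" unfolding mi_order_def using is' by simp
  also have "\<dots> = length is" by (rule sum_count_set) auto
  finally have "mi_order \<alpha> = length is" .
  moreover have "mpd \<alpha> (\<lambda>x. f x * g x) = foldr partial_deriv is (\<lambda>x. f x * g x)"
    using is' assms by (intro mpd_eq smooth_mult) auto
  ultimately show ?thesis using foldr_partial_deriv_mult_le[OF assms, of "is" x] by simp
qed

lemma jet_norm_le_sup_norm:
  assumes "compact K" "smooth f" "x \<in> K"
  shows "jet_norm k f x \<le> (\<Sum>\<beta> | mi_order \<beta> \<le> k. sup_norm K (mpd \<beta> f))"
  unfolding jet_norm_def using assms
  by (intro sum_mono sup_norm_upper smooth_continuous_on smooth_mpd)

lemma sup_norm_mpd_mult_le:
  assumes "compact K" "smooth f" "smooth g"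
  shows "sup_norm K (mpd \<alpha> (\<lambda>x. f x * g x)) \<le> 2 ^ mi_order \<alpha> * (\<Sum>\<beta> | mi_order \<beta> \<le> mi_order \<alpha>. sup_norm K (mpd \<beta> f))
    * (\<Sum>\<beta> | mi_order \<beta> \<le> mi_order \<alpha>. sup_norm K (mpd \<beta> g))"
proof (rule sup_norm_least)
  have nn: "0 \<le> (\<Sum>\<beta> | mi_order \<beta> \<le> mi_order \<alpha>. sup_norm K (mpd \<beta> h))" if "smooth h" for h
    using that assms(1) by (intro sum_nonneg sup_norm_nonneg smooth_continuous_on smooth_mpd)
  then show "0 \<le> 2 ^ mi_order \<alpha> * (\<Sum>\<beta> | mi_order \<beta> \<le> mi_order \<alpha>. sup_norm K (mpd \<beta> f))
    * (\<Sum>\<beta> | mi_order \<beta> \<le> mi_order \<alpha>. sup_norm K (mpd \<beta> g))" using assms by simp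
  fix x assume "x \<in> K"
  have "cmod (mpd \<alpha> (\<lambda>x. f x * g x) x) \<le> 2 ^ mi_order \<alpha> * (jet_norm (mi_order \<alpha>) f x * jet_norm (mi_order \<alpha>) g x)"
    by (rule mpd_mult_le[OF assms(2,3)])
  also have "\<dots> \<le> 2 ^ mi_order \<alpha> * ((\<Sum>\<beta> | mi_order \<beta> \<le> mi_order \<alpha>. sup_norm K (mpd \<beta> f))
      * (\<Sum>\<beta> | mi_order \<beta> \<le> mi_order \<alpha>. sup_norm K (mpd \<beta> g)))"
    using \<open>x \<in> K\<close> assms nn by (intro mult_left_mono mult_mono jet_norm_le_sup_norm jet_norm_nonneg) auto
  finally show "cmod (mpd \<alpha> (\<lambda>x. f x * g x) x) \<le> 2 ^ mi_order \<alpha> * (\<Sum>\<beta> | mi_order \<beta> \<le> mi_order \<alpha>. sup_norm K (mpd \<beta> f))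
    * (\<Sum>\<beta> | mi_order \<beta> \<le> mi_order \<alpha>. sup_norm K (mpd \<beta> g))" by (simp only: mult.assoc)
qed

section \<open>Nets and their classes\<close>

lemma eventually_at_right_0_intro:
  "(\<And>e. 0 < e \<Longrightarrow> e \<le> 1 \<Longrightarrow> P e) \<Longrightarrow> eventually P (at_right (0::real))"
  using eventually_unit_interval by (auto elim!: eventually_mono)

lemma colombeau_eq_refl: "colombeau_eq u u \<longleftrightarrow> moderate_fnet u"
  by (simp add: colombeau_eq_def)

lemma abs_colombeau_eqI: "colombeau_eq u w \<Longrightarrow> abs_colombeau u = abs_colombeau w"
  by (rule Quotient3_rel_abs[OF Quotient3_colombeau])

lemma moderate_rep_colombeau: "moderate_fnet (rep_colombeau u)"
  using Quotient3_rep_reflp[OF Quotient3_colombeau] by (simp add: colombeau_eq_refl)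

lemma abs_rep_colombeau: "abs_colombeau (rep_colombeau u) = u"
  by (rule Quotient3_abs_rep[OF Quotient3_colombeau])

lemma gen_eq_refl: "gen_eq r r \<longleftrightarrow> moderate r"
  by (simp add: gen_eq_def)

lemma moderate_rep_gen: "moderate (rep_gen r)"
  using Quotient3_rep_reflp[OF Quotient3_gen] by (simp add: gen_eq_refl)

lemma abs_rep_gen: "abs_gen (rep_gen r) = r"
  by (rule Quotient3_abs_rep[OF Quotient3_gen])

lemma abs_gen_eqD:
  assumes "abs_gen r = abs_gen s" "moderate r" "moderate s"
  shows "negligible_net (\<lambda>e. r e - s e)"
proof -
  have "gen_eq r s" using Quotient3_rel[OF Quotient3_gen, of r s] assms by (simp add: gen_eq_refl)
  then show ?thesis by (simp add: gen_eq_def)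
qed

lemma abs_colombeau_add:
  "moderate_fnet u \<Longrightarrow> moderate_fnet w \<Longrightarrow> abs_colombeau u + abs_colombeau w = abs_colombeau (\<lambda>e x. u e x + w e x)"
  by (rule plus_colombeau.abs_eq) (simp_all add: colombeau_eq_refl)

lemma abs_colombeau_gscale:
  "moderate r \<Longrightarrow> moderate_fnet u \<Longrightarrow> gscale (abs_gen r) (abs_colombeau u) = abs_colombeau (\<lambda>e x. r e * u e x)"
  by (rule gscale.abs_eq) (simp_all add: colombeau_eq_refl gen_eq_refl)

lemma abs_colombeau_gD:
  "moderate_fnet u \<Longrightarrow> gD \<alpha> (abs_colombeau u) = abs_colombeau (\<lambda>e x. (- \<i>) ^ mi_order \<alpha> * mpd \<alpha> (u e) x)"
  by (rule gD.abs_eq) (simp_all add: colombeau_eq_refl)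

lemma abs_colombeau_sum:
  assumes "finite I" "\<And>i. i \<in> I \<Longrightarrow> moderate_fnet (f i)"
  shows "moderate_fnet (\<lambda>e x. \<Sum>i\<in>I. f i e x)
    \<and> (\<Sum>i\<in>I. abs_colombeau (f i)) = abs_colombeau (\<lambda>e x. \<Sum>i\<in>I. f i e x)"
  using assms
proof (induction I rule: finite_induct)
  case empty
  then show ?case by (simp add: zero_colombeau_def)
next
  case (insert i I)
  then show ?case by (simp add: abs_colombeau_add moderate_fnet_add)
qed

lemma negligible_net_eventually_0:
  assumes "eventually (\<lambda>e. r e = 0) (at_right 0)"
  shows "negligible_net r"
  by (rule negligible_net_bound[of _ "\<lambda>_. 0"]) (use assms in \<open>auto elim: eventually_mono\<close>)

lemma abs_colombeau_eventually_eq: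
  assumes "moderate_fnet u" "moderate_fnet w" "eventually (\<lambda>e. u e = w e) (at_right 0)"
  shows "abs_colombeau u = abs_colombeau w"
proof (rule abs_colombeau_eqI)
  have "negligible_net (\<lambda>e. sup_norm K (mpd \<alpha> (\<lambda>x. u e x - w e x)))" for K \<alpha>
    by (rule negligible_net_eventually_0) (use assms(3) in eventually_elim, simp)
  then show "colombeau_eq u w" using assms by (simp add: colombeau_eq_def negligible_fnet_def)
qed

lemma moderate_fnet_cdiff_op:
  assumes a: "\<And>\<alpha>. moderate (a \<alpha>)" and u: "moderate_fnet u"
  shows "moderate_fnet (\<lambda>e. cdiff_op m (\<lambda>\<alpha>. a \<alpha> e) (u e))"
    and "(\<And>\<alpha>. c \<alpha> = abs_gen (a \<alpha>)) \<Longrightarrow>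
      diff_op m c (abs_colombeau u) = abs_colombeau (\<lambda>e. cdiff_op m (\<lambda>\<alpha>. a \<alpha> e) (u e))"
proof -
  have 1: "moderate_fnet (\<lambda>e x. (- \<i>) ^ mi_order \<alpha> * mpd \<alpha> (u e) x)" for \<alpha>
    by (intro moderate_fnet_scale moderate_fnet_mpd u) simp
  have 2: "moderate_fnet (\<lambda>e x. a \<alpha> e * ((- \<i>) ^ mi_order \<alpha> * mpd \<alpha> (u e) x))" for \<alpha>
    by (rule moderate_fnet_scale[OF a 1])
  have sum: "moderate_fnet (\<lambda>e x. \<Sum>\<alpha> | mi_order \<alpha> \<le> m. a \<alpha> e * ((- \<i>) ^ mi_order \<alpha> * mpd \<alpha> (u e) x))
    \<and> (\<Sum>\<alpha> | mi_order \<alpha> \<le> m. abs_colombeau (\<lambda>e x. a \<alpha> e * ((- \<i>) ^ mi_order \<alpha> * mpd \<alpha> (u e) x)))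
      = abs_colombeau (\<lambda>e x. \<Sum>\<alpha> | mi_order \<alpha> \<le> m. a \<alpha> e * ((- \<i>) ^ mi_order \<alpha> * mpd \<alpha> (u e) x))"
    by (rule abs_colombeau_sum[OF finite_mi_order 2])
  then show "moderate_fnet (\<lambda>e. cdiff_op m (\<lambda>\<alpha>. a \<alpha> e) (u e))" by (simp add: cdiff_op_def[abs_def])
  assume c: "\<And>\<alpha>. c \<alpha> = abs_gen (a \<alpha>)"
  have "gscale (c \<alpha>) (gD \<alpha> (abs_colombeau u)) = abs_colombeau (\<lambda>e x. a \<alpha> e * ((- \<i>) ^ mi_order \<alpha> * mpd \<alpha> (u e) x))" for \<alpha>
    unfolding c abs_colombeau_gD[OF u] by (rule abs_colombeau_gscale[OF a 1])
  then show "diff_op m c (abs_colombeau u) = abs_colombeau (\<lambda>e. cdiff_op m (\<lambda>\<alpha>. a \<alpha> e) (u e))"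
    using sum by (simp add: diff_op_def cdiff_op_def[abs_def])
qed

subsection \<open>Estimates of nets in terms of seminorms\<close>

lemma sup_norm_mpd_le_seminorm:
  assumes "compact K" "smooth f" "mi_order \<alpha> \<le> j"
  shows "sup_norm K (mpd \<alpha> f) \<le> seminorm K j f"
  using assms by (intro sup_norm_least seminorm_upper seminorm_nonneg)

lemma bigo_seminorm:
  assumes "compact K" "smooth_fnet u"
    and "\<And>\<beta>. mi_order \<beta> \<le> j \<Longrightarrow> (\<lambda>e. sup_norm K (mpd \<beta> (u e))) \<in> O[at_right 0](g)"
  shows "(\<lambda>e. seminorm K j (u e)) \<in> O[at_right 0](g)"
proof (rule bigo_bound)
  show "(\<lambda>e. \<Sum>\<beta> | mi_order \<beta> \<le> j. sup_norm K (mpd \<beta> (u e))) \<in> O[at_right 0](g)"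
    using assms(3) by (intro big_sum_in_bigo) auto
  show "eventually (\<lambda>e. \<bar>seminorm K j (u e)\<bar> \<le> (\<Sum>\<beta> | mi_order \<beta> \<le> j. sup_norm K (mpd \<beta> (u e)))) (at_right 0)"
    using assms(1,2)
    by (intro eventually_at_right_0_intro) (simp add: smooth_fnet_def seminorm_nonneg seminorm_le_sum)
qed

lemma bigo_sup_norm:
  assumes "compact K" "smooth_fnet u" "mi_order \<alpha> \<le> j"
    and "(\<lambda>e. seminorm K j (u e)) \<in> O[at_right 0](g)"
  shows "(\<lambda>e. sup_norm K (mpd \<alpha> (u e))) \<in> O[at_right 0](g)"
proof (rule bigo_bound[OF _ assms(4)])
  show "eventually (\<lambda>e. \<bar>sup_norm K (mpd \<alpha> (u e))\<bar> \<le> seminorm K j (u e)) (at_right 0)"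
    using assms(1,2,3)
    by (intro eventually_at_right_0_intro) (simp add: smooth_fnet_def sup_norm_mpd_le_seminorm)
qed

lemma moderate_seminorm:
  assumes "moderate_fnet u" "compact K"
  shows "moderate (\<lambda>e. seminorm K j (u e))"
proof (rule moderate_bound)
  show "moderate (\<lambda>e. \<Sum>\<beta> | mi_order \<beta> \<le> j. sup_norm K (mpd \<beta> (u e)))"
    using assms by (intro moderate_sum) (simp add: moderate_fnet_def)
  show "eventually (\<lambda>e. norm (seminorm K j (u e)) \<le> (\<Sum>\<beta> | mi_order \<beta> \<le> j. sup_norm K (mpd \<beta> (u e)))) (at_right 0)"
    using assms
    by (intro eventually_at_right_0_intro) (simp add: moderate_fnet_def seminorm_nonneg seminorm_le_sum)
qed

lemma moderate_seminorm_bigo: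
  assumes "moderate_fnet u" "compact K"
  obtains N :: nat where "(\<lambda>e. seminorm K j (u e)) \<in> O[at_right 0](\<lambda>e. e powr - real N)"
  using moderate_seminorm[OF assms, of j] unfolding moderate_def by (auto simp: landau_o.big.norm_iff)

lemma negligible_seminorm_bigo:
  assumes "negligible_fnet u" "smooth_fnet u" "compact K"
  shows "(\<lambda>e. seminorm K j (u e)) \<in> O[at_right 0](\<lambda>e. e powr real q)"
  using assms by (intro bigo_seminorm) (auto simp: negligible_fnet_def negligible_net_def)

lemma bigo_cmult: "f \<in> O[F](g) \<Longrightarrow> (\<lambda>x. c * f x) \<in> O[F](g)" for c :: real
  by (cases "c = 0") auto

lemma moderate_fnetI:
  assumes "smooth_fnet u"
    and "\<And>K j. compact K \<Longrightarrow> \<exists>N::nat. (\<lambda>e. seminorm K j (u e)) \<in> O[at_right 0](\<lambda>e. e powr - real N)"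
  shows "moderate_fnet u"
  unfolding moderate_fnet_def
proof (intro conjI allI impI)
  fix K :: "(real ^ 'a) set" and \<alpha> :: "'a \<Rightarrow> nat" assume K: "compact K"
  from assms(2)[OF this, of "mi_order \<alpha>"] obtain N :: nat
    where "(\<lambda>e. seminorm K (mi_order \<alpha>) (u e)) \<in> O[at_right 0](\<lambda>e. e powr - real N)" by blast
  from bigo_sup_norm[OF K assms(1) order_refl this]
  show "moderate (\<lambda>e. sup_norm K (mpd \<alpha> (u e)))" by (auto simp: moderate_def)
qed (use assms(1) in \<open>simp add: smooth_fnet_def\<close>)

lemma negligible_fnetI:
  assumes "smooth_fnet u"
    and "\<And>K j q. compact K \<Longrightarrow> (\<lambda>e. seminorm K j (u e)) \<in> O[at_right 0](\<lambda>e. e powr real q)"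
  shows "negligible_fnet u"
  unfolding negligible_fnet_def negligible_net_def
  using bigo_sup_norm[OF _ assms(1) order_refl assms(2)] by auto

subsection \<open>Compactly supported representatives\<close>

definition test_net :: "(real ^ 'n::finite) set \<Rightarrow> 'n fnet \<Rightarrow> bool" where
  "test_net K u \<longleftrightarrow> (\<forall>e\<in>{0<..1}. u e \<in> C_infinity_on K)"

lemma test_net_smooth: "test_net K u \<Longrightarrow> smooth_fnet u"
  by (auto simp: test_net_def smooth_fnet_def C_infinity_on_def)

lemma test_net_mono: "test_net K u \<Longrightarrow> K \<subseteq> K' \<Longrightarrow> test_net K' u"
  by (fastforce simp: test_net_def C_infinity_on_def)

lemma vanishes_on_abs:
  "moderate_fnet u \<Longrightarrow> vanishes_on W (abs_colombeau u)
    \<longleftrightarrow> (\<forall>K \<alpha>. compact K \<and> K \<subseteq> W \<longrightarrow> negligible_net (\<lambda>e. sup_norm K (mpd \<alpha> (u e))))"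
  by (rule vanishes_on.abs_eq) (simp add: colombeau_eq_refl)

text \<open>
  Locally this is the definition of the support; by compactness finitely many of the vanishing regions suffice.
\<close>

lemma negligible_outside_gsupp:
  fixes u :: "'n::finite fnet"
  assumes u: "moderate_fnet u" and K: "compact K" "K \<inter> gsupp (abs_colombeau u) = {}"
  shows "negligible_net (\<lambda>e. sup_norm K (mpd \<alpha> (u e)))"
proof -
  have "\<exists>r>0. \<exists>W. cball x r \<subseteq> W \<and> vanishes_on W (abs_colombeau u)" if "x \<in> K" for x
  proof -
    from that K(2) obtain W where "open W" "vanishes_on W (abs_colombeau u)" "x \<in> W"
      by (auto simp: gsupp_def)
    then show ?thesis by (meson open_contains_cball)
  qed
  then obtain r W where r: "\<And>x. x \<in> K \<Longrightarrow> 0 < r x" "\<And>x. x \<in> K \<Longrightarrow> cball x (r x) \<subseteq> W x"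
    "\<And>x. x \<in> K \<Longrightarrow> vanishes_on (W x) (abs_colombeau u)" by metis
  have "K \<subseteq> (\<Union>x\<in>K. ball x (r x))" using r(1) by force
  then obtain F where F: "F \<subseteq> K" "finite F" "K \<subseteq> (\<Union>x\<in>F. ball x (r x))"
    using compactE_image[OF K(1), of K "\<lambda>x. ball x (r x)"] by (metis open_ball)
  define L where "L x = K \<inter> cball x (r x)" for x
  have cL: "compact (L x)" for x unfolding L_def by (intro compact_Int K compact_cball)
  have neg: "negligible_net (\<lambda>e. \<Sum>x\<in>F. sup_norm (L x) (mpd \<alpha> (u e)))"
  proof (rule negligible_net_sum)
    fix x assume "x \<in> F"
    then have "x \<in> K" using F by auto
    then have "L x \<subseteq> W x" using r(2) by (auto simp: L_def)
    then show "negligible_net (\<lambda>e. sup_norm (L x) (mpd \<alpha> (u e)))"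
      using r(3)[OF \<open>x \<in> K\<close>] cL unfolding vanishes_on_abs[OF u] by blast
  qed
  show ?thesis
  proof (rule negligible_net_bound[OF _ neg], rule eventually_at_right_0_intro)
    fix e :: real assume "0 < e" "e \<le> 1"
    then have sm: "smooth (u e)" using u by (simp add: moderate_fnet_def)
    then have c: "continuous_on S (mpd \<alpha> (u e))" for S by (intro smooth_continuous_on smooth_mpd)
    have "sup_norm K (mpd \<alpha> (u e)) \<le> (\<Sum>x\<in>F. sup_norm (L x) (mpd \<alpha> (u e)))"
    proof (rule sup_norm_least)
      show "0 \<le> (\<Sum>x\<in>F. sup_norm (L x) (mpd \<alpha> (u e)))" by (intro sum_nonneg sup_norm_nonneg cL c)
      fix y assume "y \<in> K"
      then obtain x where x: "x \<in> F" "y \<in> ball x (r x)" using F by blast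
      then have "y \<in> L x" using \<open>y \<in> K\<close> by (auto simp: L_def)
      then have "cmod (mpd \<alpha> (u e) y) \<le> sup_norm (L x) (mpd \<alpha> (u e))" by (intro sup_norm_upper cL c)
      also have "\<dots> \<le> (\<Sum>x\<in>F. sup_norm (L x) (mpd \<alpha> (u e)))"
        using x F by (intro member_le_sum sup_norm_nonneg cL c) auto
      finally show "cmod (mpd \<alpha> (u e) y) \<le> (\<Sum>x\<in>F. sup_norm (L x) (mpd \<alpha> (u e)))" .
    qed
    then show "norm (sup_norm K (mpd \<alpha> (u e))) \<le> (\<Sum>x\<in>F. sup_norm (L x) (mpd \<alpha> (u e)))"
      using K sm by simp
  qed
qed

lemma gsupp_abs_subset:
  assumes "moderate_fnet u" "test_net K u" "closed K"
  shows "gsupp (abs_colombeau u) \<subseteq> K"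
proof -
  have "negligible_net (\<lambda>e. sup_norm L (mpd \<alpha> (u e)))" if "L \<subseteq> - K" for L \<alpha>
  proof (rule negligible_net_eventually_0, rule eventually_at_right_0_intro)
    fix e :: real assume "0 < e" "e \<le> 1"
    then have "u e \<in> C_infinity_on K" using assms(2) by (simp add: test_net_def)
    then have "mpd \<alpha> (u e) x = 0" if "x \<in> L" for x
      using that \<open>L \<subseteq> - K\<close> C_infinity_on_mpd[OF _ assms(3)] C_infinity_on_outside by blast
    then have "insert 0 ((\<lambda>x. cmod (mpd \<alpha> (u e) x)) ` L) = {0}" by auto
    then show "sup_norm L (mpd \<alpha> (u e)) = 0" unfolding sup_norm_def by (metis cSup_singleton)
  qed
  then have "vanishes_on (- K) (abs_colombeau u)" unfolding vanishes_on_abs[OF assms(1)] by blast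
  then show ?thesis using assms(3) by (auto simp: gsupp_def)
qed

lemma closed_gsupp: "closed (gsupp u)"
  unfolding gsupp_def by (intro closed_Compl open_Union) auto

lemma abs_test_net_Gc:
  assumes "moderate_fnet u" "test_net K u" "compact K"
  shows "abs_colombeau u \<in> Gc"
proof -
  have "gsupp (abs_colombeau u) = K \<inter> gsupp (abs_colombeau u)"
    using gsupp_abs_subset[OF assms(1,2) compact_imp_closed[OF assms(3)]] by blast
  then show ?thesis unfolding Gc_def using compact_Int_closed[OF assms(3) closed_gsupp] by (metis mem_Collect_eq)
qed

text \<open>
  The net \<open>(cf - 1) u\<close> vanishes on \<open>U\<close>, and on the part of a compact set outside \<open>U\<close> it inherits
  negligibility from \<open>u\<close> by the Leibniz estimate.
\<close>

lemma cutoff_net: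
  fixes u :: "'n::finite fnet"
  assumes u: "moderate_fnet u" and supp: "gsupp (abs_colombeau u) \<subseteq> U"
    and cf: "smooth cf" "open U" "\<And>x. x \<in> U \<Longrightarrow> cf x = 1"
  shows "moderate_fnet (\<lambda>e x. cf x * u e x)"
    and "abs_colombeau (\<lambda>e x. cf x * u e x) = abs_colombeau u"
    and "regular_fnet u \<Longrightarrow> regular_fnet (\<lambda>e x. cf x * u e x)"
proof -
  have su: "smooth (u e)" if "0 < e" "e \<le> 1" for e using u that by (simp add: moderate_fnet_def)
  have bd: "eventually (\<lambda>e. norm (sup_norm K (mpd \<alpha> (\<lambda>x. f x * u e x))) \<le>
      2 ^ mi_order \<alpha> * (\<Sum>\<beta> | mi_order \<beta> \<le> mi_order \<alpha>. sup_norm K (mpd \<beta> f))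
        * (\<Sum>\<beta> | mi_order \<beta> \<le> mi_order \<alpha>. sup_norm K (mpd \<beta> (u e)))) (at_right 0)"
    if "compact K" "smooth f" for K \<alpha> f
  proof (rule eventually_at_right_0_intro)
    fix e :: real assume "0 < e" "e \<le> 1"
    from sup_norm_mpd_mult_le[OF that su[OF this], of \<alpha>]
    show "norm (sup_norm K (mpd \<alpha> (\<lambda>x. f x * u e x))) \<le>
      2 ^ mi_order \<alpha> * (\<Sum>\<beta> | mi_order \<beta> \<le> mi_order \<alpha>. sup_norm K (mpd \<beta> f))
        * (\<Sum>\<beta> | mi_order \<beta> \<le> mi_order \<alpha>. sup_norm K (mpd \<beta> (u e)))"
      using that smooth_mult[OF that(2) su[OF \<open>0 < e\<close> \<open>e \<le> 1\<close>]] by simp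
  qed
  have mod: "moderate_fnet (\<lambda>e x. f x * u e x)" if "smooth f" for f
    unfolding moderate_fnet_def
  proof (intro conjI allI impI ballI)
    show "smooth (\<lambda>x. f x * u e x)" if "e \<in> {0<..1}" for e
      using smooth_mult[OF \<open>smooth f\<close> su] that by simp
    show "moderate (\<lambda>e. sup_norm K (mpd \<alpha> (\<lambda>x. f x * u e x)))" if "compact K" for K \<alpha>
      using u that
      by (intro moderate_bound[OF bd[OF that \<open>smooth f\<close>]] moderate_mult moderate_sum) (auto simp: moderate_fnet_def)
  qed
  show m: "moderate_fnet (\<lambda>e x. cf x * u e x)" by (rule mod[OF cf(1)])
  define h where "h x = cf x - 1" for x
  have sh: "smooth h"
    unfolding h_def by (intro smooth_diff cf poly_fun_smooth poly_fun.const)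
  have "negligible_net (\<lambda>e. sup_norm K (mpd \<alpha> (\<lambda>x. h x * u e x)))" if K: "compact K" for K \<alpha>
  proof -
    define L where "L = K - U"
    have cL: "compact L" unfolding L_def by (rule compact_diff[OF K cf(2)])
    let ?B = "\<lambda>e. 2 ^ mi_order \<alpha> * (\<Sum>\<beta> | mi_order \<beta> \<le> mi_order \<alpha>. sup_norm L (mpd \<beta> h))
        * (\<Sum>\<beta> | mi_order \<beta> \<le> mi_order \<alpha>. sup_norm L (mpd \<beta> (u e)))"
    have negB: "negligible_net ?B"
    proof (rule negligible_net_mult)
      show "negligible_net (\<lambda>e. \<Sum>\<beta> | mi_order \<beta> \<le> mi_order \<alpha>. sup_norm L (mpd \<beta> (u e)))"
        using supp by (intro negligible_net_sum negligible_outside_gsupp[OF u cL]) (auto simp: L_def)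
    qed simp
    show ?thesis
    proof (rule negligible_net_bound[OF _ negB], use bd[OF cL sh, of \<alpha>] eventually_unit_interval in eventually_elim)
      fix e :: real
      assume e: "e \<in> {0<..1}" and le: "norm (sup_norm L (mpd \<alpha> (\<lambda>x. h x * u e x))) \<le> ?B e"
      have sm: "smooth (\<lambda>x. h x * u e x)" using smooth_mult[OF sh su] e by simp
      then have c: "continuous_on S (mpd \<alpha> (\<lambda>x. h x * u e x))" for S by (intro smooth_continuous_on smooth_mpd)
      have "sup_norm K (mpd \<alpha> (\<lambda>x. h x * u e x)) \<le> sup_norm L (mpd \<alpha> (\<lambda>x. h x * u e x))"
      proof (rule sup_norm_least)
        show "0 \<le> sup_norm L (mpd \<alpha> (\<lambda>x. h x * u e x))" by (rule sup_norm_nonneg[OF cL c])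
        fix x assume "x \<in> K"
        show "cmod (mpd \<alpha> (\<lambda>x. h x * u e x) x) \<le> sup_norm L (mpd \<alpha> (\<lambda>x. h x * u e x))"
        proof (cases "x \<in> U")
          case True
          have "mpd \<alpha> (\<lambda>x. h x * u e x) x = 0"
            unfolding mpd_def by (rule foldr_partial_deriv_vanish[OF cf(2) _ True]) (simp add: h_def cf(3))
          then show ?thesis using sup_norm_nonneg[OF cL c] by simp
        next
          case False
          then show ?thesis using \<open>x \<in> K\<close> by (intro sup_norm_upper cL c) (simp add: L_def)
        qed
      qed
      then show "norm (sup_norm K (mpd \<alpha> (\<lambda>x. h x * u e x))) \<le> ?B e"
        using le K cL sm by simp
    qed
  qed
  moreover have "(\<lambda>x. cf x * u e x - u e x) = (\<lambda>x. h x * u e x)" for e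
    by (simp add: h_def left_diff_distrib)
  ultimately have "colombeau_eq (\<lambda>e x. cf x * u e x) u"
    using m u by (simp add: colombeau_eq_def negligible_fnet_def)
  then show "abs_colombeau (\<lambda>e x. cf x * u e x) = abs_colombeau u" by (rule abs_colombeau_eqI)
  show "regular_fnet (\<lambda>e x. cf x * u e x)" if reg: "regular_fnet u"
    unfolding regular_fnet_def
  proof (intro allI impI)
    fix K :: "(real ^ 'n) set" assume K: "compact K"
    then obtain N :: nat where N: "\<And>\<alpha>. (\<lambda>e. sup_norm K (mpd \<alpha> (u e))) \<in> O[at_right 0](\<lambda>e. e powr - real N)"
      using reg unfolding regular_fnet_def by blast
    have "(\<lambda>e. sup_norm K (mpd \<alpha> (\<lambda>x. cf x * u e x))) \<in> O[at_right 0](\<lambda>e. e powr - real N)" for \<alpha>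
    proof (rule bigo_bound)
      show "eventually (\<lambda>e. \<bar>sup_norm K (mpd \<alpha> (\<lambda>x. cf x * u e x))\<bar> \<le>
          2 ^ mi_order \<alpha> * (\<Sum>\<beta> | mi_order \<beta> \<le> mi_order \<alpha>. sup_norm K (mpd \<beta> cf))
          * (\<Sum>\<beta> | mi_order \<beta> \<le> mi_order \<alpha>. sup_norm K (mpd \<beta> (u e)))) (at_right 0)"
        using bd[OF K cf(1)] by simp
      show "(\<lambda>e. 2 ^ mi_order \<alpha> * (\<Sum>\<beta> | mi_order \<beta> \<le> mi_order \<alpha>. sup_norm K (mpd \<beta> cf))
          * (\<Sum>\<beta> | mi_order \<beta> \<le> mi_order \<alpha>. sup_norm K (mpd \<beta> (u e)))) \<in> O[at_right 0](\<lambda>e. e powr - real N)"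
        by (intro bigo_cmult big_sum_in_bigo N)
    qed
    then show "\<exists>N::nat. \<forall>\<alpha>. (\<lambda>e. sup_norm K (mpd \<alpha> (\<lambda>x. cf x * u e x))) \<in> O[at_right 0](\<lambda>e. e powr - real N)" by blast
  qed
qed

text \<open>
  One compact set serves for all elements supported in \<open>K\<close>; continuity on \<open>GK K\<close> depends on this uniformity.
\<close>

lemma compact_representative:
  fixes K :: "(real ^ 'n::finite) set"
  assumes "compact K"
  shows "\<exists>K'. compact K' \<and> K \<subseteq> interior K' \<and> (\<forall>v. gsupp v \<subseteq> K \<longrightarrow>
    (\<exists>u. moderate_fnet u \<and> test_net K' u \<and> abs_colombeau u = v \<and> (v \<in> Ginf \<longrightarrow> regular_fnet u)))"
proof -
  obtain cf :: "'n cfun" and U K' where c: "smooth cf" "open U" "K \<subseteq> U" "\<And>x. x \<in> U \<Longrightarrow> cf x = 1"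
    "compact K'" "U \<subseteq> K'" "\<And>x. x \<notin> K' \<Longrightarrow> cf x = 0"
    using cutoff_exists[OF assms] by blast
  have "K \<subseteq> interior K'" using c(2,3,6) interior_maximal by blast
  moreover have "\<exists>u. moderate_fnet u \<and> test_net K' u \<and> abs_colombeau u = v \<and> (v \<in> Ginf \<longrightarrow> regular_fnet u)"
    if "gsupp v \<subseteq> K" for v
  proof -
    obtain r where r: "moderate_fnet r" "abs_colombeau r = v" "v \<in> Ginf \<longrightarrow> regular_fnet r"
    proof (cases "v \<in> Ginf")
      case True
      then show ?thesis using that unfolding Ginf_def by blast
    next
      case False
      then show ?thesis using that moderate_rep_colombeau abs_rep_colombeau by blast
    qed
    have "gsupp (abs_colombeau r) \<subseteq> U" using r(2) that c(3) by blast
    note cn = cutoff_net[OF r(1) this c(1,2,4)]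
    have "test_net K' (\<lambda>e x. cf x * r e x)"
      unfolding test_net_def using c r(1)
      by (auto intro!: C_infinity_onI smooth_mult compact_imp_closed simp: moderate_fnet_def)
    then show ?thesis using cn r by auto
  qed
  ultimately show ?thesis using c(5) by blast
qed

section \<open>The solution operator on generalized functions\<close>

text \<open>
  The form in which invertibility of the weight is used.  The index of the large coefficient may vary with
  \<open>e\<close>, so that the order of the operators need not stabilize.
\<close>

definition moderately_nonzero :: "nat \<Rightarrow> (('n::finite \<Rightarrow> nat) \<Rightarrow> real \<Rightarrow> complex) \<Rightarrow> bool" where
  "moderately_nonzero m a \<longleftrightarrow>
     (\<exists>N::nat. eventually (\<lambda>e. \<exists>\<alpha>. mi_order \<alpha> \<le> m \<and> e powr real N \<le> cmod (a \<alpha> e)) (at_right 0))"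

lemma eventually_powr_less:
  assumes "0 < \<delta>"
  shows "eventually (\<lambda>e. C * e powr real (Suc N) < \<delta> * e powr real N) (at_right 0)"
proof -
  have "eventually (\<lambda>e::real. e \<in> {0<..<\<delta> / (\<bar>C\<bar> + 1)}) (at_right 0)"
    by (rule eventually_at_right_real) (use assms in simp)
  then show ?thesis
  proof eventually_elim
    case (elim e)
    then have "0 < e" and lt: "e * (\<bar>C\<bar> + 1) < \<delta>" by (auto simp: pos_less_divide_eq)
    have "C * e \<le> e * (\<bar>C\<bar> + 1)" using \<open>0 < e\<close> mult_right_mono[of C "\<bar>C\<bar> + 1" e] by (simp add: mult.commute)
    then have "C * e < \<delta>" using lt by linarith
    then have "C * e * e powr real N < \<delta> * e powr real N" using \<open>0 < e\<close> by (intro mult_strict_right_mono) auto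
    moreover have "e powr real (Suc N) = e * e powr real N"
      using \<open>0 < e\<close> by (simp add: powr_add)
    ultimately show ?case by (simp add: mult.assoc)
  qed
qed

lemma gen_weight_abs: "gen_weight m c \<xi> = abs_gen (\<lambda>e. weight m (\<lambda>\<alpha>. rep_gen (c \<alpha>) e) \<xi>)"
  by (simp add: gen_weight_def)

lemma weight_le_coeffs:
  "\<exists>B>0. \<forall>a \<delta>. (\<forall>\<alpha>. mi_order \<alpha> \<le> m \<longrightarrow> cmod (a \<alpha>) \<le> \<delta>) \<longrightarrow> weight m a \<xi> \<le> B * \<delta>"
proof -
  define M where "M \<alpha> \<beta> = cmod (mpd \<alpha> (\<lambda>x. of_real (\<Prod>i\<in>UNIV. (x $ i) ^ \<beta> i)) \<xi>)" for \<alpha> \<beta> :: "'a \<Rightarrow> nat"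
  define B where "B = (\<Sum>\<alpha> | mi_order \<alpha> \<le> m. \<Sum>\<beta> | mi_order \<beta> \<le> m. M \<alpha> \<beta>)"
  have "0 \<le> B" by (simp add: B_def M_def sum_nonneg)
  have "weight m a \<xi> \<le> (B + 1) * \<delta>" if le: "\<And>\<alpha>. mi_order \<alpha> \<le> m \<Longrightarrow> cmod (a \<alpha>) \<le> \<delta>" for a \<delta>
  proof -
    have "0 \<le> \<delta>" using le[of "\<lambda>_. 0"] norm_ge_zero[of "a (\<lambda>_. 0)"] by (simp add: mi_order_def del: norm_ge_zero)
    have "weight m a \<xi> \<le> (\<Sum>\<alpha> | mi_order \<alpha> \<le> m. cmod (mpd \<alpha> (symbol_poly m a) \<xi>))" by (rule weight_le_sum)
    also have "\<dots> \<le> (\<Sum>\<alpha> | mi_order \<alpha> \<le> m. \<Sum>\<beta> | mi_order \<beta> \<le> m. \<delta> * M \<alpha> \<beta>)"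
    proof (rule sum_mono)
      fix \<alpha> :: "'a \<Rightarrow> nat"
      show "cmod (mpd \<alpha> (symbol_poly m a) \<xi>) \<le> (\<Sum>\<beta> | mi_order \<beta> \<le> m. \<delta> * M \<alpha> \<beta>)"
        unfolding mpd_symbol_poly
      proof (rule order_trans[OF norm_sum], rule sum_mono)
        fix \<beta> :: "'a \<Rightarrow> nat" assume "\<beta> \<in> {\<beta>. mi_order \<beta> \<le> m}"
        then show "cmod (a \<beta> * mpd \<alpha> (\<lambda>x. of_real (\<Prod>i\<in>UNIV. (x $ i) ^ \<beta> i)) \<xi>) \<le> \<delta> * M \<alpha> \<beta>"
          unfolding norm_mult M_def using le by (intro mult_right_mono) auto
      qed
    qed
    also have "\<dots> = B * \<delta>" by (simp add: B_def sum_distrib_left mult.commute)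
    also have "\<dots> \<le> (B + 1) * \<delta>" using \<open>0 \<le> \<delta>\<close> by (intro mult_right_mono) auto
    finally show ?thesis .
  qed
  then show ?thesis using \<open>0 \<le> B\<close> by (intro exI[of _ "B + 1"]) auto
qed

text \<open>
  If \<open>s\<close> inverts the weight, then the weight exceeds half the reciprocal of the moderate net \<open>s\<close>, hence a power of
  \<open>e\<close>; on the other hand the weight at a fixed point is at most a constant times the largest coefficient.
\<close>

theorem invertible_weight_imp_moderately_nonzero:
  assumes "gen_weight m c \<xi> dvd 1"
  shows "moderately_nonzero m (\<lambda>\<alpha>. rep_gen (c \<alpha>))"
proof -
  define w where "w e = weight m (\<lambda>\<alpha>. rep_gen (c \<alpha>) e) \<xi>" for e
  have mw: "moderate w"
  proof -
    have "gen_eq (\<lambda>e. weight m (\<lambda>\<alpha>. rep_gen (c \<alpha>) e) \<xi>) (\<lambda>e. weight m (\<lambda>\<alpha>. rep_gen (c \<alpha>) e) \<xi>)"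
      by (rule gen_weight.rsp[unfolded rel_fun_def, rule_format, OF refl _ refl]) (simp add: gen_eq_refl moderate_rep_gen)
    then show ?thesis by (simp add: gen_eq_refl w_def[abs_def])
  qed
  from assms obtain s where s: "1 = gen_weight m c \<xi> * s" by (rule dvdE)
  define r where "r = rep_gen s"
  have mr: "moderate r" by (simp add: r_def moderate_rep_gen)
  have "abs_gen (\<lambda>e. w e * r e) = abs_gen w * abs_gen r"
    by (rule times_gen.abs_eq[symmetric]) (simp_all add: gen_eq_refl mw mr)
  also have "\<dots> = 1" using s by (simp add: gen_weight_abs w_def[abs_def] r_def abs_rep_gen)
  finally have "abs_gen (\<lambda>e. w e * r e) = abs_gen (\<lambda>_. 1)" by (simp add: one_gen_def)
  then have "negligible_net (\<lambda>e. w e * r e - 1)"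
    by (rule abs_gen_eqD) (simp_all add: moderate_mult mw mr)
  then have "(\<lambda>e. norm (w e * r e - 1)) \<in> O[at_right 0](\<lambda>e. e powr real 1)"
    unfolding negligible_net_def by blast
  then obtain C1 where C1: "eventually (\<lambda>e. norm (w e * r e - 1) \<le> C1 * e powr real 1) (at_right 0)"
    by (elim landau_o.bigE) simp
  from mr obtain N :: nat where "(\<lambda>e. norm (r e)) \<in> O[at_right 0](\<lambda>e. e powr - real N)"
    unfolding moderate_def by blast
  then obtain C2 where "0 < C2" and C2: "eventually (\<lambda>e. norm (r e) \<le> C2 * e powr - real N) (at_right 0)"
    by (elim landau_o.bigE) simp
  obtain B where "0 < B" and B: "\<And>a \<delta>. (\<And>\<alpha>. mi_order \<alpha> \<le> m \<Longrightarrow> cmod (a \<alpha>) \<le> \<delta>) \<Longrightarrow> weight m a \<xi> \<le> B * \<delta>"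
    using weight_le_coeffs[of m \<xi>] by blast
  have e1: "eventually (\<lambda>e. C1 * e powr real (Suc 0) < 1 / 2 * e powr real 0) (at_right 0)"
    by (rule eventually_powr_less) simp
  have e2: "eventually (\<lambda>e. B * C2 * e powr real (Suc N) < 1 / 2 * e powr real N) (at_right 0)"
    by (rule eventually_powr_less) simp
  have "eventually (\<lambda>e. \<exists>\<alpha>. mi_order \<alpha> \<le> m \<and> e powr real (Suc N) \<le> cmod (rep_gen (c \<alpha>) e)) (at_right 0)"
    using C1 C2 e1 e2 eventually_unit_interval
  proof eventually_elim
    case (elim e)
    then have "0 < e" by simp
    have "norm (w e * r e - 1) < 1 / 2" using elim(1,3) \<open>0 < e\<close> by simp
    then have "1 / 2 < w e * r e" unfolding real_norm_def by linarith
    also have "\<dots> \<le> w e * \<bar>r e\<bar>"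
      using weight_nonneg[of m "\<lambda>\<alpha>. rep_gen (c \<alpha>) e" \<xi>] by (intro mult_left_mono) (auto simp: w_def)
    also have "\<dots> \<le> w e * (C2 * e powr - real N)"
      using elim(2) weight_nonneg by (intro mult_left_mono) (auto simp: w_def)
    finally have big: "1 / 2 * e powr real N < w e * C2"
      using \<open>0 < e\<close> by (simp add: powr_minus field_simps)
    \<comment> \<open>otherwise the weight would be at most \<open>B\<close> times one more power of \<open>e\<close>, which is too small\<close>
    show ?case
    proof (rule ccontr)
      assume "\<not> ?case"
      then have "w e \<le> B * e powr real (Suc N)"
        unfolding w_def by (intro B) (meson linear)
      then have "w e * C2 \<le> B * C2 * e powr real (Suc N)"
        using mult_right_mono[of "w e" "B * e powr real (Suc N)" C2] \<open>0 < C2\<close> by (simp add: mult_ac)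
      then show False using big elim(4) by linarith
    qed
  qed
  then show ?thesis unfolding moderately_nonzero_def by blast
qed

definition sol_net :: "nat \<Rightarrow> (('n::finite \<Rightarrow> nat) \<Rightarrow> real \<Rightarrow> complex) \<Rightarrow> 'n fnet \<Rightarrow> 'n fnet" where
  "sol_net m a u e = sol m (\<lambda>\<alpha>. a \<alpha> e) (u e)"

lemma moderately_nonzero_nonzero:
  assumes "moderately_nonzero m a"
  shows "eventually (\<lambda>e. nonzero_coeffs m (\<lambda>\<alpha>. a \<alpha> e)) (at_right 0)"
proof -
  from assms obtain N :: nat
    where "eventually (\<lambda>e. \<exists>\<alpha>. mi_order \<alpha> \<le> m \<and> e powr real N \<le> cmod (a \<alpha> e)) (at_right 0)"
    unfolding moderately_nonzero_def by blast
  then show ?thesis using eventually_unit_interval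
  proof eventually_elim
    case (elim e)
    then obtain \<alpha> where "mi_order \<alpha> \<le> m" "e powr real N \<le> cmod (a \<alpha> e)" by blast
    moreover have "0 < e powr real N" using elim by simp
    ultimately show ?case unfolding nonzero_coeffs_def by (metis norm_zero not_le)
  qed
qed

lemma sol_net_estimate:
  fixes a :: "('n::finite \<Rightarrow> nat) \<Rightarrow> real \<Rightarrow> complex"
  assumes a: "moderately_nonzero m a" and K: "compact K" "compact K'"
  obtains C :: real and N :: nat where "0 < C"
    "eventually (\<lambda>e. \<forall>w\<in>C_infinity_on K. \<forall>l. seminorm K' l (sol m (\<lambda>\<alpha>. a \<alpha> e) w)
      \<le> C * e powr - real N * seminorm K (m + 2 * CARD('n) + l) w) (at_right 0)"
proof -
  from a obtain N :: nat where N: "eventually (\<lambda>e. \<exists>\<alpha>. mi_order \<alpha> \<le> m \<and> e powr real N \<le> cmod (a \<alpha> e)) (at_right 0)"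
    unfolding moderately_nonzero_def by blast
  obtain C where "0 \<le> C" and C: "\<And>a \<alpha> w l. mi_order \<alpha> \<le> m \<Longrightarrow> a \<alpha> \<noteq> 0 \<Longrightarrow> w \<in> C_infinity_on K \<Longrightarrow>
      seminorm K' l (sol m a w) \<le> C / cmod (a \<alpha>) * seminorm K (m + 2 * CARD('n) + l) w"
    using seminorm_sol_le[OF K] by blast
  have "eventually (\<lambda>e. \<forall>w\<in>C_infinity_on K. \<forall>l. seminorm K' l (sol m (\<lambda>\<alpha>. a \<alpha> e) w)
      \<le> (C + 1) * e powr - real N * seminorm K (m + 2 * CARD('n) + l) w) (at_right 0)"
    using N eventually_unit_interval
  proof eventually_elim
    case (elim e)
    then obtain \<alpha> where \<alpha>: "mi_order \<alpha> \<le> m" "e powr real N \<le> cmod (a \<alpha> e)" by blast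
    have pos: "0 < e powr real N" using elim by simp
    then have nz: "a \<alpha> e \<noteq> 0" using \<alpha>(2) by auto
    have "C / cmod (a \<alpha> e) \<le> C / e powr real N"
      using \<alpha>(2) pos nz \<open>0 \<le> C\<close> by (intro divide_left_mono mult_pos_pos) auto
    also have "\<dots> \<le> (C + 1) * e powr - real N" by (simp add: powr_minus divide_inverse mult_right_mono)
    finally have le: "C / cmod (a \<alpha> e) \<le> (C + 1) * e powr - real N" .
    show ?case
    proof (intro ballI allI)
      fix w l assume w: "w \<in> C_infinity_on K"
      have "seminorm K' l (sol m (\<lambda>\<alpha>. a \<alpha> e) w) \<le> C / cmod (a \<alpha> e) * seminorm K (m + 2 * CARD('n) + l) w"
        using C[of \<alpha> "\<lambda>\<alpha>. a \<alpha> e" w l] \<alpha>(1) nz w by blast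
      also have "\<dots> \<le> (C + 1) * e powr - real N * seminorm K (m + 2 * CARD('n) + l) w"
        by (intro mult_right_mono le seminorm_nonneg K C_infinity_on_smooth[OF w])
      finally show "seminorm K' l (sol m (\<lambda>\<alpha>. a \<alpha> e) w)
          \<le> (C + 1) * e powr - real N * seminorm K (m + 2 * CARD('n) + l) w" .
    qed
  qed
  then show ?thesis using that[of "C + 1" N] \<open>0 \<le> C\<close> by auto
qed

lemma smooth_sol_net: "test_net K u \<Longrightarrow> compact K \<Longrightarrow> smooth_fnet (sol_net m a u)"
  by (auto simp: smooth_fnet_def sol_net_def test_net_def intro: smooth_sol)

text \<open>
  The exponent \<open>N\<close> depends neither on the net nor on the order \<open>l\<close>.  Preservation of moderate, negligible and
  regular nets and the continuity estimate all derive from this statement.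
\<close>

lemma sol_net_bigo:
  fixes a :: "('n::finite \<Rightarrow> nat) \<Rightarrow> real \<Rightarrow> complex"
  assumes a: "moderately_nonzero m a" and K: "compact K" "compact K'"
  shows "\<exists>N::nat. \<forall>u b l. test_net K u \<longrightarrow>
    (\<lambda>e. seminorm K (m + 2 * CARD('n) + l) (u e)) \<in> O[at_right 0](\<lambda>e. e powr b) \<longrightarrow>
    (\<lambda>e. seminorm K' l (sol_net m a u e)) \<in> O[at_right 0](\<lambda>e. e powr (b - real N))"
proof -
  obtain C :: real and N :: nat where C: "0 < C"
    and ev: "eventually (\<lambda>e. \<forall>w\<in>C_infinity_on K. \<forall>l. seminorm K' l (sol m (\<lambda>\<alpha>. a \<alpha> e) w)
      \<le> C * e powr - real N * seminorm K (m + 2 * CARD('n) + l) w) (at_right 0)"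
    by (rule sol_net_estimate[OF assms])
  show ?thesis
  proof (intro exI[of _ N] allI impI)
    fix u :: "'n fnet" and b l
    assume u: "test_net K u" and bo: "(\<lambda>e. seminorm K (m + 2 * CARD('n) + l) (u e)) \<in> O[at_right 0](\<lambda>e. e powr b)"
    have "(\<lambda>e. C * e powr - real N) \<in> O[at_right 0](\<lambda>e. e powr - real N)"
      by (intro bigo_cmult landau_o.big_refl)
    from bigo_powr_mult[OF this bo]
    have "(\<lambda>e. C * e powr - real N * seminorm K (m + 2 * CARD('n) + l) (u e)) \<in> O[at_right 0](\<lambda>e. e powr (b - real N))"
      by simp
    then show "(\<lambda>e. seminorm K' l (sol_net m a u e)) \<in> O[at_right 0](\<lambda>e. e powr (b - real N))"
    proof (rule bigo_bound[rotated], use ev eventually_unit_interval in eventually_elim)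
      case (elim e)
      have ue: "u e \<in> C_infinity_on K" using u elim by (simp add: test_net_def)
      then have "0 \<le> seminorm K' l (sol_net m a u e)"
        unfolding sol_net_def by (intro seminorm_nonneg K smooth_sol[OF ue K(1)])
      then show ?case using elim(1) ue by (simp add: sol_net_def)
    qed
  qed
qed

lemma moderate_sol_net:
  assumes "moderately_nonzero m a" "test_net K u" "compact K" "moderate_fnet u"
  shows "moderate_fnet (sol_net m a u)"
proof (rule moderate_fnetI[OF smooth_sol_net[OF assms(2,3)]])
  fix K' :: "(real ^ 'a) set" and j assume K': "compact K'"
  obtain N :: nat where N: "\<And>u b l. test_net K u \<Longrightarrow> (\<lambda>e. seminorm K (m + 2 * CARD('a) + l) (u e)) \<in> O[at_right 0](\<lambda>e. e powr b)
      \<Longrightarrow> (\<lambda>e. seminorm K' l (sol_net m a u e)) \<in> O[at_right 0](\<lambda>e. e powr (b - real N))"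
    using sol_net_bigo[OF assms(1,3) K'] by blast
  obtain N0 :: nat where N0: "(\<lambda>e. seminorm K (m + 2 * CARD('a) + j) (u e)) \<in> O[at_right 0](\<lambda>e. e powr - real N0)"
    by (rule moderate_seminorm_bigo[OF assms(4,3)])
  have "- real N0 - real N = - real (N0 + N)" by simp
  with N[OF assms(2) N0]
  show "\<exists>N::nat. (\<lambda>e. seminorm K' j (sol_net m a u e)) \<in> O[at_right 0](\<lambda>e. e powr - real N)" by metis
qed

lemma negligible_sol_net:
  assumes "moderately_nonzero m a" "test_net K u" "compact K" "negligible_fnet u"
  shows "negligible_fnet (sol_net m a u)"
proof (rule negligible_fnetI[OF smooth_sol_net[OF assms(2,3)]])
  fix K' :: "(real ^ 'a) set" and j q :: nat assume K': "compact K'"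
  obtain N :: nat where N: "\<And>u b l. test_net K u \<Longrightarrow> (\<lambda>e. seminorm K (m + 2 * CARD('a) + l) (u e)) \<in> O[at_right 0](\<lambda>e. e powr b)
      \<Longrightarrow> (\<lambda>e. seminorm K' l (sol_net m a u e)) \<in> O[at_right 0](\<lambda>e. e powr (b - real N))"
    using sol_net_bigo[OF assms(1,3) K'] by blast
  show "(\<lambda>e. seminorm K' j (sol_net m a u e)) \<in> O[at_right 0](\<lambda>e. e powr real q)"
    using N[OF assms(2) negligible_seminorm_bigo[OF assms(4) test_net_smooth[OF assms(2)] assms(3), of _ "q + N"]] by simp
qed

lemma regular_sol_net:
  assumes "moderately_nonzero m a" "test_net K u" "compact K" "regular_fnet u"
  shows "regular_fnet (sol_net m a u)"
  unfolding regular_fnet_def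
proof (intro allI impI)
  fix K' :: "(real ^ 'a) set" assume K': "compact K'"
  obtain N :: nat where N: "\<And>u b l. test_net K u \<Longrightarrow> (\<lambda>e. seminorm K (m + 2 * CARD('a) + l) (u e)) \<in> O[at_right 0](\<lambda>e. e powr b)
      \<Longrightarrow> (\<lambda>e. seminorm K' l (sol_net m a u e)) \<in> O[at_right 0](\<lambda>e. e powr (b - real N))"
    using sol_net_bigo[OF assms(1,3) K'] by blast
  obtain N0 :: nat where N0: "\<And>\<alpha>. (\<lambda>e. sup_norm K (mpd \<alpha> (u e))) \<in> O[at_right 0](\<lambda>e. e powr - real N0)"
    using assms(3,4) unfolding regular_fnet_def by blast
  have "(\<lambda>e. sup_norm K' (mpd \<alpha> (sol_net m a u e))) \<in> O[at_right 0](\<lambda>e. e powr - real (N0 + N))" for \<alpha>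
  proof (rule bigo_sup_norm[OF K' smooth_sol_net[OF assms(2,3)] order_refl])
    have "- real N0 - real N = - real (N0 + N)" by simp
    moreover have "(\<lambda>e. seminorm K j (u e)) \<in> O[at_right 0](\<lambda>e. e powr - real N0)" for j
      by (rule bigo_seminorm[OF assms(3) test_net_smooth[OF assms(2)] N0])
    ultimately show "(\<lambda>e. seminorm K' (mi_order \<alpha>) (sol_net m a u e)) \<in> O[at_right 0](\<lambda>e. e powr - real (N0 + N))"
      using N[OF assms(2)] by metis
  qed
  then show "\<exists>N::nat. \<forall>\<alpha>. (\<lambda>e. sup_norm K' (mpd \<alpha> (sol_net m a u e))) \<in> O[at_right 0](\<lambda>e. e powr - real N)" by blast
qed

text \<open>
Representatives with supports in one compact set, to which \<^const>\<open>sol\<close> can be applied.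
\<close>

definition represents :: "'n::finite fnet \<Rightarrow> 'n colombeau \<Rightarrow> bool" where
  "represents u w \<longleftrightarrow> moderate_fnet u \<and> (\<exists>K. compact K \<and> test_net K u) \<and> abs_colombeau u = w"

definition gsol :: "nat \<Rightarrow> (('n::finite \<Rightarrow> nat) \<Rightarrow> real \<Rightarrow> complex) \<Rightarrow> 'n colombeau \<Rightarrow> 'n colombeau" where
  "gsol m a w = abs_colombeau (sol_net m a (SOME u. represents u w))"

lemma represents_ex: "w \<in> Gc \<Longrightarrow> \<exists>u. represents u w"
  unfolding represents_def Gc_def using compact_representative[of "gsupp w"] by blast

lemma represents_Gc: "represents u w \<Longrightarrow> w \<in> Gc"
  unfolding represents_def using abs_test_net_Gc by blast

lemma test_net_add: "test_net K u \<Longrightarrow> test_net K w \<Longrightarrow> closed K \<Longrightarrow> test_net K (\<lambda>e x. u e x + w e x)"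
  by (simp add: test_net_def C_infinity_on_add)

lemma test_net_scale: "test_net K u \<Longrightarrow> closed K \<Longrightarrow> test_net K (\<lambda>e x. r e * u e x)"
  by (simp add: test_net_def C_infinity_on_cmult)

lemma represents_add:
  assumes "represents u v" "represents u' w"
  shows "represents (\<lambda>e x. u e x + u' e x) (v + w)"
proof -
  from assms obtain K K' where "compact K" "test_net K u" "compact K'" "test_net K' u'" by (auto simp: represents_def)
  then have "compact (K \<union> K')" "test_net (K \<union> K') (\<lambda>e x. u e x + u' e x)"
    using test_net_mono[of K u "K \<union> K'"] test_net_mono[of K' u' "K \<union> K'"]
    by (auto intro!: test_net_add compact_imp_closed)
  then show ?thesis using assms unfolding represents_def by (auto simp: moderate_fnet_add abs_colombeau_add)
qed

lemma represents_gscale: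
  assumes "represents u v"
  shows "represents (\<lambda>e x. rep_gen r e * u e x) (gscale r v)"
proof -
  have "gscale r v = abs_colombeau (\<lambda>e x. rep_gen r e * u e x)"
    using abs_colombeau_gscale[OF moderate_rep_gen, of u r] assms by (simp add: represents_def abs_rep_gen)
  then show ?thesis
    using assms unfolding represents_def
    by (auto intro!: moderate_fnet_scale moderate_rep_gen test_net_scale compact_imp_closed)
qed

text \<open>
  Independence of the representative: the difference of two of them is a negligible net supported in the union of
  the two compact sets.
\<close>

lemma gsol_eq:
  assumes a: "moderately_nonzero m a" and r: "represents u w"
  shows "gsol m a w = abs_colombeau (sol_net m a u)"
proof -
  define u' where "u' = (SOME u. represents u w)"
  have r': "represents u' w" unfolding u'_def by (rule someI[of _ u]) (rule r)
  from r r' obtain L L' where L: "compact L" "test_net L u" "compact L'" "test_net L' u'" by (auto simp: represents_def)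
  define K where "K = L \<union> L'"
  have K: "compact K" "test_net K u" "test_net K u'"
    unfolding K_def using L test_net_mono[of L u "L \<union> L'"] test_net_mono[of L' u' "L \<union> L'"] by auto
  define d where "d e x = u' e x - u e x" for e x
  have d_alt: "d = (\<lambda>e x. u' e x + (-1) * u e x)" by (simp add: d_def fun_eq_iff)
  have td: "test_net K d"
    unfolding d_alt using K by (intro test_net_add test_net_scale compact_imp_closed)
  have "abs_colombeau u' = abs_colombeau u" "moderate_fnet u'" "moderate_fnet u"
    using r r' by (auto simp: represents_def)
  then have "colombeau_eq u' u"
    using Quotient3_rel[OF Quotient3_colombeau, of u' u] by (simp add: colombeau_eq_refl)
  then have "negligible_fnet d" by (simp add: colombeau_eq_def d_def[abs_def])
  then have neg: "negligible_fnet (sol_net m a d)" by (rule negligible_sol_net[OF a td K(1)])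
  have "sol_net m a d e = (\<lambda>x. sol_net m a u' e x - sol_net m a u e x)" if "e \<in> {0<..1}" for e
  proof -
    have ue: "u e \<in> C_infinity_on K" "u' e \<in> C_infinity_on K" using that K by (auto simp: test_net_def)
    show ?thesis
      unfolding sol_net_def d_alt
      by (subst sol_add[OF ue(2) C_infinity_on_cmult[OF ue(1) compact_imp_closed[OF K(1)]] K(1)], subst sol_cmult) simp
  qed
  then have "negligible_fnet (\<lambda>e x. sol_net m a u' e x - sol_net m a u e x)"
    by (rule negligible_fnet_cong[OF neg])
  moreover have "moderate_fnet (sol_net m a u')" "moderate_fnet (sol_net m a u)"
    using r r' K by (auto intro!: moderate_sol_net[OF a] simp: represents_def)
  ultimately have "colombeau_eq (sol_net m a u') (sol_net m a u)" by (simp add: colombeau_eq_def)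
  then show ?thesis unfolding gsol_def u'_def by (rule abs_colombeau_eqI)
qed

lemma represents_sol_moderate:
  "moderately_nonzero m a \<Longrightarrow> represents u w \<Longrightarrow> moderate_fnet (sol_net m a u)"
  by (auto simp: represents_def intro: moderate_sol_net)

lemma gsol_add:
  assumes a: "moderately_nonzero m a" and "v \<in> Gc" "w \<in> Gc"
  shows "gsol m a (v + w) = gsol m a v + gsol m a w"
proof -
  from assms(2,3) obtain u u' where r: "represents u v" "represents u' w" using represents_ex by metis
  from r obtain L L' where L: "compact L" "test_net L u" "compact L'" "test_net L' u'" by (auto simp: represents_def)
  have eq: "sol_net m a (\<lambda>e x. u e x + u' e x) e = (\<lambda>x. sol_net m a u e x + sol_net m a u' e x)" if "e \<in> {0<..1}" for e
    unfolding sol_net_def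
  proof (rule sol_add[of _ "L \<union> L'"])
    show "u e \<in> C_infinity_on (L \<union> L')" "u' e \<in> C_infinity_on (L \<union> L')"
      using that L test_net_mono[of L u "L \<union> L'"] test_net_mono[of L' u' "L \<union> L'"] by (auto simp: test_net_def)
  qed (use L in auto)
  note m = represents_sol_moderate[OF a r(1)] represents_sol_moderate[OF a r(2)]
    represents_sol_moderate[OF a represents_add[OF r]]
  show ?thesis
    unfolding gsol_eq[OF a r(1)] gsol_eq[OF a r(2)] gsol_eq[OF a represents_add[OF r]] abs_colombeau_add[OF m(1,2)]
    by (intro abs_colombeau_eventually_eq m moderate_fnet_add eventually_at_right_0_intro eq) simp
qed

lemma gsol_gscale:
  assumes a: "moderately_nonzero m a" and "w \<in> Gc"
  shows "gsol m a (gscale r w) = gscale r (gsol m a w)"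
proof -
  from assms(2) obtain u where r: "represents u w" using represents_ex by metis
  have "gscale r (gsol m a w) = abs_colombeau (\<lambda>e x. rep_gen r e * sol_net m a u e x)"
    using abs_colombeau_gscale[OF moderate_rep_gen represents_sol_moderate[OF a r], of r]
    by (simp add: gsol_eq[OF a r] abs_rep_gen)
  then show ?thesis
    unfolding gsol_eq[OF a represents_gscale[OF r]] by (simp add: sol_net_def[abs_def] sol_cmult)
qed

definition net_transpose :: "(('n::finite \<Rightarrow> nat) \<Rightarrow> real \<Rightarrow> complex) \<Rightarrow> ('n \<Rightarrow> nat) \<Rightarrow> real \<Rightarrow> complex" where
  "net_transpose a \<alpha> e = (- 1) ^ mi_order \<alpha> * a \<alpha> e"

lemma net_transpose_at: "(\<lambda>\<alpha>. net_transpose a \<alpha> e) = ctranspose (\<lambda>\<alpha>. a \<alpha> e)"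
  by (simp add: fun_eq_iff net_transpose_def ctranspose_def)

lemma net_transpose_twice: "net_transpose (net_transpose a) = a"
  by (simp add: fun_eq_iff net_transpose_def flip: mult.assoc power_mult_distrib)

lemma moderately_nonzero_transpose: "moderately_nonzero m (net_transpose a) \<longleftrightarrow> moderately_nonzero m a"
  by (simp add: moderately_nonzero_def net_transpose_def norm_mult norm_power)

lemma moderate_net_transpose: "moderate (a \<alpha>) \<Longrightarrow> moderate (net_transpose a \<alpha>)"
  unfolding net_transpose_def[abs_def] by (intro moderate_mult) auto

lemma transpose_coeffs_abs:
  assumes "moderate (a \<alpha>)" "c \<alpha> = abs_gen (a \<alpha>)"
  shows "transpose_coeffs c \<alpha> = abs_gen (net_transpose a \<alpha>)"
proof -
  have neg: "- abs_gen r = abs_gen (\<lambda>e. - r e)" if "moderate r" for r :: "real \<Rightarrow> complex"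
    by (rule uminus_gen.abs_eq) (simp add: gen_eq_refl that)
  have "(- 1) ^ k * abs_gen (a \<alpha>) = abs_gen (\<lambda>e. (- 1) ^ k * a \<alpha> e)" for k
  proof (induction k)
    case (Suc k)
    have "moderate (\<lambda>e. (- 1) ^ k * a \<alpha> e)" by (intro moderate_mult assms) simp
    from neg[OF this] Suc show ?case by simp
  qed simp
  then show ?thesis by (simp add: transpose_coeffs_def assms(2) net_transpose_def[abs_def])
qed

text \<open>
  For small \<open>e\<close> the operators \<^const>\<open>sol\<close> invert the symbols exactly, so the two nets agree for small \<open>e\<close>.
\<close>

lemma diff_op_gsol_transpose:
  assumes a: "moderately_nonzero m a" "\<And>\<alpha>. moderate (a \<alpha>)" "\<And>\<alpha>. c \<alpha> = abs_gen (a \<alpha>)"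
    and r: "represents u v"
  shows "diff_op m c (abs_colombeau (sol_net m (net_transpose a) u)) = v"
proof -
  let ?b = "net_transpose a"
  have b: "moderately_nonzero m ?b" using a(1) by (simp add: moderately_nonzero_transpose)
  have ms: "moderate_fnet (sol_net m ?b u)" by (rule represents_sol_moderate[OF b r])
  from r obtain K where K: "compact K" "test_net K u" and u: "moderate_fnet u" "abs_colombeau u = v" by (auto simp: represents_def)
  have "diff_op m c (abs_colombeau (sol_net m ?b u)) = abs_colombeau (\<lambda>e. cdiff_op m (\<lambda>\<alpha>. a \<alpha> e) (sol_net m ?b u e))"
    by (rule moderate_fnet_cdiff_op(2)[OF a(2) ms a(3)])
  also have "\<dots> = abs_colombeau u"
  proof (rule abs_colombeau_eventually_eq[OF moderate_fnet_cdiff_op(1)[OF a(2) ms] u(1)])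
    show "eventually (\<lambda>e. cdiff_op m (\<lambda>\<alpha>. a \<alpha> e) (sol_net m ?b u e) = u e) (at_right 0)"
      using moderately_nonzero_nonzero[OF b] eventually_unit_interval
    proof eventually_elim
      case (elim e)
      then have "u e \<in> C_infinity_on K" using K by (simp add: test_net_def)
      from cdiff_op_sol[OF this K(1) elim(1)] show ?case
        by (simp add: sol_net_def net_transpose_at[symmetric] net_transpose_twice)
    qed
  qed
  finally show ?thesis by (simp only: u(2))
qed

lemma gsol_diff_op_transpose:
  assumes a: "moderately_nonzero m a" "\<And>\<alpha>. moderate (a \<alpha>)" "\<And>\<alpha>. c \<alpha> = abs_gen (a \<alpha>)"
    and w: "w \<in> Gc"
  shows "gsol m a (diff_op m (transpose_coeffs c) w) = w"
proof -
  let ?b = "net_transpose a"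
  from w obtain u where r: "represents u w" using represents_ex by blast
  then obtain K where K: "compact K" "test_net K u" and u: "moderate_fnet u" "abs_colombeau u = w" by (auto simp: represents_def)
  define d where "d e = cdiff_op m (\<lambda>\<alpha>. ?b \<alpha> e) (u e)" for e
  have "moderate (?b \<alpha>)" "transpose_coeffs c \<alpha> = abs_gen (?b \<alpha>)" for \<alpha>
    using moderate_net_transpose[of a, OF a(2)] transpose_coeffs_abs[of a \<alpha> c, OF a(2,3)] by auto
  from moderate_fnet_cdiff_op(1)[OF this(1) u(1)] moderate_fnet_cdiff_op(2)[OF this(1) u(1) this(2)]
  have "moderate_fnet d" and d: "diff_op m (transpose_coeffs c) w = abs_colombeau d"
    by (simp_all add: d_def[abs_def] u(2))
  moreover have "test_net K d" using K unfolding d_def test_net_def by (simp add: C_infinity_on_cdiff_op)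
  ultimately have rd: "represents d (diff_op m (transpose_coeffs c) w)" using K by (auto simp: represents_def)
  have "gsol m a (diff_op m (transpose_coeffs c) w) = abs_colombeau (sol_net m a d)" by (rule gsol_eq[OF a(1) rd])
  also have "\<dots> = abs_colombeau u"
  proof (rule abs_colombeau_eventually_eq[OF represents_sol_moderate[OF a(1) rd] u(1)])
    show "eventually (\<lambda>e. sol_net m a d e = u e) (at_right 0)"
      using moderately_nonzero_nonzero[OF a(1)] eventually_unit_interval
    proof eventually_elim
      case (elim e)
      then have "u e \<in> C_infinity_on K" using K by (simp add: test_net_def)
      from sol_cdiff_op[OF this K(1) elim(1)] show ?case
        by (simp add: sol_net_def d_def net_transpose_at)
    qed
  qed
  finally show ?thesis by (simp only: u(2))
qed

section \<open>Continuity of the dual solution operator\<close>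

lemma exp_neg_less_iff:
  assumes "v \<noteq> - \<infinity>" "0 < r"
  shows "exp_neg v < r \<longleftrightarrow> ereal (- ln r) < v"
proof (cases v)
  case (real x)
  have "exp (- x) < r \<longleftrightarrow> - x < ln r" using assms(2) by (metis exp_less_cancel_iff exp_ln)
  then show ?thesis using real by (auto simp: exp_neg_def)
qed (use assms in \<open>auto simp: exp_neg_def\<close>)

text \<open>
  Balls of the ultra-pseudo-seminorms in terms of growth rates.  The first assumption excludes the valuation \<open>-\<infinity>\<close>,
  at which \<^const>\<open>exp_neg\<close> has an arbitrary value.
\<close>

lemma exp_neg_valuation_less_iff:
  assumes "f \<in> O[at_right 0](\<lambda>e. e powr b0)" "0 < r"
  shows "exp_neg (valuation f) < r \<longleftrightarrow> (\<exists>b > - ln r. f \<in> O[at_right 0](\<lambda>e. e powr b))"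
proof -
  have "ereal b0 \<le> valuation f" unfolding valuation_def using assms(1) by (intro Sup_upper) auto
  then have "valuation f \<noteq> - \<infinity>" by auto
  from exp_neg_less_iff[OF this assms(2)] show ?thesis
    unfolding valuation_def less_Sup_iff by auto
qed

lemma gen_abs_less_iff:
  assumes "moderate s" "0 < r"
  shows "gen_abs (abs_gen s) < r \<longleftrightarrow> (\<exists>b > - ln r. (\<lambda>e. norm (s e)) \<in> O[at_right 0](\<lambda>e. e powr b))"
proof -
  have "gen_val (abs_gen s) = valuation (\<lambda>e. norm (s e))"
    by (rule gen_val.abs_eq) (simp add: gen_eq_refl assms(1))
  moreover obtain N :: nat where "(\<lambda>e. norm (s e)) \<in> O[at_right 0](\<lambda>e. e powr - real N)"
    using assms(1) unfolding moderate_def by blast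
  ultimately show ?thesis
    using exp_neg_valuation_less_iff[OF _ assms(2)] by (simp add: gen_abs_def)
qed

lemma gen_abs_0: "gen_abs 0 = 0"
proof -
  have "gen_abs (abs_gen (\<lambda>_. 0)) < r" if "0 < r" for r
    unfolding gen_abs_less_iff[OF moderate_const that] by (intro exI[of _ "1 - ln r"]) simp
  moreover have "0 \<le> gen_abs x" for x :: "'a gen" by (simp add: gen_abs_def exp_neg_def)
  ultimately show ?thesis by (metis less_irrefl less_le zero_gen_def)
qed

lemma gen_abs_add_less:
  assumes "gen_abs x < r" "gen_abs y < r" "0 < r"
  shows "gen_abs (x + y) < r"
proof -
  define s t where "s = rep_gen x" and "t = rep_gen y"
  have m: "moderate s" "moderate t" by (simp_all add: s_def t_def moderate_rep_gen)
  have xy: "x = abs_gen s" "y = abs_gen t" by (simp_all add: s_def t_def abs_rep_gen)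
  obtain b b' where b: "- ln r < b" "(\<lambda>e. norm (s e)) \<in> O[at_right 0](\<lambda>e. e powr b)"
    "- ln r < b'" "(\<lambda>e. norm (t e)) \<in> O[at_right 0](\<lambda>e. e powr b')"
    using assms(1,2) unfolding xy gen_abs_less_iff[OF m(1) assms(3)] gen_abs_less_iff[OF m(2) assms(3)] by blast
  have "(\<lambda>e. norm (s e) + norm (t e)) \<in> O[at_right 0](\<lambda>e. e powr min b b')"
    by (intro sum_in_bigo bigo_powr_weaken[OF b(2)] bigo_powr_weaken[OF b(4)]) auto
  then have "(\<lambda>e. norm (s e + t e)) \<in> O[at_right 0](\<lambda>e. e powr min b b')"
    by (rule bigo_bound[rotated]) (simp add: norm_triangle_ineq)
  moreover have "x + y = abs_gen (\<lambda>e. s e + t e)"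
    unfolding xy by (rule plus_gen.abs_eq) (simp_all add: gen_eq_refl m)
  moreover have "- ln r < min b b'" using b(1,3) by simp
  ultimately show ?thesis
    using gen_abs_less_iff[OF moderate_add[OF m] assms(3)] by auto
qed

text \<open>
  The valuation of \<open>x\<close> is nonnegative but need not be attained, so half of the room between \<open>b\<close> and
  \<open>- ln r\<close> is spent on \<open>x\<close>.
\<close>

lemma gen_abs_mult_less:
  assumes "gen_abs x \<le> 1" "gen_abs y < r" "0 < r"
  shows "gen_abs (x * y) < r"
proof -
  define s t where "s = rep_gen x" and "t = rep_gen y"
  have m: "moderate s" "moderate t" by (simp_all add: s_def t_def moderate_rep_gen)
  have xy: "x = abs_gen s" "y = abs_gen t" by (simp_all add: s_def t_def abs_rep_gen)
  obtain b where b: "- ln r < b" "(\<lambda>e. norm (t e)) \<in> O[at_right 0](\<lambda>e. e powr b)"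
    using assms(2) unfolding xy gen_abs_less_iff[OF m(2) assms(3)] by blast
  define d where "d = (b + ln r) / 2"
  have "0 < d" using b(1) by (simp add: d_def)
  then have "gen_abs (abs_gen s) < exp d" using assms(1) xy(1) by (metis le_less_trans one_less_exp_iff)
  then obtain b' where b': "- d < b'" "(\<lambda>e. norm (s e)) \<in> O[at_right 0](\<lambda>e. e powr b')"
    unfolding gen_abs_less_iff[OF m(1) exp_gt_zero] by auto
  have "(\<lambda>e. norm (s e * t e)) \<in> O[at_right 0](\<lambda>e. e powr (b' + b))"
    using bigo_powr_mult[OF b'(2) b(2)] by (simp add: norm_mult)
  moreover have "- ln r < b' + b"
  proof -
    have "b + ln r = 2 * d" by (simp add: d_def)
    then show ?thesis using b(1) b'(1) \<open>0 < d\<close> by linarith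
  qed
  moreover have "x * y = abs_gen (\<lambda>e. s e * t e)"
    unfolding xy by (rule times_gen.abs_eq) (simp_all add: gen_eq_refl m)
  ultimately show ?thesis using gen_abs_less_iff[OF moderate_mult[OF m] assms(3)] by metis
qed

definition colombeau_abs :: "(real ^ 'n::finite) set \<Rightarrow> nat \<Rightarrow> 'n colombeau \<Rightarrow> real" where
  "colombeau_abs K j u = exp_neg (colombeau_val K j u)"

lemma colombeau_abs_less_iff:
  assumes "compact K" "moderate_fnet u" "0 < r"
  shows "colombeau_abs K j (abs_colombeau u) < r
    \<longleftrightarrow> (\<exists>b > - ln r. (\<lambda>e. seminorm K j (u e)) \<in> O[at_right 0](\<lambda>e. e powr b))"
proof -
  obtain N :: nat where "(\<lambda>e. seminorm K j (u e)) \<in> O[at_right 0](\<lambda>e. e powr - real N)"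
    by (rule moderate_seminorm_bigo[OF assms(2,1)])
  from exp_neg_valuation_less_iff[OF this assms(3)] show ?thesis
    by (simp add: colombeau_abs_def colombeau_val_abs[OF assms(1,2)])
qed

lemma colombeau_abs_add_less:
  assumes K: "compact K" and "colombeau_abs K j u < r" "colombeau_abs K j w < r" "0 < r"
  shows "colombeau_abs K j (u + w) < r"
proof -
  define s t where "s = rep_colombeau u" and "t = rep_colombeau w"
  have m: "moderate_fnet s" "moderate_fnet t" by (simp_all add: s_def t_def moderate_rep_colombeau)
  have uw: "u = abs_colombeau s" "w = abs_colombeau t" by (simp_all add: s_def t_def abs_rep_colombeau)
  obtain b b' where b: "- ln r < b" "(\<lambda>e. seminorm K j (s e)) \<in> O[at_right 0](\<lambda>e. e powr b)"
    "- ln r < b'" "(\<lambda>e. seminorm K j (t e)) \<in> O[at_right 0](\<lambda>e. e powr b')"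
    using assms(2,3) unfolding uw colombeau_abs_less_iff[OF K m(1) assms(4)] colombeau_abs_less_iff[OF K m(2) assms(4)] by blast
  have "(\<lambda>e. seminorm K j (s e) + seminorm K j (t e)) \<in> O[at_right 0](\<lambda>e. e powr min b b')"
    by (intro sum_in_bigo bigo_powr_weaken[OF b(2)] bigo_powr_weaken[OF b(4)]) auto
  then have "(\<lambda>e. seminorm K j (\<lambda>x. s e x + t e x)) \<in> O[at_right 0](\<lambda>e. e powr min b b')"
  proof (rule bigo_bound[rotated], intro eventually_at_right_0_intro)
    fix e :: real assume "0 < e" "e \<le> 1"
    then have "smooth (s e)" "smooth (t e)" using m by (auto simp: moderate_fnet_def)
    then show "\<bar>seminorm K j (\<lambda>x. s e x + t e x)\<bar> \<le> seminorm K j (s e) + seminorm K j (t e)"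
      using K by (simp add: seminorm_nonneg smooth_add seminorm_add_le)
  qed
  then show ?thesis
    unfolding uw abs_colombeau_add[OF m] colombeau_abs_less_iff[OF K moderate_fnet_add[OF m] assms(4)]
    using b(1,3) by (intro exI[of _ "min b b'"]) simp
qed

lemma seminorm_zero: "seminorm K j (\<lambda>_. 0) = 0"
proof -
  have "insert 0 {cmod (mpd \<alpha> (\<lambda>_. 0) x) | \<alpha> x. mi_order \<alpha> \<le> j \<and> x \<in> K} = {0}" by auto
  then show ?thesis unfolding seminorm_def by (metis cSup_singleton)
qed

lemma colombeau_abs_0_less: "compact K \<Longrightarrow> 0 < r \<Longrightarrow> colombeau_abs K j 0 < r"
  unfolding zero_colombeau_def
  by (subst colombeau_abs_less_iff) (auto simp: seminorm_zero intro!: exI[of _ "1 - ln r"])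

lemma colombeau_seminorms_eq: "(\<lambda>u. exp_neg (colombeau_val K j u)) = colombeau_abs K j"
  by (simp add: colombeau_abs_def fun_eq_iff)

text \<open>
  The topology is generated by balls around all points; by the ultrametric inequality a ball that contains \<open>0\<close>
  contains a ball of the same radius around \<open>0\<close>.
\<close>

lemma ultra_topology_nbhd_0:
  fixes P :: "('a::ab_group_add \<Rightarrow> real) set"
  assumes ultra: "\<And>p u w r. p \<in> P \<Longrightarrow> 0 < r \<Longrightarrow> p u < r \<Longrightarrow> p w < r \<Longrightarrow> p (u + w) < r"
    and U: "openin (ultra_topology UNIV P) U" "0 \<in> U"
  shows "\<exists>F r. finite F \<and> F \<subseteq> P \<and> 0 < r \<and> {w. \<forall>p\<in>F. p w < r} \<subseteq> U"
proof -
  have "generate_topology_on {{w \<in> UNIV. p (w - u) < r} | p u r. p \<in> P \<and> u \<in> UNIV \<and> 0 < r} U"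
    using U(1) unfolding ultra_topology_def openin_topology_generated_by_iff .
  then show ?thesis using U(2)
  proof (induction rule: generate_topology_on.induct)
    case (Int a b)
    then obtain F r F' r' where F: "finite F" "F \<subseteq> P" "0 < r" "{w. \<forall>p\<in>F. p w < r} \<subseteq> a"
      "finite F'" "F' \<subseteq> P" "0 < r'" "{w. \<forall>p\<in>F'. p w < r'} \<subseteq> b" by blast
    have "{w. \<forall>p\<in>F \<union> F'. p w < min r r'} \<subseteq> a \<inter> b"
      using F(4,8) by (auto simp: subset_iff)
    moreover have "finite (F \<union> F')" "F \<union> F' \<subseteq> P" "0 < min r r'" using F by auto
    ultimately show ?case by blast
  next
    case (UN K)
    then obtain k where "k \<in> K" "0 \<in> k" by blast
    with UN.IH[OF this] show ?case by (meson Union_upper order_trans)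
  next
    case (Basis s)
    then obtain p u r where s: "s = {w. p (w - u) < r}" "p \<in> P" "0 < r" by auto
    then have "p (- u) < r" using Basis.prems by simp
    then have "{w. \<forall>p\<in>{p}. p w < r} \<subseteq> s"
      using ultra[OF s(2,3), of _ "- u"] s(1) by auto
    then show ?case using s by (intro exI[of _ "{p}"] exI[of _ r]) auto
  qed auto
qed

lemma gsupp_zero: "gsupp 0 = ({} :: (real ^ 'n::finite) set)"
proof -
  have "gsupp (abs_colombeau (\<lambda>_ _. 0) :: 'n colombeau) \<subseteq> {}"
    by (rule gsupp_abs_subset) (auto simp: test_net_def C_infinity_on_zero)
  then show ?thesis by (simp add: zero_colombeau_def)
qed

lemma zero_Gc: "0 \<in> Gc"
  by (simp add: Gc_def gsupp_zero)

lemma Gc_add: "u \<in> Gc \<Longrightarrow> w \<in> Gc \<Longrightarrow> u + w \<in> Gc"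
  by (meson represents_Gc represents_add represents_ex)

lemma Gc_gscale: "w \<in> Gc \<Longrightarrow> gscale r w \<in> Gc"
  by (meson represents_Gc represents_gscale represents_ex)

text \<open>
  Loss of a factor \<open>e\<^sup>N\<close> in the net becomes loss of the constant factor \<open>exp N\<close> in the ultra-pseudo-seminorm.
\<close>

lemma gsol_continuity_estimate:
  fixes a :: "('n::finite \<Rightarrow> nat) \<Rightarrow> real \<Rightarrow> complex"
  assumes a: "moderately_nonzero m a" and K: "compact K" "compact L"
    and rep: "\<And>v. gsupp v \<subseteq> K0 \<Longrightarrow> \<exists>u. moderate_fnet u \<and> test_net K u \<and> abs_colombeau u = v"
  shows "\<exists>N::nat. \<forall>w r. gsupp w \<subseteq> K0 \<longrightarrow> 0 < r \<longrightarrow>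
    colombeau_abs K (m + 2 * CARD('n) + l) w < r * exp (- real N) \<longrightarrow> colombeau_abs L l (gsol m a w) < r"
proof -
  obtain N :: nat where N: "\<And>u b l. test_net K u \<Longrightarrow> (\<lambda>e. seminorm K (m + 2 * CARD('n) + l) (u e)) \<in> O[at_right 0](\<lambda>e. e powr b)
      \<Longrightarrow> (\<lambda>e. seminorm L l (sol_net m a u e)) \<in> O[at_right 0](\<lambda>e. e powr (b - real N))"
    using sol_net_bigo[OF a K] by blast
  have "colombeau_abs L l (gsol m a w) < r"
    if w: "gsupp w \<subseteq> K0" and r: "0 < r" and less: "colombeau_abs K (m + 2 * CARD('n) + l) w < r * exp (- real N)" for w r
  proof -
    obtain u where u: "moderate_fnet u" "test_net K u" "abs_colombeau u = w" using rep[OF w] by blast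
    have rw: "represents u w" using u K by (auto simp: represents_def)
    have "0 < r * exp (- real N)" using r by simp
    from less[folded u(3), unfolded colombeau_abs_less_iff[OF K(1) u(1) this]]
    obtain b where b: "- ln (r * exp (- real N)) < b"
      "(\<lambda>e. seminorm K (m + 2 * CARD('n) + l) (u e)) \<in> O[at_right 0](\<lambda>e. e powr b)" by blast
    have "- ln r < b - real N" using b(1) r by (simp add: ln_mult)
    with N[OF u(2) b(2)] show ?thesis
      unfolding gsol_eq[OF a rw] colombeau_abs_less_iff[OF K(2) represents_sol_moderate[OF a rw] r] by blast
  qed
  then show ?thesis by blast
qed

lemma gen_linear_on_dual_sol:
  assumes a: "moderately_nonzero m a" and v: "gen_linear_on UNIV v"
  shows "gen_linear_on Gc (\<lambda>w. v (gsol m a w))"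
  using v by (simp add: gen_linear_on_def gsol_add[OF a] gsol_gscale[OF a])

text \<open>
  A ball in the target is pulled back by \<open>v\<close> to finitely many seminorm conditions on \<open>gsol m a w\<close>, and on each \<open>GK K\<close> these
  follow from finitely many seminorm conditions on \<open>w\<close>.
\<close>

lemma dual_sol_nbhd:
  fixes a :: "('n::finite \<Rightarrow> nat) \<Rightarrow> real \<Rightarrow> complex"
  assumes a: "moderately_nonzero m a" and v: "v \<in> dual_G" and r: "0 < r"
  shows "Gc_nbhd0 {w \<in> Gc. gen_abs (v (gsol m a w)) < r}"
proof -
  define V where "V = {w \<in> Gc. gen_abs (v (gsol m a w)) < r}"
  let ?B = "{z \<in> UNIV. gen_abs (z - 0 :: complex gen) < r}"
  have lin: "gen_linear_on UNIV v" and cont: "continuous_map G_topology gen_topology v"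
    using v by (auto simp: dual_G_def)
  have "v (0 + 0) = v 0 + v 0" using lin unfolding gen_linear_on_def by blast
  then have v0: "v 0 = 0" by simp
  note T = gen_linear_on_dual_sol[OF a lin, unfolded gen_linear_on_def]
  have "openin gen_topology ?B"
    unfolding gen_topology_def ultra_topology_def using r by (intro topology_generated_by_Basis) (auto intro!: exI[of _ 0] exI[of _ r])
  then have "openin G_topology {x \<in> topspace G_topology. v x \<in> ?B}"
    by (rule openin_continuous_map_preimage[OF cont])
  moreover have "0 \<in> topspace (G_topology :: 'n colombeau topology)"
  proof -
    have "{w \<in> UNIV. colombeau_abs {} 0 (w - 0) < 1} \<in> {{w \<in> UNIV. p (w - u) < r} | p u r.
        p \<in> {\<lambda>u :: 'n colombeau. exp_neg (colombeau_val K j u) | K j. compact K} \<and> u \<in> UNIV \<and> 0 < r}"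
      unfolding colombeau_seminorms_eq using compact_empty zero_less_one[where 'a = real] by blast
    moreover have "0 \<in> {w \<in> UNIV. colombeau_abs {} 0 (w - 0 :: 'n colombeau) < 1}"
      by (simp add: colombeau_abs_0_less)
    ultimately show ?thesis
      unfolding G_topology_def ultra_topology_def topology_generated_by_topspace by blast
  qed
  moreover have "v 0 \<in> ?B" using v0 r by (simp add: gen_abs_0)
  ultimately have "openin (ultra_topology UNIV {\<lambda>u. exp_neg (colombeau_val K j u) | K j. compact K}) {x \<in> topspace G_topology. v x \<in> ?B}"
    "0 \<in> {x \<in> topspace G_topology. v x \<in> ?B}" by (simp_all add: G_topology_def)
  note open_preimage = this
  have ultra: "p (u + w) < s"
    if "p \<in> {\<lambda>u. exp_neg (colombeau_val K j u) | K j. compact K}" "0 < s" "p u < s" "p w < s"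
    for p :: "'n colombeau \<Rightarrow> real" and u w s
    using that colombeau_abs_add_less unfolding colombeau_seminorms_eq by auto
  have "\<exists>F \<rho>. finite F \<and> F \<subseteq> {\<lambda>u. exp_neg (colombeau_val K j u) | K j. compact K} \<and> 0 < \<rho> \<and>
      {w. \<forall>p\<in>F. p w < \<rho>} \<subseteq> {x \<in> topspace G_topology. v x \<in> ?B}"
    by (rule ultra_topology_nbhd_0[OF _ open_preimage], rule ultra)
  then obtain F \<rho> where F: "finite F"
    "F \<subseteq> {\<lambda>u. exp_neg (colombeau_val K j u) | K j. compact K}" "0 < \<rho>"
    "{w. \<forall>p\<in>F. p w < \<rho>} \<subseteq> {x \<in> topspace G_topology. v x \<in> ?B}"
    by (elim exE conjE)
  have "Gc_nbhd0 V"
    unfolding Gc_nbhd0_def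
  proof (intro conjI ballI allI impI)
    show "V \<subseteq> Gc" by (auto simp: V_def)
    show "u + w \<in> V" if "u \<in> V" "w \<in> V" for u w
      using that T r by (auto simp: V_def Gc_add gen_abs_add_less)
    show "gscale s u \<in> V" if "gen_abs s \<le> 1" "u \<in> V" for s u
      using that T r by (auto simp: V_def Gc_gscale gen_abs_mult_less)
    fix K :: "(real ^ 'n) set" assume K: "compact K"
    obtain K' where K': "compact K'" "K \<subseteq> interior K'"
      and rep: "\<And>v. gsupp v \<subseteq> K \<Longrightarrow> \<exists>u. moderate_fnet u \<and> test_net K' u \<and> abs_colombeau u = v \<and> (v \<in> Ginf \<longrightarrow> regular_fnet u)"
      using compact_representative[OF K] by blast
    define ball where "ball j s = {w \<in> GK K. colombeau_abs K' j (w - 0) < s}" for j s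
    have open_ball: "openin (GK_topology K) (ball j s)" if "0 < s" for j s
      unfolding GK_topology_def ultra_topology_def
    proof (rule topology_generated_by_Basis)
      have "0 \<in> GK K" by (simp add: GK_def zero_Gc gsupp_zero)
      then show "ball j s \<in> {{w \<in> GK K. p (w - u) < r} | p u r. p \<in> {\<lambda>u. exp_neg (colombeau_val K' j u) | K' j.
          compact K' \<and> K \<subseteq> interior K'} \<and> u \<in> GK K \<and> 0 < r}"
        unfolding colombeau_seminorms_eq ball_def using K' that by blast
    qed
    have zero_ball: "0 \<in> ball j s" if "0 < s" for j s
      using that K' by (simp add: ball_def GK_def zero_Gc gsupp_zero colombeau_abs_0_less)
    have "\<exists>j s. 0 < s \<and> (\<forall>w\<in>ball j s. p (gsol m a w) < \<rho>)" if "p \<in> F" for p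
    proof -
      from that F(2) obtain L l where p: "p = colombeau_abs L l" "compact L"
        unfolding colombeau_seminorms_eq by blast
      have "\<exists>u. moderate_fnet u \<and> test_net K' u \<and> abs_colombeau u = v" if "gsupp v \<subseteq> K" for v
        using rep[OF that] by blast
      from gsol_continuity_estimate[OF a K'(1) p(2) this, where l = l] obtain N :: nat where
        N: "\<And>w r. gsupp w \<subseteq> K \<Longrightarrow> 0 < r \<Longrightarrow> colombeau_abs K' (m + 2 * CARD('n) + l) w < r * exp (- real N)
          \<Longrightarrow> colombeau_abs L l (gsol m a w) < r" by blast
      have "p (gsol m a w) < \<rho>" if "w \<in> ball (m + 2 * CARD('n) + l) (\<rho> * exp (- real N))" for w
        unfolding p(1) by (rule N) (use that F(3) in \<open>auto simp: ball_def GK_def\<close>)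
      then show ?thesis using F(3) by (intro exI[of _ "m + 2 * CARD('n) + l"] exI[of _ "\<rho> * exp (- real N)"]) auto
    qed
    then obtain j s where js: "\<And>p. p \<in> F \<Longrightarrow> 0 < s p" "\<And>p w. p \<in> F \<Longrightarrow> w \<in> ball (j p) (s p) \<Longrightarrow> p (gsol m a w) < \<rho>"
      by metis
    \<comment> \<open>the factor \<open>ball 0 1\<close> keeps \<open>U\<close> inside \<open>GK K\<close> if \<open>F\<close> is empty\<close>
    define U where "U = ball 0 1 \<inter> \<Inter> ((\<lambda>p. ball (j p) (s p)) ` F)"
    have "openin (GK_topology K) U"
      unfolding U_def using F(1) js(1) by (intro openin_Int_Inter) (auto intro: open_ball)
    moreover have "0 \<in> U" unfolding U_def using js(1) zero_ball by auto
    moreover have "U \<subseteq> V"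
    proof
      fix w assume w: "w \<in> U"
      then have "w \<in> Gc" by (simp add: U_def ball_def GK_def)
      moreover have "\<forall>p\<in>F. p (gsol m a w) < \<rho>" using w js(2) by (auto simp: U_def)
      ultimately show "w \<in> V" using F(4) by (auto simp: V_def)
    qed
    ultimately show "\<exists>U. openin (GK_topology K) U \<and> 0 \<in> U \<and> U \<subseteq> V" by blast
  qed
  then show ?thesis by (simp only: V_def)
qed

text \<open>
  By linearity and the ultrametric inequality the preimage of a ball is a union of cosets of one neighbourhood of \<open>0\<close>.
\<close>

theorem dual_sol_in_dual_Gc:
  fixes a :: "('n::finite \<Rightarrow> nat) \<Rightarrow> real \<Rightarrow> complex"
  assumes a: "moderately_nonzero m a" and v: "v \<in> dual_G"
  shows "(\<lambda>w. v (gsol m a w)) \<in> dual_Gc"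
proof -
  define T where "T w = v (gsol m a w)" for w
  have lin: "gen_linear_on Gc T"
    unfolding T_def using v by (intro gen_linear_on_dual_sol[OF a]) (simp add: dual_G_def)
  define V where "V r = {w \<in> Gc. gen_abs (T w) < r}" for r
  have V: "Gc_nbhd0 (V r)" if "0 < r" for r
    unfolding V_def T_def by (rule dual_sol_nbhd[OF a v that])
  have coset: "openin Gc_topology ((+) x ` V r)" if "x \<in> Gc" "0 < r" for x r
    unfolding Gc_topology_def using that V by (intro topology_generated_by_Basis) blast
  have top: "x \<in> Gc" if "x \<in> topspace Gc_topology" for x :: "'n colombeau"
    using that unfolding Gc_topology_def topology_generated_by_topspace Gc_nbhd0_def by (auto intro: Gc_add)
  have T0: "T 0 = 0" using lin zero_Gc unfolding gen_linear_on_def by (metis add_0 add_cancel_right_left)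
  have "continuous_map Gc_topology gen_topology T"
    unfolding gen_topology_def ultra_topology_def continuous_on_generated_topo_iff
  proof (intro conjI allI impI)
    fix U :: "complex gen set"
    assume "U \<in> {{w \<in> UNIV. p (w - u) < r} | p u r. p \<in> {gen_abs} \<and> u \<in> UNIV \<and> 0 < r}"
    then obtain z r where U: "U = {w. gen_abs (w - z) < r}" "0 < r" by auto
    show "openin Gc_topology (T -` U \<inter> topspace Gc_topology)"
      unfolding openin_subopen[of _ "T -` U \<inter> topspace Gc_topology"]
    proof
      fix x assume x: "x \<in> T -` U \<inter> topspace Gc_topology"
      then have xG: "x \<in> Gc" using top by blast
      have "x + 0 \<in> (+) x ` V r" using T0 U(2) zero_Gc by (intro imageI) (simp add: V_def gen_abs_0)
      moreover have "(+) x ` V r \<subseteq> T -` U \<inter> topspace Gc_topology"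
      proof
        fix t assume t: "t \<in> (+) x ` V r"
        then obtain y where y: "t = x + y" "y \<in> Gc" "gen_abs (T y) < r" by (auto simp: V_def)
        have eq: "T t - z = (T x - z) + T y" using lin xG y by (simp add: gen_linear_on_def)
        have "gen_abs (T x - z) < r" using x U by simp
        then have "gen_abs (T t - z) < r" unfolding eq by (rule gen_abs_add_less[OF _ y(3) U(2)])
        then have "T t \<in> U" by (simp add: U(1))
        moreover have "t \<in> topspace Gc_topology" using coset[OF xG U(2)] t openin_subset by blast
        ultimately show "t \<in> T -` U \<inter> topspace Gc_topology" by simp
      qed
      ultimately show "\<exists>W. openin Gc_topology W \<and> x \<in> W \<and> W \<subseteq> T -` U \<inter> topspace Gc_topology"
        using coset[OF xG U(2)] by auto
    qed
  next
    show "T ` topspace Gc_topology \<subseteq> \<Union> {{w \<in> UNIV. p (w - u) < r} | p u r. p \<in> {gen_abs} \<and> u \<in> UNIV \<and> 0 < r}"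
    proof
      fix z :: "complex gen"
      have "{w \<in> UNIV. gen_abs (w - z) < 1} \<in> {{w \<in> UNIV. p (w - u) < r} | p u r. p \<in> {gen_abs} \<and> u \<in> UNIV \<and> 0 < r}"
        by (auto intro!: exI[of _ z] exI[of _ "1::real"])
      moreover have "z \<in> {w \<in> UNIV. gen_abs (w - z) < 1}" by (simp add: gen_abs_0)
      ultimately show "z \<in> \<Union> {{w \<in> UNIV. p (w - u) < r} | p u r. p \<in> {gen_abs} \<and> u \<in> UNIV \<and> 0 < r}" by blast
    qed
  qed
  then show ?thesis using lin by (simp add: dual_Gc_def T_def[abs_def])
qed

section \<open>Basic functionals\<close>

lemma test_functions_C_infinity_on:
  assumes "f \<in> test_functions"
  shows "f \<in> C_infinity_on (tsupp f)" "compact (tsupp f)"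
  using assms by (auto simp: test_functions_def C_infinity_on_def)

lemma C_infinity_on_mono: "f \<in> C_infinity_on K \<Longrightarrow> K \<subseteq> K' \<Longrightarrow> f \<in> C_infinity_on K'"
  by (auto simp: C_infinity_on_def)

text \<open>
  No lower bound on the coefficients is available for a single symbol, so the zero symbol, for which the
  composition is \<open>0\<close>, has to be treated separately.
\<close>

lemma distribution_compose_sol:
  fixes V :: "'n::finite cfun \<Rightarrow> complex"
  assumes "compact_distribution V"
  shows "distribution (\<lambda>f. V (sol m a f))"
proof -
  have lin: "clinear_on C_infinity V" using assms by (simp add: compact_distribution_def)
  obtain L j C where V: "compact L" "\<And>f. f \<in> C_infinity \<Longrightarrow> cmod (V f) \<le> C * seminorm L j f"
    using assms unfolding compact_distribution_def by blast
  have sm: "sol m a f \<in> C_infinity" if "f \<in> C_infinity_on K" "compact K" for f K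
    using smooth_sol[OF that] by (simp add: C_infinity_def)
  have "clinear_on test_functions (\<lambda>f. V (sol m a f))"
    unfolding clinear_on_def
  proof (intro conjI ballI allI)
    fix f g :: "'n cfun" assume f: "f \<in> test_functions" and g: "g \<in> test_functions"
    let ?K = "tsupp f \<union> tsupp g"
    have K: "compact ?K" "f \<in> C_infinity_on ?K" "g \<in> C_infinity_on ?K"
      using test_functions_C_infinity_on[OF f] test_functions_C_infinity_on[OF g]
      by (auto intro: C_infinity_on_mono)
    show "V (sol m a (\<lambda>x. f x + g x)) = V (sol m a f) + V (sol m a g)"
      using lin sm[OF K(2,1)] sm[OF K(3,1)] unfolding sol_add[OF K(2,3,1)] clinear_on_def by blast
  next
    fix b and f :: "'n cfun" assume f: "f \<in> test_functions"
    show "V (sol m a (\<lambda>x. b * f x)) = b * V (sol m a f)"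
      using lin sm[OF test_functions_C_infinity_on[OF f]] unfolding sol_cmult clinear_on_def by blast
  qed
  moreover have "\<exists>j C. \<forall>f\<in>C_infinity_on K. cmod (V (sol m a f)) \<le> C * seminorm K j f" if K: "compact K" for K
  proof (cases "nonzero_coeffs m a")
    case True
    then obtain \<alpha> where \<alpha>: "mi_order \<alpha> \<le> m" "a \<alpha> \<noteq> 0" by (auto simp: nonzero_coeffs_def)
    obtain C' where C': "\<And>w l. w \<in> C_infinity_on K \<Longrightarrow>
        seminorm L l (sol m a w) \<le> C' / cmod (a \<alpha>) * seminorm K (m + 2 * CARD('n) + l) w"
      using seminorm_sol_le[OF K V(1), of m] \<alpha> by blast
    have "cmod (V (sol m a f)) \<le> max C 0 * (C' / cmod (a \<alpha>)) * seminorm K (m + 2 * CARD('n) + j) f"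
      if f: "f \<in> C_infinity_on K" for f
    proof -
      have "0 \<le> seminorm L j (sol m a f)" by (rule seminorm_nonneg[OF V(1) smooth_sol[OF f K]])
      then have "cmod (V (sol m a f)) \<le> max C 0 * seminorm L j (sol m a f)"
        using V(2)[OF sm[OF f K]] mult_right_mono[of C "max C 0"] by fastforce
      also have "\<dots> \<le> max C 0 * (C' / cmod (a \<alpha>) * seminorm K (m + 2 * CARD('n) + j) f)"
        by (intro mult_left_mono C' f) simp
      finally show ?thesis by (simp only: mult.assoc)
    qed
    then show ?thesis by blast
  next
    case False
    have "V (\<lambda>x. 0 * 0) = 0 * V (\<lambda>_. 0)"
      using lin unfolding clinear_on_def C_infinity_def by fastforce
    then have "V (sol m a f) = 0" for f by (simp add: sol_eq_0[OF False])
    then show ?thesis by (intro exI[of _ 0] exI[of _ 0]) simp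
  qed
  ultimately show ?thesis by (simp add: distribution_def)
qed

lemma dual_bounds_compose_sol:
  fixes a :: "('n::finite \<Rightarrow> nat) \<Rightarrow> real \<Rightarrow> complex"
  assumes a: "moderately_nonzero m a" and K: "compact K" "compact L" and V: "dual_bounds C_infinity L V"
  shows "dual_bounds (C_infinity_on K) K (\<lambda>e f. V e (sol m (\<lambda>\<alpha>. a \<alpha> e) f))"
proof -
  obtain j N :: nat and c \<eta> :: real where "0 < c" "\<eta> \<in> {0<..1}" and V:
    "\<And>f e. f \<in> C_infinity \<Longrightarrow> e \<in> {0<..\<eta>} \<Longrightarrow> cmod (V e f) \<le> c * e powr - real N * seminorm L j f"
    using V unfolding dual_bounds_def by blast
  obtain C and N' :: nat where "0 < C" and ev: "eventually (\<lambda>e. \<forall>w\<in>C_infinity_on K. \<forall>l. seminorm L l (sol m (\<lambda>\<alpha>. a \<alpha> e) w)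
      \<le> C * e powr - real N' * seminorm K (m + 2 * CARD('n) + l) w) (at_right 0)"
    by (rule sol_net_estimate[OF a K])
  from ev obtain b where "0 < b" and b: "\<And>e w l. 0 < e \<Longrightarrow> e < b \<Longrightarrow> w \<in> C_infinity_on K \<Longrightarrow>
      seminorm L l (sol m (\<lambda>\<alpha>. a \<alpha> e) w) \<le> C * e powr - real N' * seminorm K (m + 2 * CARD('n) + l) w"
    unfolding eventually_at_right_field by blast
  have "cmod (V e (sol m (\<lambda>\<alpha>. a \<alpha> e) f)) \<le> (c * C) * e powr - real (N + N') * seminorm K (m + 2 * CARD('n) + j) f"
    if f: "f \<in> C_infinity_on K" and e: "e \<in> {0<..min \<eta> (b / 2)}" for e f
  proof -
    have e': "0 < e" "e < b" "e \<in> {0<..\<eta>}" using e \<open>0 < b\<close> by auto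
    have "sol m (\<lambda>\<alpha>. a \<alpha> e) f \<in> C_infinity" using smooth_sol[OF f K(1)] by (simp add: C_infinity_def)
    then have "cmod (V e (sol m (\<lambda>\<alpha>. a \<alpha> e) f)) \<le> c * e powr - real N * seminorm L j (sol m (\<lambda>\<alpha>. a \<alpha> e) f)"
      using e' by (intro V)
    also have "\<dots> \<le> c * e powr - real N * (C * e powr - real N' * seminorm K (m + 2 * CARD('n) + j) f)"
      using \<open>0 < c\<close> by (intro mult_left_mono b e' f) auto
    also have "\<dots> = (c * C) * (e powr - real N * e powr - real N') * seminorm K (m + 2 * CARD('n) + j) f" by simp
    also have "e powr - real N * e powr - real N' = e powr - real (N + N')" by (simp add: powr_add[symmetric])
    finally show ?thesis .
  qed
  moreover have "min \<eta> (b / 2) \<in> {0<..1}" using \<open>\<eta> \<in> {0<..1}\<close> \<open>0 < b\<close> by auto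
  moreover have "0 < c * C" using \<open>0 < c\<close> \<open>0 < C\<close> by simp
  ultimately show ?thesis unfolding dual_bounds_def by blast
qed

text \<open>
If the net \<open>V\<close> represents \<open>v\<close>, then the net of the compositions with \<^const>\<open>sol\<close> represents the composition with \<^const>\<open>gsol\<close>.
\<close>

theorem dual_sol_in_basic_dual_Gc:
  assumes a: "moderately_nonzero m a" and v: "v \<in> basic_dual_G"
  shows "(\<lambda>w. v (gsol m a w)) \<in> basic_dual_Gc"
proof -
  from v obtain V L where "v \<in> dual_G" and V: "\<And>e. e \<in> {0<..1} \<Longrightarrow> compact_distribution (V e)"
    "compact L" "dual_bounds C_infinity L V" "\<And>u. moderate_fnet u \<Longrightarrow> v (abs_colombeau u) = abs_gen (\<lambda>e. V e (u e))"
    unfolding basic_dual_G_def by blast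
  have "v (gsol m a (abs_colombeau u)) = abs_gen (\<lambda>e. V e (sol m (\<lambda>\<alpha>. a \<alpha> e) (u e)))"
    if u: "moderate_fnet u" "compact K" "\<forall>e\<in>{0<..1}. tsupp (u e) \<subseteq> K" for u K
  proof -
    have "test_net K u" using u by (simp add: test_net_def C_infinity_on_def moderate_fnet_def)
    then have r: "represents u (abs_colombeau u)" using u by (auto simp: represents_def)
    show ?thesis
      unfolding gsol_eq[OF a r] V(4)[OF represents_sol_moderate[OF a r]] sol_net_def ..
  qed
  then show ?thesis
    unfolding basic_dual_Gc_def
    using dual_sol_in_dual_Gc[OF a \<open>v \<in> dual_G\<close>] distribution_compose_sol[OF V(1)] dual_bounds_compose_sol[OF a _ V(2,3)]
    by (intro CollectI conjI exI[of _ "\<lambda>e f. V e (sol m (\<lambda>\<alpha>. a \<alpha> e) f)"]) auto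
qed

section \<open>Solvability\<close>

theorem theorem2p6:
  fixes m :: nat
    and c :: "('n::finite \<Rightarrow> nat) \<Rightarrow> complex gen"
    and \<xi>0 :: "real ^ 'n"
  assumes "gen_weight m c \<xi>0 dvd 1"
  shows "(\<forall>v \<in> Gc. \<exists>u. diff_op m c u = v) \<and>
    (\<forall>v \<in> Ginf \<inter> Gc. \<exists>u \<in> Ginf. diff_op m c u = v) \<and>
    (\<forall>v \<in> dual_G. \<exists>u \<in> dual_Gc. \<forall>w \<in> Gc. diff_op_dual m c u w = v w) \<and>
    (\<forall>v \<in> basic_dual_G. \<exists>u \<in> basic_dual_Gc. \<forall>w \<in> Gc. diff_op_dual m c u w = v w)"
proof -
  define a where "a \<alpha> = rep_gen (c \<alpha>)" for \<alpha>
  have a: "moderately_nonzero m a" "\<And>\<alpha>. moderate (a \<alpha>)" "\<And>\<alpha>. c \<alpha> = abs_gen (a \<alpha>)"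
    using invertible_weight_imp_moderately_nonzero[OF assms] by (simp_all add: a_def[abs_def] moderate_rep_gen abs_rep_gen)
  have b: "moderately_nonzero m (net_transpose a)" using a(1) by (simp add: moderately_nonzero_transpose)
  have "\<exists>u. diff_op m c u = v" if "v \<in> Gc" for v
    using represents_ex[OF that] diff_op_gsol_transpose[OF a] by blast
  moreover have "\<exists>u\<in>Ginf. diff_op m c u = v" if v: "v \<in> Ginf \<inter> Gc" for v
  proof -
    from v have "compact (gsupp v)" by (simp add: Gc_def)
    from compact_representative[OF this] v obtain u K where u: "compact K" "moderate_fnet u" "test_net K u"
      "abs_colombeau u = v" "regular_fnet u" by blast
    then have r: "represents u v" by (auto simp: represents_def)
    have "abs_colombeau (sol_net m (net_transpose a) u) \<in> Ginf"
      unfolding Ginf_def using regular_sol_net[OF b u(3,1,5)] moderate_sol_net[OF b u(3,1,2)] by blast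
    then show ?thesis using diff_op_gsol_transpose[OF a r] by blast
  qed
  moreover have "diff_op_dual m c (\<lambda>w. v (gsol m a w)) w = v w" if "w \<in> Gc" for v w
    by (simp add: diff_op_dual_def gsol_diff_op_transpose[OF a that])
  ultimately show ?thesis
    using dual_sol_in_dual_Gc[OF a(1)] dual_sol_in_basic_dual_Gc[OF a(1)] by blast
qed

end
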